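(* Let $n,m\in\mathbb{N}$, $0<T<\infty$, $0<\gamma<1$, let $\Omega\subset\mathbb{R}^n$ be an open bounded set with piecewise smooth boundary, and let $q\in\Omega$ be a fixed point. Let $u_0$, $h_1$, $h_2$ be given functions satisfying: 1) $u_0\in C^{4m,\gamma}(\Omega)$ and $\operatorname{supp}(u_0)\subset\Omega$; 2) $h_1\in C^1[0,T]$; 3) $h_2\in C[0,T]$ is such that $h_2(t)\ne0$ for all $0\le t\le T$ (which also implies $v(0,x)|_{x=q}=-(-\Delta_x)^m u_0(x)|_{x=q}=h_2(0)\neq0$ for the function $v$ below); 4) the function $\alpha=\frac{h_1'}{h_2}$ ensures that the equation $\partial_tu+\alpha(t)(-\Delta_x)^mu=0$ is uniformly parabolic in the sense of Petrovskii. Then there exists a unique solution of the following inverse problem, in which the coefficient $\alpha=\alpha(t)$ and the functions $u,v$ are unknown: $$\begin{cases}\partial_t u(t,x)+\alpha(t)(-\Delta_x)^m u(t,x)=0, & 0<t\le T,\ x\in\mathbb{R}^n,\\ u(t,x)|_{t=0}=u_0(x), & x\in\mathbb{R}^n,\\ u(t,x)|_{x=q}=h_1(t), & 0\le t\le T,\end{cases}$$ and $$\begin{cases}\partial_t v(t,x)+\alpha(t)(-\Delta_x)^m v(t,x)=0, & 0<t\le T,\ x\in\mathbb{R}^n,\\ v(t,x)|_{t=0}=-(-\Delta_x)^m u_0(x), & x\in\mathbb{R}^n,\\ v(t,x)|_{x=q}=h_2(t), & 0\le t\le T,\end{cases}$$ and the coefficient $\alpha\in C[0,T]$ is given by $\alpha(t)=\frac{h_1'(t)}{h_2(t)}$,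 $0\le t\le T$.
   Context: Here $\Delta_x=\sum_{j=1}^n\partial_{x_j}^2$ is the Laplacian on $\mathbb{R}^n$; $C^{k,\gamma}(\Omega)$ is the space of $k$ times differentiable functions with $\gamma$-Hölder continuous derivatives of order $k$; $u_0$ and its derivatives are extended by zero outside $\Omega$. Solving the inverse problem means finding the coefficient $\alpha$ together with the solutions $u,v$ of the two Cauchy problems (both with the same $\alpha$) that satisfy the additional data at $q$. The coefficient is sought among $\alpha\in C[0,T]$ for which the equation is uniformly parabolic in the sense of Petrovskii; for the equation $\partial_tu+\alpha(t)(-\Delta_x)^mu=0$ this means that there is $\delta>0$ with $\alpha(t)|\xi|^{2m}\ge\delta|\xi|^{2m}$ for all $t\in[0,T]$, $\xi\in\mathbb{R}^n$. For such $\alpha$ and compactly supported $u_0\in C^{2m,\gamma}(\Omega)$, the Cauchy problem with initial datum $u_0$ has a unique solution $u\in C^{2m,\gamma,0}([0,T]\times\Omega)$ (space derivatives up to order $2m$, those of top order $\gamma$-Hölder in $x$, continuous in $t$), given by the Poisson integral $u(t,x)=\int_\Omega E_{\alpha_1}(t,x-y)u_0(y)\,dy$, where $\alpha_1(t)=\int_0^t\alpha(s)\,ds$ and $E_{\alpha_1}(t,x)=(2\pi)^{-n}\int_{\mathbb{R}^n}e^{ix\cdot s-|s|^{2m}\alpha_1(t)}\,ds$; "solution" of the Cauchy problems is understood in this sense.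
   Formalization: As stated, existence fails for some data, so two necessary conditions are added: h_1(0)=u_0(q), and every solution v of the second Cauchy problem with α=h_1'/h_2 has v(t,q)=h_2(t) on [0,T]. Solutions are bounded, with continuous space derivatives up to order 2m on [0,T]×R^n. *)

theory Defs
  imports "HOL-Analysis.Analysis"
begin

definition partial_deriv :: "'n \<Rightarrow> (real ^ 'n \<Rightarrow> real) \<Rightarrow> real ^ 'n \<Rightarrow> real" where
  "partial_deriv i f x = deriv (\<lambda>h. f (x + h *\<^sub>R axis i 1)) 0"

definition iter_partial :: "'n list \<Rightarrow> (real ^ 'n \<Rightarrow> real) \<Rightarrow> real ^ 'n \<Rightarrow> real" where
  "iter_partial is f = foldr partial_deriv is f"

definition neg_laplacian :: "(real ^ 'n \<Rightarrow> real) \<Rightarrow> real ^ 'n \<Rightarrow> real" where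
  "neg_laplacian f x = - (\<Sum>i\<in>UNIV. partial_deriv i (partial_deriv i f) x)"

abbreviation neg_laplacian_pow :: "nat \<Rightarrow> (real ^ 'n \<Rightarrow> real) \<Rightarrow> real ^ 'n \<Rightarrow> real" where
  "neg_laplacian_pow m \<equiv> neg_laplacian ^^ m"

definition Holder_on :: "real \<Rightarrow> (real ^ 'n) set \<Rightarrow> (real ^ 'n \<Rightarrow> real) \<Rightarrow> bool" where
  "Holder_on \<gamma> S f \<longleftrightarrow> (\<exists>C. \<forall>x\<in>S. \<forall>y\<in>S. \<bar>f x - f y\<bar> \<le> C * dist x y powr \<gamma>)"

text \<open>The space \<open>C\<^sup>k\<^sup>,\<^sup>\<gamma>(S)\<close> for open \<open>S\<close>. Continuity of the derivatives is implied: those of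
  order below \<open>k\<close> are differentiable, those of order \<open>k\<close> are Hoelder continuous.\<close>

definition Ck_Holder_on ::
  "nat \<Rightarrow> real \<Rightarrow> (real ^ 'n) set \<Rightarrow> (real ^ 'n \<Rightarrow> real) \<Rightarrow> bool" where
  "Ck_Holder_on k \<gamma> S f \<longleftrightarrow>
     (\<forall>is. length is < k \<longrightarrow> (\<forall>x\<in>S. iter_partial is f differentiable (at x))) \<and>
     (\<forall>is. length is = k \<longrightarrow> Holder_on \<gamma> S (iter_partial is f))"

text \<open>Functions \<open>u(t,x)\<close> on \<open>[0,T] \<times> S\<close> whose space derivatives up to order \<open>k\<close> exist and are
  continuous in \<open>(t,x)\<close>.\<close>

definition Ck_space_on ::
  "nat \<Rightarrow> real \<Rightarrow> (real ^ 'n) set \<Rightarrow> (real \<Rightarrow> real ^ 'n \<Rightarrow> real) \<Rightarrow> bool" where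
  "Ck_space_on k T S u \<longleftrightarrow>
     (\<forall>t\<in>{0..T}. \<forall>is. length is < k \<longrightarrow>
        (\<forall>x\<in>S. iter_partial is (u t) differentiable (at x))) \<and>
     (\<forall>is. length is \<le> k \<longrightarrow>
        continuous_on ({0..T} \<times> S) (\<lambda>(t, x). iter_partial is (u t) x))"

text \<open>The space \<open>C\<^sup>k\<^sup>,\<^sup>\<gamma>\<^sup>,\<^sup>0([0,T] \<times> S)\<close>; the Hoelder constant is uniform in \<open>t\<close>.\<close>

definition Ck_Holder_space_on ::
  "nat \<Rightarrow> real \<Rightarrow> real \<Rightarrow> (real ^ 'n) set \<Rightarrow> (real \<Rightarrow> real ^ 'n \<Rightarrow> real) \<Rightarrow> bool" where
  "Ck_Holder_space_on k \<gamma> T S u \<longleftrightarrow> Ck_space_on k T S u \<and>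
     (\<forall>is. length is = k \<longrightarrow>
        (\<exists>C. \<forall>t\<in>{0..T}. \<forall>x\<in>S. \<forall>y\<in>S.
           \<bar>iter_partial is (u t) x - iter_partial is (u t) y\<bar> \<le> C * dist x y powr \<gamma>))"

text \<open>A compact piece of a regular \<open>C\<^sup>1\<close> hypersurface \<open>M\<close> (given as a level set): the closure
  of a relatively open part of \<open>M\<close>, contained in \<open>M\<close>. A boundary is piecewise smooth if it is a
  finite union of such pieces; \<open>C\<^sup>1\<close> pieces also cover the reading with \<open>C\<^sup>\<infinity>\<close> pieces.\<close>

definition smooth_surface_piece :: "(real ^ 'n) set \<Rightarrow> bool" where
  "smooth_surface_piece P \<longleftrightarrow>
     (\<exists>U V (\<phi> :: real ^ 'n \<Rightarrow> real) D.
        open U \<and> open V \<and>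
        (\<forall>x\<in>U. (\<phi> has_derivative (\<lambda>h. D x \<bullet> h)) (at x)) \<and> continuous_on U D \<and>
        (\<forall>x\<in>U. \<phi> x = 0 \<longrightarrow> D x \<noteq> 0) \<and>
        compact P \<and> P \<subseteq> {x \<in> U. \<phi> x = 0} \<and> P = closure (V \<inter> {x \<in> U. \<phi> x = 0}))"

definition piecewise_smooth_boundary :: "(real ^ 'n) set \<Rightarrow> bool" where
  "piecewise_smooth_boundary \<Omega> \<longleftrightarrow>
     (\<exists>F. finite F \<and> (\<forall>P\<in>F. smooth_surface_piece P) \<and> frontier \<Omega> = \<Union>F)"

text \<open>Uniform parabolicity (Petrovskii) of \<open>\<partial>\<^sub>tu + \<alpha>(t)(-\<Delta>)\<^sup>mu = 0\<close>; the first
  argument fixes the space \<open>\<real>\<^sup>n\<close>.\<close>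

definition petrovskii_parabolic ::
  "'n::finite itself \<Rightarrow> nat \<Rightarrow> real \<Rightarrow> (real \<Rightarrow> real) \<Rightarrow> bool" where
  "petrovskii_parabolic _ m T \<alpha> \<longleftrightarrow>
     (\<exists>\<delta>>0. \<forall>t\<in>{0..T}. \<forall>\<xi> :: real ^ 'n. \<alpha> t * norm \<xi> ^ (2 * m) \<ge> \<delta> * norm \<xi> ^ (2 * m))"

text \<open>Solutions of \<open>\<partial>\<^sub>tu + \<alpha>(t)(-\<Delta>)\<^sup>mu = 0\<close> on \<open>(0,T] \<times> \<real>\<^sup>n\<close>, \<open>u(0,\<cdot>) = g\<close>, of class
  \<open>C\<^sup>2\<^sup>m\<^sup>,\<^sup>\<gamma>\<^sup>,\<^sup>0([0,T] \<times> \<Omega>)\<close>. Boundedness on \<open>[0,T] \<times> \<real>\<^sup>n\<close> holds for the Poisson integral and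
  excludes Tychonoff-type null solutions of the whole-space problem, which are of class
  \<open>C\<^sup>2\<^sup>m\<^sup>,\<^sup>\<gamma>\<^sup>,\<^sup>0\<close> on bounded sets and may even vanish at a given point for all times.\<close>

definition cauchy_solution ::
  "nat \<Rightarrow> real \<Rightarrow> real \<Rightarrow> (real ^ 'n) set \<Rightarrow> (real \<Rightarrow> real) \<Rightarrow> (real ^ 'n \<Rightarrow> real) \<Rightarrow>
   (real \<Rightarrow> real ^ 'n \<Rightarrow> real) \<Rightarrow> bool" where
  "cauchy_solution m \<gamma> T \<Omega> \<alpha> g u \<longleftrightarrow>
     Ck_Holder_space_on (2 * m) \<gamma> T \<Omega> u \<and>
     Ck_space_on (2 * m) T UNIV u \<and>
     (\<exists>B. \<forall>t\<in>{0..T}. \<forall>x. \<bar>u t x\<bar> \<le> B) \<and>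
     (\<forall>t\<in>{0<..T}. \<forall>x.
        ((\<lambda>s. u s x) has_real_derivative - \<alpha> t * neg_laplacian_pow m (u t) x)
          (at t within {0..T})) \<and>
     (\<forall>x. u 0 x = g x)"

text \<open>The kernel \<open>E\<^sub>a(x) = (2\<pi>)\<^sup>-\<^sup>n \<integral> exp (i x\<cdot>s - |s|\<^sup>2\<^sup>m a) ds\<close>.\<close>

definition poisson_kernel :: "nat \<Rightarrow> real \<Rightarrow> real ^ 'n \<Rightarrow> complex" where
  "poisson_kernel m a x =
     1 / of_real ((2 * pi) ^ CARD('n)) *
     (LINT s|lborel. exp (\<i> * of_real (x \<bullet> s) - of_real (norm s ^ (2 * m) * a)))"

definition poisson_integral ::
  "nat \<Rightarrow> (real ^ 'n) set \<Rightarrow> (real \<Rightarrow> real) \<Rightarrow> (real ^ 'n \<Rightarrow> real) \<Rightarrow> real \<Rightarrow> real ^ 'n \<Rightarrow> complex" where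
  "poisson_integral m \<Omega> \<alpha> g t x =
     (LINT y:\<Omega>|lborel. poisson_kernel m (integral {0..t} \<alpha>) (x - y) * of_real (g y))"

definition inverse_solution ::
  "nat \<Rightarrow> real \<Rightarrow> real \<Rightarrow> (real ^ 'n) set \<Rightarrow> real ^ 'n \<Rightarrow> (real ^ 'n \<Rightarrow> real) \<Rightarrow>
   (real \<Rightarrow> real) \<Rightarrow> (real \<Rightarrow> real) \<Rightarrow>
   (real \<Rightarrow> real) \<Rightarrow> (real \<Rightarrow> real ^ 'n \<Rightarrow> real) \<Rightarrow> (real \<Rightarrow> real ^ 'n \<Rightarrow> real) \<Rightarrow> bool" where
  "inverse_solution m \<gamma> T \<Omega> q u0 h1 h2 \<alpha> u v \<longleftrightarrow>
     continuous_on {0..T} \<alpha> \<and> petrovskii_parabolic TYPE('n) m T \<alpha> \<and>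
     cauchy_solution m \<gamma> T \<Omega> \<alpha> u0 u \<and>
     (\<forall>t\<in>{0..T}. u t q = h1 t) \<and>
     cauchy_solution m \<gamma> T \<Omega> \<alpha> (\<lambda>x. - neg_laplacian_pow m u0 x) v \<and>
     (\<forall>t\<in>{0..T}. v t q = h2 t)"

end

theory Submission
  imports Defs "HOL-Probability.Sinc_Integral" "HOL-Probability.Characteristic_Functions"
begin

text \<open>The key identity is \<open>(-\<Delta>)\<^sup>m u = - v\<close>: the operator \<open>(-\<Delta>)\<^sup>m\<close> commutes with the
solution operator of the Cauchy problem, so applying it to \<open>u\<close> gives the solution with initial
datum \<open>(-\<Delta>)\<^sup>m u0\<close>. The equation for \<open>u\<close> at the point \<open>q\<close> therefore reads \<open>h1' = \<alpha> h2\<close>. For a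
given solution of the inverse problem this forces \<open>\<alpha> = h1' / h2\<close>; conversely, with this \<open>\<alpha>\<close>, the
functions \<open>u(\<cdot>, q)\<close> and \<open>h1\<close> have the same derivative and the same initial value. What remains is
the theory of the Cauchy problem itself: existence in the class of \<open>cauchy_solution\<close>, the Poisson
formula, and uniqueness among bounded solutions.

Existence (\<open>cauchy_solution_kernel_average\<close>). The kernel is \<open>E\<^sub>a(x) = r\<^sup>-\<^sup>n E\<^sub>1(x / r)\<close> with
\<open>r\<^sup>2\<^sup>m = a\<close>, so the Poisson integral equals \<open>\<integral> E\<^sub>1(z) g(x - r z) dz\<close>. Since \<open>E\<^sub>1\<close> is integrable
with integral one, this formula also makes sense for \<open>r = 0\<close>, where it gives the initial datum,
and all space derivatives, their joint continuity up to \<open>t = 0\<close> and their Hoelder bounds are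
inherited from \<open>g\<close> by dominated convergence. Integrability of \<open>E\<^sub>1\<close> (\<open>poisson_kernel_decay\<close>) follows
by partial integration, because \<open>exp (-|s|\<^sup>2\<^sup>m)\<close> lies in a class of rapidly decaying functions that is
closed under differentiation; its integral (\<open>poisson_kernel_integral\<close>) is found by testing with
wide Gaussians, whose Fourier integrals are explicit. The derivative with respect to \<open>a\<close>
(\<open>kernel_average_root_has_derivative\<close>) is read off from the Fourier representation.

Uniqueness (\<open>bounded_solution_unique\<close>). Only the solution is bounded; nothing is known about the growth
of its derivatives. The difference \<open>d\<close> of two solutions is tested with a product \<open>\<psi>\<close> of band-limited
functions, all of whose derivatives satisfy \<open>\<parallel>\<partial>\<^sup>\<beta>\<psi>\<parallel> \<le> C M\<^bsup>|\<beta>|\<^esup>\<close> in \<open>L\<^sup>1\<close>. Cutoffs justify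
moving the operator to \<open>\<psi>\<close>, so that \<open>F\<^sub>k(t) = \<integral> d(t) (-\<Delta>)\<^sup>m\<^sup>k\<psi>\<close> satisfies
\<open>|F\<^sub>k(t)| \<le> A \<integral>\<^sub>0\<^sup>t |F\<^sub>k\<^sub>+\<^sub>1|\<close>. Iterating \<open>j\<close> times bounds \<open>F\<^sub>0(t)\<close> by
\<open>C (A' t)\<^sup>j / j!\<close>, where \<open>A'\<close> is independent of \<open>j\<close>, hence \<open>F\<^sub>0 = 0\<close>
(\<open>bounded_solution_tested_zero\<close>). Rescaling \<open>\<psi>\<close> to an approximate identity gives \<open>d = 0\<close>.\<close>

section \<open>Lebesgue integrals with parameters\<close>

text \<open>The standard bound for functions on \<open>\<real>\<^sup>n\<close>: it is integrable as a product of integrable functions of one variable, and translations by at most one along a coordinate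
axis change it by a bounded factor only.\<close>

definition weight :: "real ^ 'n::finite \<Rightarrow> real" where
  "weight x = (\<Prod>i\<in>UNIV. 1 / (1 + (x $ i)\<^sup>2))"

lemma prod_lborel_integral:
  fixes f :: "'n::finite \<Rightarrow> real \<Rightarrow> 'b::{real_normed_field,banach,second_countable_topology}"
  assumes f: "\<And>i. integrable lborel (f i)"
  shows integrable_prod_coords: "integrable lborel (\<lambda>x::real^'n. \<Prod>i\<in>UNIV. f i (x $ i))"
    and integral_prod_coords:
      "(LINT x|lborel. (\<Prod>i\<in>UNIV. f i ((x::real^'n) $ i))) = (\<Prod>i\<in>UNIV. LINT y|lborel. f i y)"
proof -
  interpret P: product_sigma_finite "\<lambda>_::real^'n. lborel::real measure" by standard
  define ix :: "real^'n \<Rightarrow> 'n" where "ix = inv (\<lambda>i. axis i 1)"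
  have inj: "inj (\<lambda>i::'n. axis i (1::real))" by (auto simp: inj_on_def axis_eq_axis)
  have ix: "ix (axis i 1) = i" for i unfolding ix_def by (rule inv_f_f[OF inj])
  have B: "(Basis :: (real^'n) set) = range (\<lambda>i. axis i 1)" by (auto simp: Basis_vec_def)
  \<comment> \<open>coordinates are rewritten as inner products with the basis, over which \<open>lborel\<close> is a product measure\<close>
  have re: "(\<Prod>i\<in>UNIV. f i (x $ i)) = (\<Prod>b\<in>Basis. f (ix b) (x \<bullet> b))" for x :: "real^'n"
    unfolding B by (subst prod.reindex[OF inj]) (simp add: ix inner_axis)
  have m: "(\<lambda>x::real^'n. \<Prod>i\<in>UNIV. f i (x $ i)) \<in> borel_measurable borel"
    using borel_measurable_integrable[OF f] by measurable
  have mm: "(\<lambda>z. \<Sum>b\<in>(Basis::(real^'n) set). z b *\<^sub>R b) \<in> measurable (\<Pi>\<^sub>M b\<in>Basis. lborel) borel"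
    by measurable
  have eq: "(\<Prod>b\<in>(Basis::(real^'n) set). f (ix b) ((\<Sum>b\<in>Basis. z b *\<^sub>R b) \<bullet> b)) = (\<Prod>b\<in>Basis. f (ix b) (z b))" for z
    by (intro prod.cong refl) (simp add: inner_sum_left_Basis)
  show "integrable lborel (\<lambda>x::real^'n. \<Prod>i\<in>UNIV. f i (x $ i))"
    apply (subst lborel_eq, subst integrable_distr_eq[OF mm m])
    unfolding re eq by (rule P.product_integrable_prod) (auto simp: f)
  have "(LINT x|lborel. (\<Prod>i\<in>UNIV. f i ((x::real^'n) $ i))) = (\<Prod>b\<in>(Basis::(real^'n) set). LINT y|lborel. f (ix b) y)"
    apply (subst lborel_eq, subst integral_distr[OF mm m])
    unfolding re eq by (rule P.product_integral_prod) (auto simp: f)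
  also have "\<dots> = (\<Prod>i\<in>UNIV. LINT y|lborel. f i y)"
    unfolding B by (subst prod.reindex[OF inj]) (simp add: ix)
  finally show "(LINT x|lborel. (\<Prod>i\<in>UNIV. f i ((x::real^'n) $ i))) = (\<Prod>i\<in>UNIV. LINT y|lborel. f i y)" .
qed

lemma integrable_inv_1_plus_square: "integrable lborel (\<lambda>x::real. 1 / (1 + x\<^sup>2))"
  using integrable_inverse_1_plus_square by (simp add: set_integrable_def einterval_def inverse_eq_divide)

lemma integrable_weight: "integrable lborel weight"
  unfolding weight_def[abs_def] by (rule integrable_prod_coords) (rule integrable_inv_1_plus_square)

lemma weight_pos: "0 < weight x"
  unfolding weight_def by (intro prod_pos) (auto simp: add_pos_nonneg)

lemma borel_measurable_weight [measurable]: "weight \<in> borel_measurable borel"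
  using borel_measurable_integrable[OF integrable_weight] by simp

text \<open>Through this estimate a pointwise bound by the weight dominates a whole neighbourhood in
the parameter \<open>h\<close>, as differentiation under the integral sign requires.\<close>

lemma weight_shift:
  assumes "\<bar>h\<bar> \<le> 1"
  shows "weight (x + h *\<^sub>R axis i 1) \<le> 3 * weight x"
proof -
  have 1: "1 / (1 + (y + h)\<^sup>2) \<le> 3 * (1 / (1 + y\<^sup>2))" for y
  proof -
    have "0 \<le> (2*y + 3*h)\<^sup>2" by simp
    moreover have "h\<^sup>2 \<le> 1" using assms by (simp add: abs_square_le_1)
    ultimately have "1 + y\<^sup>2 \<le> 3 * (1 + (y + h)\<^sup>2)"
      by (simp add: power2_eq_square algebra_simps)
    then show ?thesis by (simp add: field_simps add_pos_nonneg)
  qed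
  have sp: "weight z = (1 / (1 + (z $ i)\<^sup>2)) * (\<Prod>j\<in>UNIV-{i}. 1 / (1 + (z $ j)\<^sup>2))" for z :: "real^'a"
    unfolding weight_def by (subst prod.remove[of _ i]) auto
  have "(\<Prod>j\<in>UNIV-{i}. 1 / (1 + ((x + h *\<^sub>R axis i 1) $ j)\<^sup>2)) = (\<Prod>j\<in>UNIV-{i}. 1 / (1 + (x $ j)\<^sup>2))"
    by (intro prod.cong) (auto simp: axis_def)
  moreover have "(x + h *\<^sub>R axis i 1) $ i = x $ i + h" by simp
  ultimately show ?thesis
    unfolding sp[of x] sp[of "x + h *\<^sub>R axis i 1"] mult.assoc[symmetric]
    using 1[of "x $ i"] by (intro mult_mono) (auto intro!: prod_nonneg)
qed

lemma integral_translation: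
  fixes f :: "'a::euclidean_space \<Rightarrow> 'b::{banach,second_countable_topology}"
  shows "(LINT x|lborel. f (x + c)) = (LINT x|lborel. f x)"
    and "f \<in> borel_measurable borel \<Longrightarrow> integrable lborel (\<lambda>x. f (x + c)) \<longleftrightarrow> integrable lborel f"
proof -
  have *: "integrable lborel (\<lambda>x. f (x + c)) \<longleftrightarrow> integrable lborel f"
    if "f \<in> borel_measurable borel" for f :: "'a \<Rightarrow> 'b" and c
    using integrable_distr_eq[of "(+) c" lborel borel f] that
    by (simp add: lborel_distr_plus add.commute)
  show "f \<in> borel_measurable borel \<Longrightarrow> integrable lborel (\<lambda>x. f (x + c)) \<longleftrightarrow> integrable lborel f" by (rule *)
  show "(LINT x|lborel. f (x + c)) = (LINT x|lborel. f x)"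
  proof (cases "f \<in> borel_measurable borel")
    case True
    then show ?thesis using integral_distr[of "(+) c" lborel borel f]
      by (simp add: lborel_distr_plus add.commute)
  next
    case False
    have "(\<lambda>x. f (x + c)) \<notin> borel_measurable borel"
    proof
      assume "(\<lambda>x. f (x + c)) \<in> borel_measurable borel"
      from measurable_compose[OF _ this, of "\<lambda>x. x - c" borel] have "f \<in> borel_measurable borel" by simp
      with False show False by simp
    qed
    with False have "\<not> integrable lborel f" "\<not> integrable lborel (\<lambda>x. f (x + c))"
      using borel_measurable_integrable by fastforce+
    then show ?thesis by (simp add: not_integrable_integral_eq)
  qed
qed

lemma integral_scaling:
  fixes f :: "'a::euclidean_space \<Rightarrow> 'b::{banach,second_countable_topology}"
  assumes c: "c \<noteq> 0" and f: "f \<in> borel_measurable borel"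
  shows "(LINT x|lborel. f x) = \<bar>c\<bar> ^ DIM('a) *\<^sub>R (LINT x|lborel. f (t + c *\<^sub>R x))"
    and "integrable lborel f \<longleftrightarrow> integrable lborel (\<lambda>x. f (t + c *\<^sub>R x))"
proof -
  have e: "(lborel :: 'a measure) = density (distr lborel borel (\<lambda>x. t + c *\<^sub>R x)) (\<lambda>_. ennreal (\<bar>c\<bar> ^ DIM('a)))"
    using lborel_affine[of c t] c by simp
  show "(LINT x|lborel. f x) = \<bar>c\<bar> ^ DIM('a) *\<^sub>R (LINT x|lborel. f (t + c *\<^sub>R x))"
    apply (subst e) using f c by (simp add: integral_density integral_distr)
  show "integrable lborel f \<longleftrightarrow> integrable lborel (\<lambda>x. f (t + c *\<^sub>R x))"
  proof -
    have "integrable lborel f \<longleftrightarrow> integrable lborel (\<lambda>x. \<bar>c\<bar> ^ DIM('a) *\<^sub>R f (t + c *\<^sub>R x))"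
      apply (subst e) using f c by (simp add: integrable_density integrable_distr_eq)
    also have "\<dots> \<longleftrightarrow> integrable lborel (\<lambda>x. f (t + c *\<^sub>R x))" (is "?l \<longleftrightarrow> ?r")
    proof
      show "?r" if ?l
        using integrable_scaleR_right[OF that, of "1 / \<bar>c\<bar> ^ DIM('a)"] c by simp
    qed (rule integrable_scaleR_right)
    finally show ?thesis .
  qed
qed

text \<open>Dominated convergence for the difference quotients: on the convex set \<open>U\<close> the mean value
inequality turns the bound on \<open>f'\<close> into a Lipschitz bound with constant \<open>G z\<close>, so that the remainder
quotients are dominated by \<open>2 G\<close>.\<close>

lemma has_derivative_integral:
  fixes f :: "'p::real_normed_vector \<Rightarrow> 'z \<Rightarrow> 'b::{banach,second_countable_topology}"
  assumes U: "convex U" and x0: "x0 \<in> U"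
    and int: "\<And>x. x \<in> U \<Longrightarrow> integrable M (f x)"
    and der: "\<And>x z. x \<in> U \<Longrightarrow> z \<in> space M \<Longrightarrow> ((\<lambda>x. f x z) has_derivative f' x z) (at x within U)"
    and bnd: "\<And>x z h. x \<in> U \<Longrightarrow> z \<in> space M \<Longrightarrow> norm (f' x z h) \<le> G z * norm h"
    and G: "integrable M G"
    and meas: "\<And>h. (\<lambda>z. f' x0 z h) \<in> borel_measurable M"
  shows "((\<lambda>x. LINT z|M. f x z) has_derivative (\<lambda>h. LINT z|M. f' x0 z h)) (at x0 within U)"
proof -
  have lin: "bounded_linear (f' x0 z)" if "z \<in> space M" for z
    using der[OF x0 that] by (rule has_derivative_bounded_linear)
  have if': "integrable M (\<lambda>z. f' x0 z h)" for h
    by (rule Bochner_Integration.integrable_bound[OF integrable_mult_left[OF G, of "norm h"] meas])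
      (auto intro!: AE_I2 order_trans[OF bnd[OF x0]] simp: abs_mult mult_right_mono)
  have bl: "bounded_linear (\<lambda>h. LINT z|M. f' x0 z h)"
  proof (rule bounded_linear_intro)
    show "(LINT z|M. f' x0 z (x + y)) = (LINT z|M. f' x0 z x) + (LINT z|M. f' x0 z y)" for x y
      by (subst Bochner_Integration.integral_add[symmetric, OF if' if'])
        (auto intro!: Bochner_Integration.integral_cong simp: linear_add[OF bounded_linear.linear[OF lin]])
    show "(LINT z|M. f' x0 z (r *\<^sub>R x)) = r *\<^sub>R (LINT z|M. f' x0 z x)" for r x
    proof -
      have "(LINT z|M. f' x0 z (r *\<^sub>R x)) = (LINT z|M. r *\<^sub>R f' x0 z x)"
        by (intro Bochner_Integration.integral_cong refl linear_scale[OF bounded_linear.linear[OF lin]])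
      then show ?thesis by simp
    qed
    show "norm (LINT z|M. f' x0 z x) \<le> norm x * (LINT z|M. G z)" for x
    proof -
      have "norm (LINT z|M. f' x0 z x) \<le> (LINT z|M. G z * norm x)"
        by (rule order_trans[OF integral_norm_bound integral_mono]) (auto intro!: if' G bnd[OF x0])
      then show ?thesis using G by (simp add: mult.commute)
    qed
  qed
  have lip: "norm (f y z - f x0 z) \<le> G z * norm (y - x0)" if y: "y \<in> U" and z: "z \<in> space M" for y z
  proof (cases "y = x0")
    case False
    have "0 \<le> G z * norm (y - x0)"
      using order_trans[OF norm_ge_zero bnd[OF x0 z]] .
    then have Gz: "0 \<le> G z" using False by (simp add: zero_le_mult_iff)
    show ?thesis
    proof (rule differentiable_bound[OF U, where f="\<lambda>x. f x z" and f'="\<lambda>x. f' x z"])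
      show "onorm (f' x z) \<le> G z" if "x \<in> U" for x
        by (rule onorm_bound[OF Gz]) (rule bnd[OF that z])
    qed (use x0 y z der in auto)
  qed simp
  show ?thesis
    unfolding has_derivative_within
  proof (intro conjI bl)
    show "((\<lambda>y. (1 / norm (y - x0)) *\<^sub>R ((LINT z|M. f y z) - ((LINT z|M. f x0 z) + (LINT z|M. f' x0 z (y - x0))))) \<longlongrightarrow> 0) (at x0 within U)"
      unfolding tendsto_at_iff_sequentially o_def
    proof (intro allI impI)
      fix X assume X: "\<forall>k. X k \<in> U - {x0}" and Xl: "X \<longlonglongrightarrow> x0"
      let ?g = "\<lambda>k z. (1 / norm (X k - x0)) *\<^sub>R (f (X k) z - (f x0 z + f' x0 z (X k - x0)))"
      have XU: "X k \<in> U" and Xn: "X k \<noteq> x0" for k using X by auto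
      have ig: "integrable M (?g k)" for k
        by (intro integrable_scaleR_right Bochner_Integration.integrable_diff Bochner_Integration.integrable_add int XU x0 if')
      have "(\<lambda>k. LINT z|M. ?g k z) \<longlonglongrightarrow> (LINT z|M. 0)"
      proof (rule integral_dominated_convergence[where w="\<lambda>z. 2 * G z"])
        show "AE z in M. (\<lambda>k. ?g k z) \<longlonglongrightarrow> 0"
        proof (rule AE_I2)
          fix z assume z: "z \<in> space M"
          have "((\<lambda>y. (1 / norm (y - x0)) *\<^sub>R (f y z - (f x0 z + f' x0 z (y - x0)))) \<longlongrightarrow> 0) (at x0 within U)"
            using der[OF x0 z] unfolding has_derivative_within by simp
          then show "(\<lambda>k. ?g k z) \<longlonglongrightarrow> 0"
            unfolding tendsto_at_iff_sequentially o_def using X Xl by blast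
        qed
        show "AE z in M. norm (?g k z) \<le> 2 * G z" for k
        proof (rule AE_I2)
          fix z assume z: "z \<in> space M"
          have "norm (f (X k) z - (f x0 z + f' x0 z (X k - x0))) \<le> norm (f (X k) z - f x0 z) + norm (f' x0 z (X k - x0))"
            by (metis diff_diff_eq norm_triangle_ineq4)
          also have "\<dots> \<le> 2 * G z * norm (X k - x0)"
            using lip[OF XU z, of k] bnd[OF x0 z, of "X k - x0"] by simp
          finally show "norm (?g k z) \<le> 2 * G z"
            using Xn[of k] by (simp add: divide_le_eq)
        qed
      qed (use ig G in auto)
      moreover have "(LINT z|M. ?g k z) = (1 / norm (X k - x0)) *\<^sub>R ((LINT z|M. f (X k) z) - ((LINT z|M. f x0 z) + (LINT z|M. f' x0 z (X k - x0))))" for k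
        by (simp add: Bochner_Integration.integral_diff Bochner_Integration.integral_add int XU x0 if')
      ultimately show "(\<lambda>k. (1 / norm (X k - x0)) *\<^sub>R ((LINT z|M. f (X k) z) - ((LINT z|M. f x0 z) + (LINT z|M. f' x0 z (X k - x0))))) \<longlonglongrightarrow> 0"
        by (simp del: integral_scaleR_right)
    qed
  qed
qed

text \<open>The integral of \<open>f\<close> does not change when \<open>f\<close> is translated; differentiating this identity
with respect to the translation shows that the integral of a partial derivative vanishes. This is the
source of all partial integrations below.\<close>

lemma integral_partial_zero:
  fixes f f' :: "real^'n \<Rightarrow> 'b::{banach,second_countable_topology}"
  assumes der: "\<And>x. ((\<lambda>h. f (x + h *\<^sub>R axis i 1)) has_vector_derivative f' x) (at 0)"
    and bf: "\<And>x. norm (f x) \<le> C * weight x" and bf': "\<And>x. norm (f' x) \<le> C * weight x"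
    and mf: "f \<in> borel_measurable borel" and mf': "f' \<in> borel_measurable borel"
  shows "(LINT x|lborel. f' x) = 0"
proof -
  let ?e = "axis i 1 :: real^'n"
  have C: "0 \<le> C"
    using order_trans[OF norm_ge_zero bf[of 0]] weight_pos[of "0::real^'n"] by (simp add: zero_le_mult_iff)
  have intf: "integrable lborel f"
    by (rule Bochner_Integration.integrable_bound[OF integrable_mult_right[OF integrable_weight, of C]])
      (use bf mf in \<open>auto intro!: AE_I2 order_trans[OF bf]\<close>)
  have "((\<lambda>h. LINT z|lborel. f (z + h *\<^sub>R ?e)) has_derivative (\<lambda>k. LINT z|lborel. k *\<^sub>R f' (z + 0 *\<^sub>R ?e))) (at 0 within {-1<..<1})"
  proof (rule has_derivative_integral[where G="\<lambda>z. 3 * C * weight z"])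
    fix h :: real assume h: "h \<in> {-1<..<1}"
    show "integrable lborel (\<lambda>z. f (z + h *\<^sub>R ?e))"
      using integral_translation(2)[OF mf, of "h *\<^sub>R ?e"] intf by simp
    fix z :: "real^'n"
    have "((\<lambda>k. f (z + h *\<^sub>R ?e + k *\<^sub>R ?e)) has_vector_derivative f' (z + h *\<^sub>R ?e)) (at (h - h))"
      using der[of "z + h *\<^sub>R ?e"] by simp
    then have "((\<lambda>k. f (z + h *\<^sub>R ?e + (k - h) *\<^sub>R ?e)) has_vector_derivative f' (z + h *\<^sub>R ?e)) (at h)"
      unfolding has_vector_derivative_def
      by (rule has_derivative_compose[of "\<lambda>k. k - h" "\<lambda>k. k" h UNIV, rotated, simplified comp_def]) (auto intro!: derivative_eq_intros)
    then have "((\<lambda>k. f (z + k *\<^sub>R ?e)) has_vector_derivative f' (z + h *\<^sub>R ?e)) (at h)"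
      by (simp add: algebra_simps)
    then show "((\<lambda>k. f (z + k *\<^sub>R ?e)) has_derivative (\<lambda>k. k *\<^sub>R f' (z + h *\<^sub>R ?e))) (at h within {-1<..<1})"
      unfolding has_vector_derivative_def by (rule has_derivative_at_withinI)
    show "norm (k *\<^sub>R f' (z + h *\<^sub>R ?e)) \<le> 3 * C * weight z * norm k" for k :: real
    proof -
      have "norm (f' (z + h *\<^sub>R ?e)) \<le> C * weight (z + h *\<^sub>R ?e)" by (rule bf')
      also have "\<dots> \<le> C * (3 * weight z)" using h by (intro mult_left_mono weight_shift C) auto
      finally show ?thesis using mult_left_mono[of "norm (f' (z + h *\<^sub>R ?e))" "3 * C * weight z" "\<bar>k\<bar>"] by (simp add: mult_ac)
    qed
  qed (use integrable_weight mf' in auto)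
  then have "((\<lambda>h. LINT z|lborel. f (z + h *\<^sub>R ?e)) has_derivative (\<lambda>k. k *\<^sub>R (LINT z|lborel. f' z))) (at 0)"
    by (subst (asm) at_within_open) auto
  then have "((\<lambda>h::real. LINT z|lborel. f z) has_vector_derivative (LINT z|lborel. f' z)) (at 0)"
    unfolding integral_translation(1) has_vector_derivative_def .
  then show ?thesis
    using has_vector_derivative_const[of "LINT z|lborel. f z"] vector_derivative_unique_at by blast
qed

section \<open>The Poisson kernel\<close>

lemma power_le_fact_exp:
  fixes x :: real assumes "0 \<le> x" shows "x ^ k \<le> fact k * exp x"
proof -
  have "(\<Sum>n\<in>{k}. x ^ n /\<^sub>R fact n) \<le> exp x"
    unfolding sums_unique[OF exp_converges[of x]]
    by (rule sum_le_suminf) (use assms exp_converges[of x] in \<open>auto simp: sums_iff\<close>)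
  then show ?thesis by (simp add: field_simps)
qed

lemma real_polynomial_function_partial:
  assumes "real_polynomial_function (p :: 'a::real_normed_vector \<Rightarrow> real)"
  shows "\<exists>p'. real_polynomial_function p' \<and> (\<forall>x. ((\<lambda>h. p (x + h *\<^sub>R e)) has_real_derivative p' x) (at 0))"
  using assms
proof induction
  case (linear f)
  have "f (x + h *\<^sub>R e) = f x + h * f e" for x h
    using linear by (simp add: linear_simps)
  then show ?case by (intro exI[of _ "\<lambda>_. f e"]) (auto intro!: derivative_eq_intros)
next
  case (const c)
  then show ?case by (intro exI[of _ "\<lambda>_. 0"]) auto
next
  case (add f g)
  then obtain f' g' where "real_polynomial_function f'" "real_polynomial_function g'"
    "\<And>x. ((\<lambda>h. f (x + h *\<^sub>R e)) has_real_derivative f' x) (at 0)" "\<And>x. ((\<lambda>h. g (x + h *\<^sub>R e)) has_real_derivative g' x) (at 0)"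
    by blast
  then show ?case by (intro exI[of _ "\<lambda>x. f' x + g' x"]) (auto intro!: derivative_eq_intros)
next
  case (mult f g)
  then obtain f' g' where "real_polynomial_function f'" "real_polynomial_function g'"
    "\<And>x. ((\<lambda>h. f (x + h *\<^sub>R e)) has_real_derivative f' x) (at 0)" "\<And>x. ((\<lambda>h. g (x + h *\<^sub>R e)) has_real_derivative g' x) (at 0)"
    by blast
  with mult show ?case
    by (intro exI[of _ "\<lambda>x. f' x * g x + f x * g' x"]) (auto intro!: derivative_eq_intros)
qed

lemma real_polynomial_function_growth:
  assumes "real_polynomial_function (p :: 'a::real_normed_vector \<Rightarrow> real)"
  shows "\<exists>C k. \<forall>x. \<bar>p x\<bar> \<le> C * (1 + norm x) ^ k"
  using assms
proof induction
  case (linear f)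
  then obtain K where "K > 0" "\<And>x. norm (f x) \<le> norm x * K" using bounded_linear.pos_bounded by blast
  then have "\<bar>f x\<bar> \<le> K * (1 + norm x) ^ 1" for x
    by (simp add: algebra_simps) (smt (verit) mult.commute real_norm_def)
  then show ?case by blast
next
  case (const c)
  show ?case by (intro exI[of _ "\<bar>c\<bar>"] exI[of _ 0]) auto
next
  case (add f g)
  then obtain C k D l where f: "\<And>x. \<bar>f x\<bar> \<le> C * (1 + norm x) ^ k" and g: "\<And>x. \<bar>g x\<bar> \<le> D * (1 + norm x) ^ l"
    by blast
  have C: "0 \<le> C" "0 \<le> D" using f[of 0] g[of 0] by auto
  have "\<bar>f x + g x\<bar> \<le> (C + D) * (1 + norm x) ^ (k + l)" for x
  proof -
    have "C * (1 + norm x) ^ k \<le> C * (1 + norm x) ^ (k + l)" "D * (1 + norm x) ^ l \<le> D * (1 + norm x) ^ (k + l)"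
      using C by (auto intro!: mult_left_mono power_increasing)
    then show ?thesis using f[of x] g[of x] by (simp add: algebra_simps)
  qed
  then show ?case by blast
next
  case (mult f g)
  then obtain C k D l where f: "\<And>x. \<bar>f x\<bar> \<le> C * (1 + norm x) ^ k" and g: "\<And>x. \<bar>g x\<bar> \<le> D * (1 + norm x) ^ l"
    by blast
  have C: "0 \<le> C" using f[of 0] by auto
  have "\<bar>f x * g x\<bar> \<le> (C * D) * (1 + norm x) ^ (k + l)" for x
    using mult_mono[OF f[of x] g[of x]] C by (simp add: abs_mult power_add mult_ac)
  then show ?case by blast
qed

lemma real_polynomial_function_norm_even_power:
  "real_polynomial_function (\<lambda>s::real^'n. norm s ^ (2 * m))"
proof -
  have "real_polynomial_function (\<lambda>s::real^'n. (\<Sum>i\<in>UNIV. (s $ i)\<^sup>2) ^ m)"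
    by (intro real_polynomial_function_power real_polynomial_function_sum)
      (auto intro!: real_polynomial_function_power real_polynomial_function.intros(1) bounded_linear_vec_nth)
  moreover have "(\<Sum>i\<in>UNIV. (s $ i)\<^sup>2) ^ m = norm s ^ (2 * m)" for s :: "real^'n"
    by (simp add: power_mult norm_vec_def L2_set_def real_sqrt_pow2 sum_nonneg)
  ultimately show ?thesis by simp
qed

text \<open>Multiplying \<open>p\<close> by the reciprocal of the weight gives another polynomial, and the exponential
dominates every polynomial since \<open>norm s - 1 \<le> norm s ^ (2 * m)\<close>.\<close>

lemma poly_exp_le_weight:
  fixes p :: "real^'n \<Rightarrow> real"
  assumes p: "real_polynomial_function p" and m: "1 \<le> m" and a: "0 < a"
  shows "\<exists>C. \<forall>s. \<bar>p s * exp (- a * norm s ^ (2 * m))\<bar> \<le> C * weight s"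
proof -
  have "real_polynomial_function (\<lambda>s. p s * (\<Prod>i\<in>UNIV. 1 + (s $ i)\<^sup>2))"
    by (intro real_polynomial_function.intros(4)[OF p] real_polynomial_function_prod real_polynomial_function.intros(3)
        real_polynomial_function.intros(2) real_polynomial_function_power real_polynomial_function.intros(1)[OF bounded_linear_vec_nth]) auto
  then obtain C k where Ck: "\<And>s. \<bar>p s * (\<Prod>i\<in>UNIV. 1 + (s $ i)\<^sup>2)\<bar> \<le> C * (1 + norm s) ^ k"
    using real_polynomial_function_growth by blast
  have C: "0 \<le> C" using Ck[of 0] by auto
  have *: "\<bar>p s * exp (- a * norm s ^ (2 * m))\<bar> \<le> (C * (fact k / a ^ k * exp (2*a))) * weight s" for s
  proof -
    have pos: "0 < (\<Prod>i\<in>UNIV. 1 + (s $ i)\<^sup>2)" by (intro prod_pos) (auto simp: add_pos_nonneg)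
    have "norm s - 1 \<le> norm s ^ (2 * m)"
    proof (cases "norm s \<le> 1")
      case False
      then have "norm s ^ 1 \<le> norm s ^ (2 * m)" using m by (intro power_increasing) auto
      then show ?thesis by simp
    next
      case True
      then show ?thesis by (smt (verit) zero_le_power norm_ge_zero)
    qed
    then have "a * (norm s - 1) \<le> a * norm s ^ (2 * m)" using a by simp
    then have "exp (- a * norm s ^ (2 * m)) \<le> exp (2 * a - a * (1 + norm s))"
      by (simp add: algebra_simps)
    then have e: "exp (- a * norm s ^ (2 * m)) \<le> exp (2 * a) / exp (a * (1 + norm s))"
      by (simp add: exp_diff)
    have "(a * (1 + norm s)) ^ k \<le> fact k * exp (a * (1 + norm s))"
      using a by (intro power_le_fact_exp) auto
    then have f: "(1 + norm s) ^ k \<le> fact k / a ^ k * exp (a * (1 + norm s))"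
      using a unfolding power_mult_distrib by (simp add: pos_le_divide_eq mult.commute)
    have "\<bar>p s * exp (- a * norm s ^ (2 * m))\<bar> * (\<Prod>i\<in>UNIV. 1 + (s $ i)\<^sup>2) = \<bar>p s * (\<Prod>i\<in>UNIV. 1 + (s $ i)\<^sup>2)\<bar> * exp (- a * norm s ^ (2 * m))"
      using pos by (simp add: abs_mult)
    also have "\<dots> \<le> (C * (1 + norm s) ^ k) * (exp (2 * a) / exp (a * (1 + norm s)))"
      using Ck[of s] e C by (intro mult_mono) auto
    also have "\<dots> \<le> (C * (fact k / a ^ k * exp (a * (1 + norm s)))) * (exp (2 * a) / exp (a * (1 + norm s)))"
      using f C by (intro mult_right_mono mult_left_mono) auto
    also have "\<dots> = C * (fact k / a ^ k * exp (2*a))" by simp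
    finally have "\<bar>p s * exp (- a * norm s ^ (2 * m))\<bar> \<le> (C * (fact k / a ^ k * exp (2*a))) / (\<Prod>i\<in>UNIV. 1 + (s $ i)\<^sup>2)"
      using pos by (simp only: pos_le_divide_eq)
    then show ?thesis by (simp add: weight_def prod_dividef)
  qed
  then show ?thesis by blast
qed

text \<open>The sign in the exponent is that of \<open>poisson_kernel\<close>, whose factor
\<open>1 / (2 * pi) ^ n\<close> is kept separate.\<close>

definition fourier :: "(real^'n \<Rightarrow> complex) \<Rightarrow> real^'n \<Rightarrow> complex" where
  "fourier \<phi> x = (LINT s|lborel. exp (\<i> * of_real (x \<bullet> s)) * \<phi> s)"

lemma fourier_measurable [measurable]:
  assumes [measurable]: "\<phi> \<in> borel_measurable borel"
  shows "fourier \<phi> \<in> borel_measurable borel"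
  unfolding fourier_def by (rule lborel.borel_measurable_lebesgue_integral) measurable

lemma fourier_integrable:
  "integrable lborel \<phi> \<Longrightarrow> integrable lborel (\<lambda>s. exp (\<i> * of_real (x \<bullet> s)) * \<phi> s)"
  by (rule Bochner_Integration.integrable_bound[of _ \<phi>]) (auto simp: norm_mult)

lemma fourier_bound: "integrable lborel \<phi> \<Longrightarrow> norm (fourier \<phi> x) \<le> (LINT s|lborel. norm (\<phi> s))"
  unfolding fourier_def by (rule order_trans[OF integral_norm_bound]) (simp add: norm_mult)

lemma integrable_le_weight:
  fixes f :: "real^'n \<Rightarrow> 'b::{banach,second_countable_topology}"
  assumes "f \<in> borel_measurable borel" "\<And>x. norm (f x) \<le> C * weight x"
  shows "integrable lborel f"
  by (rule Bochner_Integration.integrable_bound[OF integrable_mult_right[OF integrable_weight, of C]])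
    (use assms in \<open>auto intro!: AE_I2 order_trans[OF assms(2)]\<close>)

lemma fourier_partial:
  assumes der: "\<And>s. ((\<lambda>h. \<phi> (s + h *\<^sub>R axis i 1)) has_vector_derivative \<phi>' s) (at 0)"
    and b: "\<And>s. norm (\<phi> s) \<le> C * weight s" and b': "\<And>s. norm (\<phi>' s) \<le> D * weight s"
    and [measurable]: "\<phi> \<in> borel_measurable borel" "\<phi>' \<in> borel_measurable borel"
  shows "fourier \<phi>' x = - \<i> * of_real (x $ i) * fourier \<phi> x"
proof -
  let ?E = "\<lambda>s. exp (\<i> * of_real (x \<bullet> s))"
  let ?f' = "\<lambda>s. \<i> * of_real (x $ i) * (?E s * \<phi> s) + ?E s * \<phi>' s"
  have i1: "integrable lborel \<phi>" "integrable lborel \<phi>'"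
    by (rule integrable_le_weight[OF _ b], simp) (rule integrable_le_weight[OF _ b'], simp)
  have C: "0 \<le> C" "0 \<le> D"
    using order_trans[OF norm_ge_zero b[of 0]] order_trans[OF norm_ge_zero b'[of 0]] weight_pos[of "0::real^'a"]
    by (auto simp: zero_le_mult_iff)
  have "(LINT s|lborel. ?f' s) = 0"
  proof (rule integral_partial_zero)
    fix s :: "real^'a"
    have e: "((\<lambda>h::real. ?E (s + h *\<^sub>R axis i 1)) has_vector_derivative \<i> * of_real (x $ i) * ?E s) (at 0)"
    proof -
      have "((\<lambda>z. exp (\<i> * (of_real (x \<bullet> s) + z * of_real (x $ i)))) has_field_derivative \<i> * of_real (x $ i) * ?E s) (at (of_real 0))"
        by (auto intro!: derivative_eq_intros)
      from has_vector_derivative_real_field[OF this] show ?thesis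
        by (simp add: o_def inner_add_right inner_axis)
    qed
    show "((\<lambda>h. ?E (s + h *\<^sub>R axis i 1) * \<phi> (s + h *\<^sub>R axis i 1)) has_vector_derivative ?f' s) (at 0)"
      using has_vector_derivative_mult[OF e der[of s]] by (simp add: algebra_simps)
    show "norm (?E s * \<phi> s) \<le> (C + D + \<bar>x $ i\<bar> * C) * weight s"
    proof -
      have "C * weight s \<le> (C + D + \<bar>x $ i\<bar> * C) * weight s"
        using C weight_pos[of s] by (intro mult_right_mono) auto
      then show ?thesis using b[of s] by (simp add: norm_mult)
    qed
    show "norm (?f' s) \<le> (C + D + \<bar>x $ i\<bar> * C) * weight s"
    proof -
      have "norm (?f' s) \<le> \<bar>x $ i\<bar> * norm (\<phi> s) + norm (\<phi>' s)"
        by (rule order_trans[OF norm_triangle_ineq]) (simp add: norm_mult)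
      also have "\<dots> \<le> \<bar>x $ i\<bar> * (C * weight s) + D * weight s"
        by (intro add_mono mult_left_mono b b') auto
      also have "\<dots> \<le> (C + D + \<bar>x $ i\<bar> * C) * weight s"
        using C weight_pos[of s] by (simp add: algebra_simps)
      finally show ?thesis .
    qed
  qed measurable
  moreover have "(LINT s|lborel. ?f' s) = \<i> * of_real (x $ i) * fourier \<phi> x + fourier \<phi>' x"
    unfolding fourier_def using fourier_integrable[OF i1(1), of x] fourier_integrable[OF i1(2), of x]
    by (simp add: Bochner_Integration.integral_add)
  ultimately show ?thesis by (simp add: eq_neg_iff_add_eq_0 add.commute)
qed

lemma borel_measurable_real_polynomial_function:
  "real_polynomial_function (p :: real^'n \<Rightarrow> real) \<Longrightarrow> p \<in> borel_measurable borel"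
  by (intro borel_measurable_continuous_onI continuous_at_imp_continuous_on ballI continuous_real_polymonial_function)

text \<open>Multiplying the Fourier integral of \<open>\<phi>\<close> by \<open>1 + (x $ i)\<^sup>2\<close> replaces \<open>\<phi>\<close> by
\<open>\<phi> - \<partial>\<^sub>i\<partial>\<^sub>i\<phi>\<close>, which has again the form polynomial times \<open>exp (-|s|\<^sup>2\<^sup>m)\<close>. One factor of the
weight after the other is absorbed in this way, which is why the statement ranges over all
polynomials and over sets \<open>J\<close> of coordinates.\<close>

lemma fourier_poly_exp_decay:
  assumes m: "1 \<le> m" and p: "real_polynomial_function (p :: real^'n \<Rightarrow> real)"
  shows "\<exists>C. \<forall>x. norm (fourier (\<lambda>s. of_real (p s * exp (- (norm s ^ (2 * m))))) x) * (\<Prod>i\<in>J. 1 + (x $ i)\<^sup>2) \<le> C"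
proof -
  have "finite J" by simp
  then show ?thesis using p
  proof (induction J arbitrary: p)
    case empty
    obtain C where "\<And>s. \<bar>p s * exp (- 1 * norm s ^ (2 * m))\<bar> \<le> C * weight s"
      using poly_exp_le_weight[OF empty m, of 1] by auto
    then have "integrable lborel (\<lambda>s. complex_of_real (p s * exp (- (norm s ^ (2 * m)))))"
      using borel_measurable_real_polynomial_function[OF empty]
      by (intro integrable_le_weight[where C=C]) (auto simp del: of_real_mult)
    then obtain B where "\<And>x. norm (fourier (\<lambda>s. complex_of_real (p s * exp (- (norm s ^ (2 * m))))) x) \<le> B"
      using fourier_bound by blast
    then show ?case by (intro exI[of _ B]) simp
  next
    case (insert i J)
    let ?e = "\<lambda>s::real^'n. exp (- (norm s ^ (2 * m)))"
    let ?F = "\<lambda>p. fourier (\<lambda>s. of_real (p s * ?e s))"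
    obtain N' where N': "real_polynomial_function N'" "\<And>x::real^'n. ((\<lambda>h. norm (x + h *\<^sub>R axis i 1) ^ (2*m)) has_real_derivative N' x) (at 0)"
      using real_polynomial_function_partial[OF real_polynomial_function_norm_even_power[of m], of "axis i 1"] by auto
    \<comment> \<open>multiplication by \<open>x $ i\<close> stays in the class of Fourier integrals of polynomial times exponential\<close>
    have step: "\<exists>p'. real_polynomial_function p' \<and> (\<forall>x. ?F p' x = - \<i> * of_real (x $ i) * ?F p x)"
      if p: "real_polynomial_function p" for p
    proof -
      obtain q where q: "real_polynomial_function q" "\<And>x. ((\<lambda>h. p (x + h *\<^sub>R axis i 1)) has_real_derivative q x) (at 0)"
        using real_polynomial_function_partial[OF p] by blast
      let ?q = "\<lambda>x. q x - p x * N' x"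
      have r: "real_polynomial_function ?q" using p q(1) N'(1) by auto
      obtain C where C: "\<And>s. \<bar>p s * exp (- 1 * norm s ^ (2 * m))\<bar> \<le> C * weight s"
        using poly_exp_le_weight[OF p m, of 1] by auto
      obtain D where D: "\<And>s. \<bar>?q s * exp (- 1 * norm s ^ (2 * m))\<bar> \<le> D * weight s"
        using poly_exp_le_weight[OF r m, of 1] by auto
      have "?F ?q x = - \<i> * of_real (x $ i) * ?F p x" for x
      proof (rule fourier_partial)
        fix s :: "real^'n"
        have "((\<lambda>h. p (s + h *\<^sub>R axis i 1) * ?e (s + h *\<^sub>R axis i 1)) has_real_derivative ?q s * ?e s) (at 0)"
          by (rule derivative_eq_intros q(2) N'(2) refl)+ (simp add: algebra_simps)
        then show "((\<lambda>h. complex_of_real (p (s + h *\<^sub>R axis i 1) * ?e (s + h *\<^sub>R axis i 1))) has_vector_derivative of_real (?q s * ?e s)) (at 0)"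
          by (intro has_vector_derivative_of_real) (simp add: has_real_derivative_iff_has_vector_derivative)
        show "norm (complex_of_real (p s * ?e s)) \<le> C * weight s" using C[of s] by (simp del: of_real_mult)
        show "norm (complex_of_real (?q s * ?e s)) \<le> D * weight s" using D[of s] by (simp del: of_real_mult of_real_diff)
      qed (use borel_measurable_real_polynomial_function[OF p] borel_measurable_real_polynomial_function[OF r] in measurable)
      with r show ?thesis by blast
    qed
    obtain p1 where p1: "real_polynomial_function p1" "\<And>x. ?F p1 x = - \<i> * of_real (x $ i) * ?F p x"
      using step[OF insert.prems] by blast
    obtain p2 where p2: "real_polynomial_function p2" "\<And>x. ?F p2 x = - \<i> * of_real (x $ i) * ?F p1 x"
      using step[OF p1(1)] by blast
    obtain C1 where C1: "\<And>x. norm (?F p x) * (\<Prod>i\<in>J. 1 + (x $ i)\<^sup>2) \<le> C1" using insert.IH[OF insert.prems] by blast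
    obtain C2 where C2: "\<And>x. norm (?F p2 x) * (\<Prod>i\<in>J. 1 + (x $ i)\<^sup>2) \<le> C2" using insert.IH[OF p2(1)] by blast
    have "norm (?F p x) * (\<Prod>i\<in>insert i J. 1 + (x $ i)\<^sup>2) \<le> C1 + C2" for x
    proof -
      have "norm (?F p2 x) = (x $ i)\<^sup>2 * norm (?F p x)"
        unfolding p1(2) p2(2) by (simp add: norm_mult power2_eq_square flip: abs_mult)
      then show ?thesis using C1[of x] C2[of x] insert.hyps by (simp add: algebra_simps)
    qed
    then show ?case by blast
  qed
qed

lemma integrable_poly_exp:
  assumes "1 \<le> m" "0 < a" "real_polynomial_function p"
  shows "integrable lborel (\<lambda>s::real^'n. p s * exp (- a * norm s ^ (2 * m)))"
proof -
  obtain C where C: "\<And>s. \<bar>p s * exp (- a * norm s ^ (2 * m))\<bar> \<le> C * weight s"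
    using poly_exp_le_weight[OF assms(3,1,2)] by auto
  show ?thesis
    by (rule integrable_le_weight[where C=C]) (use C borel_measurable_real_polynomial_function[OF assms(3)] in auto)
qed

lemma poisson_kernel_fourier:
  "poisson_kernel m a x = 1 / of_real ((2 * pi) ^ CARD('n)) * fourier (\<lambda>s. of_real (exp (- a * norm s ^ (2 * m)))) (x :: real^'n)"
proof -
  have e: "exp (\<i> * of_real y - of_real b) = exp (\<i> * of_real y) * of_real (exp (- b))" for y b
    by (simp add: exp_diff exp_minus divide_inverse exp_of_real[symmetric])
  show ?thesis unfolding poisson_kernel_def fourier_def e by (simp add: mult.commute)
qed

lemma integral_reflection:
  fixes f :: "'a::euclidean_space \<Rightarrow> 'b::{banach,second_countable_topology}"
  assumes "f \<in> borel_measurable borel"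
  shows "(LINT x|lborel. f (t - x)) = (LINT x|lborel. f x)"
  using integral_scaling(1)[of "-1" f t] assms by simp

lemma fourier_even:
  assumes [measurable]: "\<phi> \<in> borel_measurable borel" and "\<And>s. \<phi> (- s) = \<phi> s"
  shows "fourier \<phi> (- x) = fourier \<phi> x"
proof -
  have "fourier \<phi> (- x) = (LINT s|lborel. exp (\<i> * of_real (- x \<bullet> (0 - s))) * \<phi> (0 - s))"
    unfolding fourier_def by (rule integral_reflection[symmetric]) measurable
  also have "\<dots> = fourier \<phi> x" using assms(2) by (simp add: fourier_def)
  finally show ?thesis .
qed

lemma poisson_kernel_minus: "poisson_kernel m a (- x) = poisson_kernel m a (x :: real^'n)"
  unfolding poisson_kernel_fourier by (subst fourier_even) auto

text \<open>The symbol is even, so complex conjugation, which amounts to the reflection \<open>x \<mapsto> -x\<close>, does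
not change the kernel.\<close>

lemma poisson_kernel_real: "Im (poisson_kernel m a (x :: real^'n)) = 0"
proof -
  have "cnj (fourier (\<lambda>s. of_real (exp (- a * norm s ^ (2 * m)))) x) = fourier (\<lambda>s. of_real (exp (- a * norm s ^ (2 * m)))) (- x)"
    unfolding fourier_def by (simp add: exp_cnj flip: Bochner_Integration.integral_cnj)
  also have "\<dots> = fourier (\<lambda>s. of_real (exp (- a * norm s ^ (2 * m)))) x" by (rule fourier_even) auto
  finally have "fourier (\<lambda>s. of_real (exp (- a * norm s ^ (2 * m)))) x \<in> \<real>" by (simp add: Reals_cnj_iff)
  then show ?thesis unfolding poisson_kernel_fourier complex_is_Real_iff[symmetric]
    by (intro Reals_mult Reals_divide) auto
qed

lemma poisson_kernel_measurable [measurable]: "poisson_kernel m a \<in> borel_measurable (borel :: (real^'n) measure)"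
  unfolding poisson_kernel_fourier[abs_def] by measurable

lemma poisson_kernel_decay:
  assumes "1 \<le> m"
  shows "\<exists>C. \<forall>x :: real^'n. norm (poisson_kernel m 1 x) \<le> C * weight x"
proof -
  obtain C where C: "\<And>x::real^'n. norm (fourier (\<lambda>s. of_real (1 * exp (- (norm s ^ (2 * m))))) x) * (\<Prod>i\<in>UNIV. 1 + (x $ i)\<^sup>2) \<le> C"
    using fourier_poly_exp_decay[OF assms real_polynomial_function.intros(2), of 1 UNIV] by blast
  have "norm (poisson_kernel m 1 x) \<le> (1 / (2 * pi) ^ CARD('n) * C) * weight x" for x :: "real^'n"
  proof -
    have pos: "0 < (\<Prod>i\<in>UNIV. 1 + (x $ i)\<^sup>2)" by (intro prod_pos) (auto simp: add_pos_nonneg)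
    have "norm (fourier (\<lambda>s. of_real (exp (- (norm s ^ (2 * m))))) x) \<le> C * weight x"
      using C[of x] pos by (simp add: weight_def prod_dividef pos_le_divide_eq)
    from mult_left_mono[OF this, of "1 / (2 * pi) ^ CARD('n)"] show ?thesis
      by (simp add: poisson_kernel_fourier norm_mult norm_divide norm_power)
  qed
  then show ?thesis by blast
qed

lemma poisson_kernel_integrable: "1 \<le> m \<Longrightarrow> integrable lborel (poisson_kernel m 1 :: real^'n \<Rightarrow> complex)"
  using poisson_kernel_decay integrable_le_weight poisson_kernel_measurable by metis

text \<open>Substitution of \<open>s / r\<close> for \<open>s\<close>; it reduces every question about the kernel to the
parameter value one.\<close>

lemma poisson_kernel_scale:
  assumes r: "0 < r"
  shows "poisson_kernel m (r ^ (2 * m)) (x :: real^'n) = of_real (1 / r ^ CARD('n)) * poisson_kernel m 1 ((1 / r) *\<^sub>R x)"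
proof -
  let ?f = "\<lambda>s::real^'n. exp (\<i> * of_real (x \<bullet> s)) * complex_of_real (exp (- (r ^ (2*m)) * norm s ^ (2 * m)))"
  have "(LINT s|lborel. ?f s) = \<bar>1/r\<bar> ^ DIM(real^'n) *\<^sub>R (LINT s|lborel. ?f (0 + (1/r) *\<^sub>R s))"
    by (rule integral_scaling) (use r in auto)
  also have "(LINT s|lborel. ?f (0 + (1/r) *\<^sub>R s)) = fourier (\<lambda>s. complex_of_real (exp (- 1 * norm s ^ (2 * m)))) ((1/r) *\<^sub>R x)"
    unfolding fourier_def using r by (intro Bochner_Integration.integral_cong) (auto simp: power_divide)
  finally show ?thesis unfolding poisson_kernel_fourier
    using r by (simp add: fourier_def power_divide scaleR_conv_of_real)
qed

lemma integrable_pair_bound: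
  fixes f g :: "real^'n \<Rightarrow> complex"
  assumes [measurable]: "integrable lborel f" "integrable lborel g"
    and [measurable]: "case_prod h \<in> borel_measurable (lborel \<Otimes>\<^sub>M lborel)"
    and b: "\<And>x y. norm (h x y) \<le> norm (f x) * norm (g y)"
  shows "integrable (lborel \<Otimes>\<^sub>M lborel) (case_prod (h :: real^'n \<Rightarrow> real^'n \<Rightarrow> complex))"
proof (rule Bochner_Integration.integrable_bound[where f="\<lambda>(x,y). f x * g y"])
  show "integrable (lborel \<Otimes>\<^sub>M lborel) (\<lambda>(x, y). f x * g y)"
  proof (rule lborel_pair.Fubini_integrable)
    show "integrable lborel (\<lambda>x. LINT y|lborel. norm (case (x, y) of (x, y) \<Rightarrow> f x * g y))"
      using assms(1,2) by (simp add: norm_mult)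
  qed (use assms(1,2) in auto)
qed (use b in \<open>auto simp: norm_mult\<close>)

text \<open>Fubini's theorem for \<open>exp (\<i> y \<bullet> s) \<phi>(s) \<psi>(y)\<close>. It takes the place of Fourier inversion: integrals
against the kernel become integrals against its explicit symbol.\<close>

lemma fourier_multiplication_formula:
  assumes \<phi>: "integrable lborel \<phi>" and \<psi>: "integrable lborel \<psi>"
  shows "(LINT y|lborel. fourier \<phi> y * \<psi> y) = (LINT s|lborel. \<phi> s * fourier \<psi> (s :: real^'n))"
proof -
  note [measurable] = borel_measurable_integrable[OF \<phi>] borel_measurable_integrable[OF \<psi>]
  let ?h = "\<lambda>y s. exp (\<i> * of_real (y \<bullet> s)) * \<phi> s * \<psi> y"
  have "integrable (lborel \<Otimes>\<^sub>M lborel) (case_prod ?h)"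
    by (rule integrable_pair_bound[OF \<psi> \<phi>]) (auto simp: norm_mult)
  then have "(LINT s|lborel. LINT y|lborel. ?h y s) = (LINT y|lborel. LINT s|lborel. ?h y s)"
    by (rule lborel_pair.Fubini_integral)
  then show ?thesis
    unfolding fourier_def by (simp add: mult_ac inner_commute flip: integral_mult_left_zero integral_mult_right_zero)
qed

definition gauss :: "real^'n \<Rightarrow> complex" where
  "gauss x = (\<Prod>i\<in>UNIV. of_real (exp (- (x $ i)\<^sup>2 / 2)))"

lemma integrable_exp_square: "integrable lborel (\<lambda>x::real. exp (- x\<^sup>2 / 2))"
  using integrable_mult_right[OF integrable_std_normal_moment[of 0], of "sqrt (2*pi)"] by (simp add: std_normal_density_def)

lemma fourier_exp_square:
  "(LINT x|lborel. exp (\<i> * of_real (t * x)) * complex_of_real (exp (- x\<^sup>2 / 2))) = of_real (sqrt (2*pi) * exp (- t\<^sup>2 / 2))"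
proof -
  have "complex_of_real (exp (- (t^2) / 2)) = char std_normal_distribution t"
    by (simp add: char_std_normal_distribution)
  also have "\<dots> = (LINT x|lborel. std_normal_density x *\<^sub>R exp (\<i> * of_real (t * x)))"
    unfolding char_def by (subst integral_density) (auto simp: scaleR_conv_of_real)
  also have "\<dots> = (LINT x|lborel. (1 / of_real (sqrt (2*pi))) * (exp (\<i> * of_real (t * x)) * complex_of_real (exp (- x\<^sup>2 / 2))))"
    by (intro Bochner_Integration.integral_cong) (auto simp: std_normal_density_def scaleR_conv_of_real)
  also have "\<dots> = (1 / of_real (sqrt (2*pi))) * (LINT x|lborel. exp (\<i> * of_real (t * x)) * complex_of_real (exp (- x\<^sup>2 / 2)))"
    by simp
  finally show ?thesis by (simp add: field_simps)
qed

lemma gauss_integrable: "integrable lborel (gauss :: real^'n \<Rightarrow> complex)"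
  unfolding gauss_def[abs_def] by (intro integrable_prod_coords integrable_of_real integrable_exp_square)

lemma fourier_gauss: "fourier gauss (s :: real^'n) = of_real (sqrt (2 * pi) ^ CARD('n)) * gauss s"
proof -
  have "fourier gauss s = (LINT x|lborel. (\<Prod>i\<in>UNIV. exp (\<i> * of_real (s $ i * x $ i)) * complex_of_real (exp (- (x $ i)\<^sup>2 / 2))))"
    unfolding fourier_def gauss_def
    by (intro Bochner_Integration.integral_cong refl)
      (simp add: prod.distrib inner_vec_def sum_distrib_left flip: exp_sum)
  also have "\<dots> = (\<Prod>i\<in>UNIV. LINT x|lborel. exp (\<i> * of_real (s $ i * x)) * complex_of_real (exp (- x\<^sup>2 / 2)))"
  proof (rule integral_prod_coords)
    fix i
    show "integrable lborel (\<lambda>x. exp (\<i> * of_real (s $ i * x)) * complex_of_real (exp (- x\<^sup>2 / 2)))"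
      by (rule Bochner_Integration.integrable_bound[OF integrable_of_real[OF integrable_exp_square, where 'a=complex]]) (auto simp: norm_mult)
  qed
  also have "\<dots> = of_real (sqrt (2 * pi) ^ CARD('n)) * gauss s"
    unfolding fourier_exp_square by (simp add: gauss_def prod.distrib)
  finally show ?thesis .
qed

lemma gauss_measurable [measurable]: "gauss \<in> borel_measurable borel"
  using borel_measurable_integrable[OF gauss_integrable] by simp

lemma norm_gauss_le: "norm (gauss x) \<le> 1"
  unfolding gauss_def prod_norm[symmetric] by (intro prod_le_1) auto

lemma gauss_integral: "(LINT s|lborel. gauss (s :: real^'n)) = of_real (sqrt (2 * pi) ^ CARD('n))"
  using fourier_gauss[of "0::real^'n"] by (simp add: fourier_def gauss_def)

text \<open>Fourier inversion at the origin for one particular function. Testing the kernel with the wide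
Gaussian \<open>z \<mapsto> gauss (r z)\<close> gives, by scaling and the multiplication formula, the integral of
\<open>exp (-r\<^sup>2\<^sup>m|s|\<^sup>2\<^sup>m)\<close> against the Fourier integral of a fixed Gaussian. Both sides converge as
\<open>r \<rightarrow> 0\<close>, and the limit on the right is a Gaussian integral.\<close>

lemma poisson_kernel_integral:
  assumes m: "1 \<le> m"
  shows "(LINT z|lborel. poisson_kernel m 1 (z :: real^'n)) = 1"
proof -
  let ?K = "poisson_kernel m 1 :: real^'n \<Rightarrow> complex"
  let ?c = "complex_of_real ((2 * pi) ^ CARD('n))"
  let ?r = "\<lambda>k. 1 / real (Suc k)"
  let ?L = "\<lambda>k. LINT z|lborel. ?K z * gauss (?r k *\<^sub>R z)"
  have r0: "?r \<longlonglongrightarrow> 0" by (rule LIMSEQ_inverse_real_of_nat[unfolded inverse_eq_divide])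
  have "?L \<longlonglongrightarrow> (LINT z|lborel. ?K z)"
  proof (rule integral_dominated_convergence[where w="\<lambda>z. norm (?K z)"])
    have "(\<lambda>k. gauss (?r k *\<^sub>R z)) \<longlonglongrightarrow> 1" for z :: "real^'n"
    proof -
      have "(\<lambda>k. gauss (?r k *\<^sub>R z)) \<longlonglongrightarrow> (\<Prod>i\<in>(UNIV::'n set). complex_of_real (exp (- (0 * (z $ i))\<^sup>2 / 2)))"
        unfolding gauss_def vector_scaleR_component real_scaleR_def by (intro tendsto_intros r0) auto
      then show ?thesis by simp
    qed
    then have "(\<lambda>k. ?K z * gauss (?r k *\<^sub>R z)) \<longlonglongrightarrow> ?K z * 1" for z
      by (intro tendsto_intros)
    then show "AE z in lborel. (\<lambda>k. ?K z * gauss (?r k *\<^sub>R z)) \<longlonglongrightarrow> ?K z" by simp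
    show "AE z in lborel. norm (?K z * gauss (?r k *\<^sub>R z)) \<le> norm (?K z)" for k
      by (auto simp: norm_mult intro!: mult_left_le norm_gauss_le)
  qed (use poisson_kernel_integrable[OF m] in auto)
  moreover have "(LINT z|lborel. ?K z * gauss (r *\<^sub>R z)) = 1 / ?c * (LINT s|lborel. of_real (exp (- (r ^ (2*m)) * norm s ^ (2 * m))) * fourier gauss (s :: real^'n))"
    if r: "0 < r" for r
  proof -
    have "(LINT z|lborel. ?K z * gauss (r *\<^sub>R z)) = \<bar>r\<bar> ^ DIM(real^'n) *\<^sub>R (LINT z|lborel. poisson_kernel m (r ^ (2*m)) (0 + r *\<^sub>R (z :: real^'n)) * gauss (0 + r *\<^sub>R z))"
      unfolding poisson_kernel_scale[OF r] using r by (simp add: scaleR_conv_of_real[where 'a=complex] mult.assoc)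
    also have "\<dots> = (LINT z|lborel. poisson_kernel m (r ^ (2*m)) z * gauss (z :: real^'n))"
      by (rule integral_scaling(1)[symmetric]) (use r in auto)
    also have "\<dots> = 1 / ?c * (LINT z|lborel. fourier (\<lambda>s. of_real (exp (- (r ^ (2*m)) * norm s ^ (2 * m)))) z * gauss (z :: real^'n))"
      unfolding poisson_kernel_fourier by (simp add: mult.assoc)
    also have "(LINT z|lborel. fourier (\<lambda>s. of_real (exp (- (r ^ (2*m)) * norm s ^ (2 * m)))) z * gauss (z :: real^'n)) = (LINT s|lborel. of_real (exp (- (r ^ (2*m)) * norm s ^ (2 * m))) * fourier gauss (s :: real^'n))"
    proof (rule fourier_multiplication_formula[OF integrable_of_real gauss_integrable])
      show "integrable lborel (\<lambda>s::real^'n. exp (- (r ^ (2*m)) * norm s ^ (2 * m)))"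
        using integrable_poly_exp[OF m _ real_polynomial_function.intros(2)[of 1], of "r ^ (2*m)"] r by simp
    qed
    finally show ?thesis .
  qed
  then have "?L k = 1 / ?c * (LINT s|lborel. of_real (exp (- (?r k ^ (2*m)) * norm s ^ (2 * m))) * fourier gauss (s :: real^'n))" for k
    by simp
  moreover have "(\<lambda>k. LINT s|lborel. of_real (exp (- (?r k ^ (2*m)) * norm s ^ (2 * m))) * fourier gauss (s :: real^'n)) \<longlonglongrightarrow> (LINT s|lborel. fourier gauss (s::real^'n))"
  proof (rule integral_dominated_convergence[where w="\<lambda>s. norm (fourier gauss s)"])
    have i: "integrable lborel (fourier gauss :: real^'n \<Rightarrow> complex)" unfolding fourier_gauss[abs_def]
      by (intro integrable_mult_right gauss_integrable)
    then show "integrable lborel (\<lambda>s::real^'n. norm (fourier gauss s))" by simp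
    have "(\<lambda>k. complex_of_real (exp (- (?r k ^ (2*m)) * norm s ^ (2 * m))) * fourier gauss s) \<longlonglongrightarrow> complex_of_real (exp (- (0 ^ (2*m)) * norm s ^ (2 * m))) * fourier gauss s" for s :: "real^'n"
      by (intro tendsto_intros r0)
    then show "AE s in lborel. (\<lambda>k. complex_of_real (exp (- (?r k ^ (2*m)) * norm s ^ (2 * m))) * fourier gauss (s::real^'n)) \<longlonglongrightarrow> fourier gauss s"
      using m by (simp add: power_0_left)
    show "AE s in lborel. norm (complex_of_real (exp (- (?r k ^ (2*m)) * norm s ^ (2 * m))) * fourier gauss (s::real^'n)) \<le> norm (fourier gauss s)" for k
      by (auto simp: norm_mult intro!: mult_left_le_one_le)
  qed measurable
  ultimately have "?L \<longlonglongrightarrow> 1 / ?c * (LINT s|lborel. fourier gauss (s::real^'n))"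
    by (simp only:) (intro tendsto_intros)
  then have "(LINT z|lborel. ?K z) = 1 / ?c * (LINT s|lborel. fourier gauss (s::real^'n))"
    using \<open>?L \<longlonglongrightarrow> (LINT z|lborel. ?K z)\<close> LIMSEQ_unique by blast
  also have "(LINT s|lborel. fourier gauss (s::real^'n)) = of_real (sqrt (2 * pi) ^ CARD('n) * sqrt (2 * pi) ^ CARD('n))"
    unfolding fourier_gauss by (simp add: gauss_integral)
  also have "sqrt (2 * pi) ^ CARD('n) * sqrt (2 * pi) ^ CARD('n) = (2 * pi) ^ CARD('n)"
    unfolding power_mult_distrib[symmetric] real_sqrt_mult_self by simp
  also have "1 / ?c * ?c = 1" by simp
  finally show ?thesis .
qed

section \<open>Iterated partial derivatives and initial data\<close>

lemma iter_partial_simps [simp]: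
  "iter_partial [] f = f" "iter_partial (i # is) f = partial_deriv i (iter_partial is f)"
  by (simp_all add: iter_partial_def)

lemma iter_partial_append: "iter_partial (is @ js) f = iter_partial is (iter_partial js f)"
  by (simp add: iter_partial_def)

lemma partial_deriv_eqI:
  "((\<lambda>h. f (x + h *\<^sub>R axis i 1)) has_real_derivative d) (at 0) \<Longrightarrow> partial_deriv i f x = d"
  unfolding partial_deriv_def by (rule DERIV_imp_deriv)

text \<open>Differentiability makes \<open>partial_deriv\<close>, which is defined by a choice of derivative, agree
with the directional derivative.\<close>

lemma has_derivative_partial_deriv:
  fixes f :: "real^'n \<Rightarrow> real"
  assumes "f differentiable (at x)"
  shows "(f has_derivative (\<lambda>h. \<Sum>i\<in>UNIV. h $ i * partial_deriv i f x)) (at x)"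
    and "((\<lambda>h. f (x + h *\<^sub>R axis i 1)) has_real_derivative partial_deriv i f x) (at 0)"
proof -
  obtain D where D: "(f has_derivative D) (at x)" using assms by (auto simp: differentiable_def)
  have lin: "linear D" using D by (simp add: has_derivative_linear)
  have p: "((\<lambda>h. f (x + h *\<^sub>R axis i 1)) has_real_derivative D (axis i 1)) (at 0)" for i
  proof -
    have "((\<lambda>h. f (x + h *\<^sub>R axis i 1)) has_derivative (\<lambda>h. D (h *\<^sub>R axis i 1))) (at 0)"
      by (rule has_derivative_compose[of "\<lambda>h. x + h *\<^sub>R axis i 1" "\<lambda>h. h *\<^sub>R axis i 1" 0 UNIV f D, simplified])
        (use D in \<open>auto intro!: derivative_eq_intros\<close>)
    then show ?thesis
      by (simp add: linear_scale[OF lin] has_field_derivative_def mult_commute_abs)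
  qed
  have e: "partial_deriv i f x = D (axis i 1)" for i by (rule partial_deriv_eqI[OF p])
  show "((\<lambda>h. f (x + h *\<^sub>R axis i 1)) has_real_derivative partial_deriv i f x) (at 0)"
    unfolding e by (rule p)
  have "(\<Sum>i\<in>UNIV. h $ i * D (axis i 1)) = D h" for h
  proof -
    have "D h = D (\<Sum>i\<in>UNIV. h $ i *\<^sub>R axis i 1)"
      by (simp add: basis_expansion flip: scalar_mult_eq_scaleR)
    then show ?thesis by (simp add: linear_sum[OF lin] linear_scale[OF lin])
  qed
  then have De: "(\<lambda>h. \<Sum>i\<in>UNIV. h $ i * D (axis i 1)) = D" by (rule ext)
  show "(f has_derivative (\<lambda>h. \<Sum>i\<in>UNIV. h $ i * partial_deriv i f x)) (at x)"
    unfolding e De by (rule D)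
qed

lemma has_derivative_imp_partial_deriv:
  fixes f :: "real^'n \<Rightarrow> real"
  assumes "(f has_derivative (\<lambda>h. \<Sum>i\<in>UNIV. h $ i * d i)) (at x)"
  shows "partial_deriv i f x = d i"
proof (rule partial_deriv_eqI)
  have "((\<lambda>h. f (x + h *\<^sub>R axis i 1)) has_derivative (\<lambda>h. \<Sum>j\<in>UNIV. (h *\<^sub>R axis i 1 :: real^'n) $ j * d j)) (at 0)"
    by (rule has_derivative_compose[of "\<lambda>h. x + h *\<^sub>R axis i 1" "\<lambda>h. h *\<^sub>R axis i 1" 0 UNIV f, simplified])
      (use assms in \<open>auto intro!: derivative_eq_intros\<close>)
  moreover have "(\<Sum>j\<in>UNIV. (h *\<^sub>R axis i 1 :: real^'n) $ j * d j) = d i * h" for h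
    by (simp add: axis_def if_distrib if_distribR cong: if_cong)
  ultimately show "((\<lambda>h. f (x + h *\<^sub>R axis i 1)) has_real_derivative d i) (at 0)"
    by (simp add: has_field_derivative_def)
qed

lemma partial_deriv_cmult_sum:
  fixes g :: "'a \<Rightarrow> real^'n \<Rightarrow> real"
  assumes "\<And>a. a \<in> A \<Longrightarrow> g a differentiable (at x)"
  shows "partial_deriv i (\<lambda>x. c * (\<Sum>a\<in>A. g a x)) x = c * (\<Sum>a\<in>A. partial_deriv i (g a) x)"
  by (rule partial_deriv_eqI) (auto intro!: derivative_eq_intros has_derivative_partial_deriv(2) assms)

definition Ck_diff :: "nat \<Rightarrow> (real^'n \<Rightarrow> real) \<Rightarrow> bool" where
  "Ck_diff k f \<longleftrightarrow> (\<forall>is x. length is < k \<longrightarrow> iter_partial is f differentiable (at x))"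

lemma Ck_diffD: "Ck_diff k f \<Longrightarrow> length is < k \<Longrightarrow> iter_partial is f differentiable (at x)"
  by (simp add: Ck_diff_def)

lemma iter_partial_cmult_sum:
  assumes "\<And>a. a \<in> A \<Longrightarrow> Ck_diff k (g a)" and "length is \<le> k"
  shows "iter_partial is (\<lambda>x. c * (\<Sum>a\<in>A. g a x)) = (\<lambda>x. c * (\<Sum>a\<in>A. iter_partial is (g a) x))"
  using assms(2)
proof (induction "is")
  case (Cons i "is")
  then have e: "iter_partial is (\<lambda>x. c * (\<Sum>a\<in>A. g a x)) = (\<lambda>x. c * (\<Sum>a\<in>A. iter_partial is (g a) x))" by simp
  show ?case unfolding iter_partial_simps e
    using Cons.prems assms(1) by (auto simp: fun_eq_iff intro!: partial_deriv_cmult_sum Ck_diffD)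
qed simp

lemma Ck_diff_cmult_sum:
  assumes "\<And>a. a \<in> A \<Longrightarrow> Ck_diff k (g a)"
  shows "Ck_diff k (\<lambda>x. c * (\<Sum>a\<in>A. g a x))"
  unfolding Ck_diff_def
proof (intro allI impI)
  fix "is" :: "'b list" and x assume l: "length is < k"
  have "iter_partial is (\<lambda>x. c * (\<Sum>a\<in>A. g a x)) = (\<lambda>x. c * (\<Sum>a\<in>A. iter_partial is (g a) x))"
    by (rule iter_partial_cmult_sum[OF assms]) (use l in auto)
  moreover have "(\<lambda>x. c * (\<Sum>a\<in>A. iter_partial is (g a) x)) differentiable at x"
  proof (cases "finite A")
    case True
    then show ?thesis using Ck_diffD[OF assms l]
      by (intro differentiable_mult differentiable_const differentiable_sum) auto
  qed simp
  ultimately show "iter_partial is (\<lambda>x. c * (\<Sum>a\<in>A. g a x)) differentiable at x" by simp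
qed

lemma Ck_diff_iter_partial:
  "Ck_diff (k + length js) f \<Longrightarrow> Ck_diff k (iter_partial js f)"
  unfolding Ck_diff_def iter_partial_append[symmetric] by auto

lemma Ck_diff_mono: "Ck_diff k f \<Longrightarrow> l \<le> k \<Longrightarrow> Ck_diff l f"
  by (auto simp: Ck_diff_def)

text \<open>The index lists of the terms \<open>\<partial>\<^sub>i\<partial>\<^sub>i\<partial>\<^sub>j\<partial>\<^sub>j\<dots>\<close> in a power of the Laplacian.\<close>

definition doubled :: "'n list \<Rightarrow> 'n list" where "doubled is = concat (map (\<lambda>i. [i, i]) is)"

lemma doubled_simps [simp]: "doubled [] = []" "doubled (i # is) = i # i # doubled is"
  by (auto simp: doubled_def)

lemma length_doubled [simp]: "length (doubled is) = 2 * length is"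
  by (induction "is") auto

lemma sum_lists_Suc:
  fixes F :: "'n::finite list \<Rightarrow> 'b::comm_monoid_add"
  shows "(\<Sum>is | length is = Suc m. F is) = (\<Sum>i\<in>UNIV. \<Sum>js | length js = m. F (i # js))"
proof -
  have "(\<Sum>is | length is = Suc m. F is) = (\<Sum>p\<in>UNIV \<times> {js. length js = m}. F (fst p # snd p))"
    by (rule sum.reindex_bij_witness[where i="\<lambda>p. fst p # snd p" and j="\<lambda>l. (hd l, tl l)"])
      (auto simp: length_Suc_conv)
  also have "\<dots> = (\<Sum>i\<in>UNIV. \<Sum>js | length js = m. F (i # js))"
    by (simp add: sum.cartesian_product split_def)
  finally show ?thesis .
qed

lemma finite_lists_length [simp]: "finite {is :: 'n::finite list. length is = m}"
  using finite_lists_length_eq[of "UNIV :: 'n set" m] by simp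

text \<open>In this form every statement about \<open>(-\<Delta>)\<^sup>m\<close> reduces to one about a single iterated
partial derivative. The smoothness assumption is needed because \<open>deriv\<close> is additive only on
differentiable functions.\<close>

lemma neg_laplacian_pow_expand:
  fixes f :: "real^'n \<Rightarrow> real"
  assumes "Ck_diff (2 * m) f"
  shows "neg_laplacian_pow m f = (\<lambda>x. (-1) ^ m * (\<Sum>is | length is = m. iter_partial (doubled is) f x))"
  using assms
proof (induction m)
  case 0
  then show ?case by simp
next
  case (Suc m)
  have C: "Ck_diff 2 (iter_partial (doubled is) f)" if "length is = m" for "is"
    by (rule Ck_diff_iter_partial) (use that Suc.prems in simp)
  have "Ck_diff (2 * m) f" using Suc.prems by (rule Ck_diff_mono) simp
  note IH = Suc.IH[OF this]
  have *: "partial_deriv i (partial_deriv i (\<lambda>x. (-1) ^ m * (\<Sum>is | length is = m. iter_partial (doubled is) f x))) =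
     (\<lambda>x. (-1) ^ m * (\<Sum>is | length is = m. iter_partial [i, i] (iter_partial (doubled is) f) x))" for i
    using iter_partial_cmult_sum[of "{is. length is = m}" 2 "\<lambda>is. iter_partial (doubled is) f" "[i,i]" "(-1) ^ m"] C by simp
  show ?case
    unfolding funpow.simps o_apply IH unfolding neg_laplacian_def[abs_def] * sum_lists_Suc
    by (simp add: sum_distrib_left sum_negf)
qed

lemma iter_partial_neg_laplacian_pow:
  fixes f :: "real^'n \<Rightarrow> real"
  assumes "Ck_diff (2 * m + k) f" "length is \<le> k"
  shows "iter_partial is (\<lambda>x. b * neg_laplacian_pow m f x) = (\<lambda>x. (b * (-1) ^ m) * (\<Sum>js | length js = m. iter_partial (is @ doubled js) f x))"
    and "Ck_diff k (\<lambda>x. b * neg_laplacian_pow m f x)"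
proof -
  have e: "(\<lambda>x. b * neg_laplacian_pow m f x) = (\<lambda>x. (b * (-1) ^ m) * (\<Sum>is | length is = m. iter_partial (doubled is) f x))"
    using neg_laplacian_pow_expand[OF Ck_diff_mono[OF assms(1)], of m] by (simp add: mult.assoc)
  have C: "Ck_diff k (iter_partial (doubled js) f)" if "js \<in> {js. length js = m}" for js
    by (rule Ck_diff_iter_partial) (use that assms in \<open>simp add: add.commute\<close>)
  show "iter_partial is (\<lambda>x. b * neg_laplacian_pow m f x) = (\<lambda>x. (b * (-1) ^ m) * (\<Sum>js | length js = m. iter_partial (is @ doubled js) f x))"
    unfolding e iter_partial_append by (rule iter_partial_cmult_sum[OF C assms(2)])
  show "Ck_diff k (\<lambda>x. b * neg_laplacian_pow m f x)"
    unfolding e by (rule Ck_diff_cmult_sum[OF C])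
qed

lemma iter_partial_zero:
  fixes f :: "real^'n \<Rightarrow> real"
  assumes S: "open S" and "\<And>x. x \<in> S \<Longrightarrow> f x = 0" and "x \<in> S"
  shows "iter_partial is f x = 0"
  using assms(3)
proof (induction "is" arbitrary: x)
  case Nil
  then show ?case using assms by simp
next
  case (Cons i "is")
  have "open ((\<lambda>h. x + h *\<^sub>R axis i 1) -` S)"
    by (intro continuous_open_vimage S continuous_intros)
  have "((\<lambda>h. iter_partial is f (x + h *\<^sub>R axis i 1)) has_real_derivative 0) (at 0)"
    by (rule has_field_derivative_transform_within_open[where f="\<lambda>_. 0" and S="(\<lambda>h. x + h *\<^sub>R axis i 1) -` S"])
      (use Cons S in \<open>auto intro!: continuous_open_vimage continuous_intros\<close>)
  then show ?case using partial_deriv_eqI by simp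
qed

text \<open>Initial data: functions of class \<open>C\<^sup>k\<^sup>,\<^sup>\<gamma>\<close> on the whole space that vanish outside the
compact set \<open>K\<close>.\<close>

definition Ck_Holder_compact :: "nat \<Rightarrow> real \<Rightarrow> (real^'n) set \<Rightarrow> (real^'n \<Rightarrow> real) \<Rightarrow> bool" where
  "Ck_Holder_compact k \<gamma> K g \<longleftrightarrow> compact K \<and> Ck_diff k g \<and> (\<forall>is. length is = k \<longrightarrow> Holder_on \<gamma> UNIV (iter_partial is g))
     \<and> (\<forall>is x. x \<notin> K \<longrightarrow> iter_partial is g x = 0)"

lemma Holder_imp_continuous:
  assumes "Holder_on \<gamma> UNIV f" "0 < \<gamma>"
  shows "continuous_on UNIV f"
proof -
  obtain C where C: "\<And>x y. \<bar>f x - f y\<bar> \<le> C * dist x y powr \<gamma>" using assms by (auto simp: Holder_on_def)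
  have "(f \<longlongrightarrow> f x) (at x)" for x
  proof (rule tendsto_dist_iff[THEN iffD2])
    have "((\<lambda>y. dist y x) \<longlongrightarrow> 0) (at x)"
      using tendsto_dist_iff[THEN iffD1, OF tendsto_ident_at] .
    then have "((\<lambda>y. C * dist y x powr \<gamma>) \<longlongrightarrow> C * 0 powr \<gamma>) (at x)"
      using assms(2) by (intro tendsto_mult[OF tendsto_const] tendsto_powr'[OF _ tendsto_const] disjI2 conjI) auto
    then have "((\<lambda>y. C * dist y x powr \<gamma>) \<longlongrightarrow> 0) (at x)" using assms(2) by simp
    then show "((\<lambda>y. dist (f y) (f x)) \<longlongrightarrow> 0) (at x)"
      by (rule Lim_null_comparison[rotated]) (auto simp: dist_real_def C)
  qed
  then show ?thesis by (simp add: continuous_on_def)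
qed

lemma Ck_Holder_compact_continuous:
  assumes "Ck_Holder_compact k \<gamma> K g" "0 < \<gamma>" "length is \<le> k"
  shows "continuous_on UNIV (iter_partial is g)"
proof (cases "length is = k")
  case True
  then show ?thesis using assms Holder_imp_continuous by (auto simp: Ck_Holder_compact_def)
next
  case False
  then have "iter_partial is g differentiable (at x)" for x
    using assms by (auto simp: Ck_Holder_compact_def Ck_diff_def)
  then show ?thesis by (intro continuous_at_imp_continuous_on ballI differentiable_imp_continuous_within)
qed

lemma continuous_on_weight: "continuous_on S (weight :: real^'n \<Rightarrow> real)"
  unfolding weight_def by (intro continuous_intros) (auto simp: add_nonneg_eq_0_iff)

lemma compact_support_le_weight:
  fixes f :: "real^'n \<Rightarrow> 'b::real_normed_vector"
  assumes "continuous_on UNIV f" "compact K" "\<And>x. x \<notin> K \<Longrightarrow> f x = 0"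
  obtains C where "0 \<le> C" "\<And>x. norm (f x) \<le> C * weight x"
proof -
  have "continuous_on K (\<lambda>x. norm (f x) / weight x)"
    using assms(1) weight_pos by (intro continuous_intros continuous_on_weight) (auto intro: continuous_on_subset simp: less_imp_neq[OF weight_pos, symmetric])
  from compact_imp_bounded[OF compact_continuous_image[OF this assms(2)]]
  obtain C where C: "\<And>x. x \<in> K \<Longrightarrow> norm (norm (f x) / weight x) \<le> C" by (auto simp: bounded_iff)
  have "norm (f x) \<le> max C 0 * weight x" for x
  proof (cases "x \<in> K")
    case True
    then have "norm (f x) / weight x \<le> max C 0" using C[of x] weight_pos[of x] by (simp add: le_max_iff_disj)
    then show ?thesis using weight_pos[of x] by (simp add: divide_le_eq)
  next
    case False
    then show ?thesis using assms(3) weight_pos[of x] by simp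
  qed
  then show ?thesis using that[of "max C 0"] by auto
qed

lemma weight_le_1: "weight x \<le> 1"
  unfolding weight_def by (intro prod_le_1) (auto simp: divide_le_eq add_pos_nonneg)

lemma Ck_Holder_compact_le_weight:
  assumes "Ck_Holder_compact k \<gamma> K g" "0 < \<gamma>" "length is \<le> k"
  obtains C where "0 \<le> C" "\<And>x. \<bar>iter_partial is g x\<bar> \<le> C * weight x"
  by (rule compact_support_le_weight[OF Ck_Holder_compact_continuous[OF assms], of K])
    (use assms in \<open>auto simp: Ck_Holder_compact_def\<close>)

lemma Ck_Holder_compact_bounded:
  assumes "Ck_Holder_compact k \<gamma> K g" "0 < \<gamma>" "length is \<le> k"
  obtains C where "0 \<le> C" "\<And>x. \<bar>iter_partial is g x\<bar> \<le> C"
proof -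
  obtain C where C: "0 \<le> C" "\<And>x. \<bar>iter_partial is g x\<bar> \<le> C * weight x"
    using Ck_Holder_compact_le_weight[OF assms] by blast
  have "\<bar>iter_partial is g x\<bar> \<le> C" for x
    using C(2)[of x] mult_left_mono[OF weight_le_1[of x] C(1)] by simp
  with C(1) show ?thesis using that by blast
qed

text \<open>Lower derivatives are bounded and Lipschitz continuous, hence Hoelder continuous: for
distances below one because \<open>\<gamma> < 1\<close>, for larger ones because they are bounded.\<close>

lemma Ck_Holder_compact_lower:
  assumes g: "Ck_Holder_compact k \<gamma> K g" and "0 < \<gamma>" "\<gamma> < 1" "l < k"
  shows "Ck_Holder_compact l \<gamma> K g"
  unfolding Ck_Holder_compact_def
proof (intro conjI allI impI)
  show "compact K" "Ck_diff l g" and "\<And>is x. x \<notin> K \<Longrightarrow> iter_partial is g x = 0"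
    using g \<open>l < k\<close> by (auto simp: Ck_Holder_compact_def intro: Ck_diff_mono)
  fix "is" :: "'a list" assume l: "length is = l"
  let ?f = "iter_partial is g"
  obtain M where M: "0 \<le> M" "\<And>x. \<bar>?f x\<bar> \<le> M"
    using Ck_Holder_compact_bounded[OF g \<open>0 < \<gamma>\<close>, of "is"] l \<open>l < k\<close> by auto
  have "\<exists>C. \<forall>x. \<bar>partial_deriv i ?f x\<bar> \<le> C" for i
    using Ck_Holder_compact_bounded[OF g \<open>0 < \<gamma>\<close>, of "i # is"] l \<open>l < k\<close> by auto
  then obtain C where C: "\<And>i x. \<bar>partial_deriv i ?f x\<bar> \<le> C i" by metis
  let ?L = "\<Sum>i\<in>UNIV. C i"
  have C0: "0 \<le> C i" for i using C[of i 0] by simp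
  then have L0: "0 \<le> ?L" by (intro sum_nonneg)
  have lip: "\<bar>?f x - ?f y\<bar> \<le> ?L * norm (x - y)" for x y
    unfolding real_norm_def[symmetric]
  proof (rule differentiable_bound[of UNIV ?f "\<lambda>x h. \<Sum>i\<in>UNIV. h $ i * partial_deriv i ?f x"])
    fix x :: "real^'a"
    show "(?f has_derivative (\<lambda>h. \<Sum>i\<in>UNIV. h $ i * partial_deriv i ?f x)) (at x)"
      by (rule has_derivative_partial_deriv(1)) (use g l \<open>l < k\<close> in \<open>auto simp: Ck_Holder_compact_def Ck_diff_def\<close>)
    show "onorm (\<lambda>h. \<Sum>i\<in>UNIV. h $ i * partial_deriv i ?f x) \<le> ?L"
    proof (rule onorm_bound)
      fix h :: "real^'a"
      have "norm (\<Sum>i\<in>UNIV. h $ i * partial_deriv i ?f x) \<le> (\<Sum>i\<in>UNIV. norm h * C i)"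
        by (rule order_trans[OF norm_sum sum_mono]) (auto simp: abs_mult intro!: mult_mono C component_le_norm_cart)
      then show "norm (\<Sum>i\<in>UNIV. h $ i * partial_deriv i ?f x) \<le> ?L * norm h"
        by (simp add: sum_distrib_left mult.commute)
    qed (auto intro!: sum_nonneg C0)
  qed auto
  have "\<bar>?f x - ?f y\<bar> \<le> (?L + 2 * M) * dist x y powr \<gamma>" for x y
  proof (cases "dist x y \<le> 1")
    case True
    have "dist x y \<le> dist x y powr \<gamma>"
    proof (cases "dist x y = 0")
      case False
      then show ?thesis using True powr_mono'[of \<gamma> 1 "dist x y"] \<open>\<gamma> < 1\<close> by simp
    qed simp
    then have "?L * norm (x - y) \<le> (?L + 2 * M) * dist x y powr \<gamma>"
      using M(1) L0 by (intro mult_mono) (auto simp: dist_norm)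
    then show ?thesis using lip[of x y] by linarith
  next
    case False
    then have "1 \<le> dist x y powr \<gamma>" using \<open>0 < \<gamma>\<close> by (simp add: ge_one_powr_ge_zero)
    then have "2 * M * 1 \<le> (?L + 2 * M) * dist x y powr \<gamma>"
      using M(1) L0 by (intro mult_mono) auto
    then show ?thesis using M(2)[of x] M(2)[of y] by linarith
  qed
  then show "Holder_on \<gamma> UNIV ?f" unfolding Holder_on_def by blast
qed

lemma Holder_on_cmult_sum:
  assumes "\<And>a. a \<in> A \<Longrightarrow> Holder_on \<gamma> S (f a)"
  shows "Holder_on \<gamma> S (\<lambda>x. c * (\<Sum>a\<in>A. f a x))"
proof -
  obtain C where C: "\<And>a x y. a \<in> A \<Longrightarrow> x \<in> S \<Longrightarrow> y \<in> S \<Longrightarrow> \<bar>f a x - f a y\<bar> \<le> C a * dist x y powr \<gamma>"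
    using assms unfolding Holder_on_def by metis
  have "\<bar>c * (\<Sum>a\<in>A. f a x) - c * (\<Sum>a\<in>A. f a y)\<bar> \<le> (\<bar>c\<bar> * sum C A) * dist x y powr \<gamma>" if "x \<in> S" "y \<in> S" for x y
  proof -
    have "\<bar>c * (\<Sum>a\<in>A. f a x) - c * (\<Sum>a\<in>A. f a y)\<bar> = \<bar>c\<bar> * \<bar>\<Sum>a\<in>A. f a x - f a y\<bar>"
      by (simp add: sum_subtractf flip: abs_mult right_diff_distrib)
    also have "\<dots> \<le> \<bar>c\<bar> * (\<Sum>a\<in>A. C a * dist x y powr \<gamma>)"
      by (intro mult_left_mono order_trans[OF sum_abs sum_mono] C that) auto
    finally show ?thesis by (simp add: sum_distrib_right mult.assoc)
  qed
  then show ?thesis unfolding Holder_on_def by blast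
qed

lemma Ck_Holder_compact_neg_laplacian_pow:
  assumes "Ck_Holder_compact (2 * m + k) \<gamma> K g"
  shows "Ck_Holder_compact k \<gamma> K (\<lambda>x. b * neg_laplacian_pow m g x)"
proof -
  have C: "Ck_diff (2 * m + k) g" using assms by (simp add: Ck_Holder_compact_def)
  show ?thesis
    unfolding Ck_Holder_compact_def
  proof (intro conjI allI impI)
    show "compact K" "Ck_diff k (\<lambda>x. b * neg_laplacian_pow m g x)"
      using assms iter_partial_neg_laplacian_pow(2)[OF C, of "[]"] by (auto simp: Ck_Holder_compact_def)
    show "Holder_on \<gamma> UNIV (iter_partial is (\<lambda>x. b * neg_laplacian_pow m g x))" if "length is = k" for "is"
      unfolding iter_partial_neg_laplacian_pow(1)[OF C order_eq_refl[OF that]]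
      by (rule Holder_on_cmult_sum) (use assms that in \<open>auto simp: Ck_Holder_compact_def\<close>)
    have "b * neg_laplacian_pow m g x = 0" if "x \<notin> K" for x
    proof -
      have "b * neg_laplacian_pow m g x = (b * (-1) ^ m) * (\<Sum>js | length js = m. iter_partial (doubled js) g x)"
        using fun_cong[OF iter_partial_neg_laplacian_pow(1)[OF C, of "[]" b], of x] by simp
      also have "\<dots> = 0" using assms that by (simp add: Ck_Holder_compact_def)
      finally show ?thesis .
    qed
    moreover have "open (- K)" using assms by (auto simp: Ck_Holder_compact_def intro: compact_imp_closed)
    ultimately show "iter_partial is (\<lambda>x. b * neg_laplacian_pow m g x) x = 0" if "x \<notin> K" for "is" x
      using that iter_partial_zero[of "- K"] by auto
  qed
qed

text \<open>Extension by zero preserves the regularity. A point of the support and a point outside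
\<open>\<Omega>\<close> have a distance bounded below, so the Hoelder quotient of such a pair is controlled by the
bound of the derivative on the support.\<close>

lemma Ck_Holder_on_imp_Ck_Holder_compact:
  fixes g :: "real^'n \<Rightarrow> real"
  assumes g: "Ck_Holder_on k \<gamma> \<Omega> g" and \<Omega>: "open \<Omega>" "bounded \<Omega>" and \<gamma>: "0 < \<gamma>"
    and supp: "closure {x. g x \<noteq> 0} \<subseteq> \<Omega>"
  shows "Ck_Holder_compact k \<gamma> (closure {x. g x \<noteq> 0}) g"
proof -
  let ?K = "closure {x. g x \<noteq> 0}"
  have K: "compact ?K" using \<Omega>(2) supp by (meson bounded_subset closed_closure compact_eq_bounded_closed)
  have z: "iter_partial is g x = 0" if "x \<notin> ?K" for "is" x
    by (rule iter_partial_zero[OF open_Compl[OF closed_closure]]) (use that closure_subset[of "{x. g x \<noteq> 0}"] in auto)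
  have oK: "open (- ?K)" by (rule open_Compl[OF closed_closure])
  show ?thesis
    unfolding Ck_Holder_compact_def Ck_diff_def
  proof (intro conjI allI impI)
    fix "is" :: "'n list" and x assume l: "length is < k"
    show "iter_partial is g differentiable (at x)"
    proof (cases "x \<in> \<Omega>")
      case True
      then show ?thesis using g l by (auto simp: Ck_Holder_on_def)
    next
      case False
      then have "x \<in> - ?K" using supp by auto
      then have "(iter_partial is g has_derivative (\<lambda>_. 0)) (at x)"
        by (intro has_derivative_transform_within_open[OF has_derivative_const oK]) (auto simp: z)
      then show ?thesis by (auto simp: differentiable_def)
    qed
  next
    fix "is" :: "'n list" assume l: "length is = k"
    let ?f = "iter_partial is g"
    obtain C where C: "\<And>x y. x \<in> \<Omega> \<Longrightarrow> y \<in> \<Omega> \<Longrightarrow> \<bar>?f x - ?f y\<bar> \<le> C * dist x y powr \<gamma>"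
      using g l unfolding Ck_Holder_on_def Holder_on_def by blast
    obtain d where d: "0 < d" "\<And>x y. x \<in> ?K \<Longrightarrow> y \<in> - \<Omega> \<Longrightarrow> d \<le> dist x y"
    proof -
      have "?K \<inter> - \<Omega> = {}" using supp by blast
      from separate_compact_closed[OF K closed_Compl[OF \<Omega>(1)] this] show ?thesis using that by blast
    qed
    have "\<exists>M. \<forall>x\<in>?K. \<bar>?f x\<bar> \<le> M"
    proof (cases "?K = {}")
      case False
      then obtain x1 where x1: "x1 \<in> ?K" by (metis ex_in_conv)
      have "\<bar>?f x\<bar> \<le> \<bar>?f x1\<bar> + \<bar>C\<bar> * diameter ?K powr \<gamma>" if "x \<in> ?K" for x
      proof -
        have "\<bar>?f x - ?f x1\<bar> \<le> C * dist x x1 powr \<gamma>" using C that x1 supp by blast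
        also have "\<dots> \<le> \<bar>C\<bar> * diameter ?K powr \<gamma>"
          using diameter_bounded_bound[OF compact_imp_bounded[OF K] that x1] \<gamma>
          by (intro mult_mono powr_mono2) auto
        finally show ?thesis by linarith
      qed
      then show ?thesis by blast
    qed simp
    then obtain M where M: "\<And>x. x \<in> ?K \<Longrightarrow> \<bar>?f x\<bar> \<le> M" by blast
    have far: "\<bar>?f x - ?f y\<bar> \<le> (\<bar>C\<bar> + \<bar>M\<bar> / d powr \<gamma>) * dist x y powr \<gamma>" if y: "y \<notin> \<Omega>" for x y
    proof (cases "x \<in> ?K")
      case True
      have fy: "?f y = 0" using y supp z by blast
      have "d powr \<gamma> \<le> dist x y powr \<gamma>" using d True y \<gamma> by (intro powr_mono2) auto
      then have "\<bar>M\<bar> / d powr \<gamma> * d powr \<gamma> \<le> (\<bar>C\<bar> + \<bar>M\<bar> / d powr \<gamma>) * dist x y powr \<gamma>"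
        by (intro mult_mono) auto
      then have "\<bar>M\<bar> \<le> (\<bar>C\<bar> + \<bar>M\<bar> / d powr \<gamma>) * dist x y powr \<gamma>" using d by simp
      then show ?thesis using M[OF True] fy by linarith
    next
      case False
      then show ?thesis using y supp z by (auto simp: subset_eq)
    qed
    have "\<bar>?f x - ?f y\<bar> \<le> (\<bar>C\<bar> + \<bar>M\<bar> / d powr \<gamma>) * dist x y powr \<gamma>" for x y
    proof -
      consider "y \<notin> \<Omega>" | "x \<notin> \<Omega>" | "x \<in> \<Omega>" "y \<in> \<Omega>" by blast
      then show ?thesis
      proof cases
        case 2
        then show ?thesis using far[of x y] by (simp add: dist_commute abs_minus_commute)
      next
        case 3
        have "C * dist x y powr \<gamma> \<le> (\<bar>C\<bar> + \<bar>M\<bar> / d powr \<gamma>) * dist x y powr \<gamma>"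
          by (intro mult_right_mono) (auto intro: add_increasing2)
        then show ?thesis using C[OF 3] by linarith
      qed (rule far)
    qed
    then show "Holder_on \<gamma> UNIV ?f" unfolding Holder_on_def by blast
  qed (use K z in auto)
qed

section \<open>The Poisson integral solves the Cauchy problem\<close>

definition profile :: "nat \<Rightarrow> real^'n \<Rightarrow> real" where "profile m z = Re (poisson_kernel m 1 z)"

lemma of_real_profile: "complex_of_real (profile m z) = poisson_kernel m 1 z"
  unfolding profile_def by (simp add: complex_eq_iff poisson_kernel_real)

lemma profile_measurable [measurable]: "profile m \<in> borel_measurable borel"
  unfolding profile_def[abs_def] by measurable

lemma profile_integrable: "1 \<le> m \<Longrightarrow> integrable lborel (profile m :: real^'n \<Rightarrow> real)"
  unfolding profile_def[abs_def] by (intro integrable_Re poisson_kernel_integrable)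

lemma profile_integral: "1 \<le> m \<Longrightarrow> (LINT z|lborel. profile m (z :: real^'n)) = 1"
  unfolding profile_def[abs_def] by (simp add: integral_Re poisson_kernel_integrable poisson_kernel_integral)

text \<open>The Poisson integral after the substitution \<open>y = x - r z\<close>, where \<open>r\<^sup>2\<^sup>m\<close> is the integral of the
coefficient. Unlike the original form it is meaningful for \<open>r = 0\<close>, and all dependence on \<open>x\<close> and \<open>r\<close>
sits in the regular function \<open>g\<close>.\<close>

definition kernel_average :: "nat \<Rightarrow> real \<Rightarrow> (real^'n \<Rightarrow> real) \<Rightarrow> real^'n \<Rightarrow> real" where
  "kernel_average m r g x = (LINT z|lborel. profile m z * g (x - r *\<^sub>R z))"

lemma kernel_average_zero: "1 \<le> m \<Longrightarrow> kernel_average m 0 g x = g x"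
  by (simp add: kernel_average_def profile_integral)

lemma kernel_average_integrable:
  assumes m: "1 \<le> m" and g: "continuous_on UNIV g" "\<And>x. \<bar>g x\<bar> \<le> C"
  shows "integrable lborel (\<lambda>z. profile m z * g (x - r *\<^sub>R z))"
proof (rule Bochner_Integration.integrable_bound[OF integrable_mult_right[OF profile_integrable[OF m], of C]])
  have [measurable]: "g \<in> borel_measurable borel" by (rule borel_measurable_continuous_onI[OF g(1)])
  show "(\<lambda>z. profile m z * g (x - r *\<^sub>R z)) \<in> borel_measurable lborel" by measurable
  have b: "\<bar>g y\<bar> \<le> \<bar>C\<bar>" for y using g(2)[of y] by linarith
  show "AE z in lborel. norm (profile m z * g (x - r *\<^sub>R z)) \<le> norm (C * profile m z)"
    using mult_left_mono[OF b abs_ge_zero] by (intro AE_I2) (simp add: abs_mult mult.commute[of "\<bar>C\<bar>"])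
qed

lemma kernel_average_bound:
  assumes m: "1 \<le> m" and g: "continuous_on UNIV g" "\<And>x. \<bar>g x\<bar> \<le> C"
  shows "\<bar>kernel_average m r g (x :: real^'n)\<bar> \<le> C * (LINT z|lborel. \<bar>profile m (z :: real^'n)\<bar>)"
proof -
  have "\<bar>kernel_average m r g x\<bar> \<le> (LINT z|lborel. C * \<bar>profile m (z :: real^'n)\<bar>)"
    unfolding kernel_average_def real_norm_def[symmetric]
  proof (rule order_trans[OF integral_norm_bound integral_mono])
    show "norm (profile m z * g (x - r *\<^sub>R z)) \<le> C * norm (profile m z)" for z
      using mult_left_mono[OF g(2) abs_ge_zero[of "profile m z"], of "x - r *\<^sub>R z"] by (simp add: abs_mult mult.commute)
  qed (use profile_integrable[OF m] kernel_average_integrable[OF assms] in auto)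
  then show ?thesis by simp
qed

lemma kernel_average_cmult_sum:
  assumes m: "1 \<le> m" and g: "\<And>a. a \<in> A \<Longrightarrow> continuous_on UNIV (g a)" "\<And>a. a \<in> A \<Longrightarrow> \<exists>C. \<forall>x. \<bar>g a x\<bar> \<le> C"
  shows "kernel_average m r (\<lambda>x. c * (\<Sum>a\<in>A. g a x)) x = c * (\<Sum>a\<in>A. kernel_average m r (g a) x)"
proof -
  have "integrable lborel (\<lambda>z. profile m z * g a (x - r *\<^sub>R z))" if "a \<in> A" for a
    using g(2)[OF that] kernel_average_integrable[OF m g(1)[OF that]] by blast
  note i = this
  have "kernel_average m r (\<lambda>x. c * (\<Sum>a\<in>A. g a x)) x = (LINT z|lborel. c * (\<Sum>a\<in>A. profile m z * g a (x - r *\<^sub>R z)))"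
    unfolding kernel_average_def by (simp add: sum_distrib_left mult_ac)
  also have "\<dots> = c * (\<Sum>a\<in>A. kernel_average m r (g a) x)"
    unfolding kernel_average_def using i by (simp add: Bochner_Integration.integral_sum)
  finally show ?thesis .
qed

lemma kernel_average_has_derivative:
  assumes m: "1 \<le> m" and g: "continuous_on UNIV g" "\<And>x. \<bar>g x\<bar> \<le> C"
    and d: "\<And>x. g differentiable (at x)"
    and pd: "\<And>i. continuous_on UNIV (partial_deriv i g)" "\<And>i. \<exists>D. \<forall>x. \<bar>partial_deriv i g x\<bar> \<le> D"
  shows "(kernel_average m r g has_derivative (\<lambda>h. \<Sum>i\<in>UNIV. h $ i * kernel_average m r (partial_deriv i g) x)) (at (x :: real^'n))"
proof -
  obtain D where D: "\<And>i x. \<bar>partial_deriv i g x\<bar> \<le> D i" using pd(2) by metis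
  have [measurable]: "partial_deriv i g \<in> borel_measurable borel" for i
    by (rule borel_measurable_continuous_onI[OF pd(1)])
  have "((\<lambda>x. LINT z|lborel. profile m z * g (x - r *\<^sub>R z)) has_derivative
      (\<lambda>h. LINT z|lborel. profile m z * (\<Sum>i\<in>UNIV. h $ i * partial_deriv i g (x - r *\<^sub>R z)))) (at x within UNIV)"
  proof (rule has_derivative_integral[where G="\<lambda>z. \<bar>profile m z\<bar> * sum D UNIV"])
    show "integrable lborel (\<lambda>z::real^'n. \<bar>profile m z\<bar> * sum D UNIV)"
      by (intro integrable_mult_left integrable_abs profile_integrable[OF m])
    fix x z h :: "real^'n"
    have "((\<lambda>x. g (x - r *\<^sub>R z)) has_derivative (\<lambda>h. \<Sum>i\<in>UNIV. h $ i * partial_deriv i g (x - r *\<^sub>R z))) (at x)"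
      by (rule has_derivative_compose[of "\<lambda>x. x - r *\<^sub>R z" "\<lambda>h. h" x UNIV g, simplified])
        (use d in \<open>auto intro!: derivative_eq_intros has_derivative_partial_deriv(1)\<close>)
    then show "((\<lambda>x. profile m z * g (x - r *\<^sub>R z)) has_derivative (\<lambda>h. profile m z * (\<Sum>i\<in>UNIV. h $ i * partial_deriv i g (x - r *\<^sub>R z)))) (at x)"
      by (rule has_derivative_mult_right)
    have "norm (\<Sum>i\<in>UNIV. h $ i * partial_deriv i g (x - r *\<^sub>R z)) \<le> (\<Sum>i\<in>UNIV. norm h * D i)"
      by (rule order_trans[OF norm_sum sum_mono]) (auto simp: abs_mult intro!: mult_mono D component_le_norm_cart)
    also have "\<dots> = sum D UNIV * norm h" by (simp add: sum_distrib_right mult.commute[of "norm h"])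
    finally show "norm (profile m z * (\<Sum>i\<in>UNIV. h $ i * partial_deriv i g (x - r *\<^sub>R z))) \<le> \<bar>profile m z\<bar> * sum D UNIV * norm h"
      by (simp add: abs_mult mult.assoc mult_left_mono)
  qed (use kernel_average_integrable[OF m g] in \<open>auto simp: measurable_lborel1\<close>)
  moreover have "(LINT z|lborel. profile m z * (\<Sum>i\<in>UNIV. h $ i * partial_deriv i g (x - r *\<^sub>R z))) = (\<Sum>i\<in>UNIV. h $ i * kernel_average m r (partial_deriv i g) x)" for h
  proof -
    have "(LINT z|lborel. profile m z * (\<Sum>i\<in>UNIV. h $ i * partial_deriv i g (x - r *\<^sub>R z))) = (LINT z|lborel. (\<Sum>i\<in>UNIV. h $ i * (profile m z * partial_deriv i g (x - r *\<^sub>R z))))"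
      by (simp add: sum_distrib_left mult_ac)
    also have "\<dots> = (\<Sum>i\<in>UNIV. h $ i * kernel_average m r (partial_deriv i g) x)"
      unfolding kernel_average_def using kernel_average_integrable[OF m pd(1) D] by (simp add: Bochner_Integration.integral_sum)
    finally show ?thesis .
  qed
  ultimately show ?thesis unfolding kernel_average_def[abs_def] by simp
qed

text \<open>The kernel does not depend on \<open>x\<close>, so all derivatives fall on the datum; this bounds them uniformly
up to \<open>r = 0\<close>.\<close>

lemma iter_partial_kernel_average:
  assumes m: "1 \<le> m" and g: "Ck_Holder_compact k \<gamma> K g" "0 < \<gamma>"
  shows "length is \<le> k \<Longrightarrow> iter_partial is (kernel_average m r g) = kernel_average m r (iter_partial is g)"
    and "Ck_diff k (kernel_average m r (g :: real^'n \<Rightarrow> real))"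
proof -
  have d: "(kernel_average m r (iter_partial is g) has_derivative (\<lambda>h. \<Sum>i\<in>UNIV. h $ i * kernel_average m r (partial_deriv i (iter_partial is g)) x)) (at x)"
    if l: "length is < k" for "is" x
  proof -
    obtain C where C: "\<And>x. \<bar>iter_partial is g x\<bar> \<le> C"
      using Ck_Holder_compact_bounded[OF g, of "is"] l by auto
    show ?thesis
    proof (rule kernel_average_has_derivative[OF m _ C])
      show "continuous_on UNIV (iter_partial is g)" using Ck_Holder_compact_continuous[OF g, of "is"] l by simp
      show "iter_partial is g differentiable at x" for x using g(1) l by (simp add: Ck_Holder_compact_def Ck_diff_def)
      show "continuous_on UNIV (partial_deriv i (iter_partial is g))" for i
        using Ck_Holder_compact_continuous[OF g, of "i # is"] l by simp
      show "\<exists>D. \<forall>x. \<bar>partial_deriv i (iter_partial is g) x\<bar> \<le> D" for i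
        using Ck_Holder_compact_bounded[OF g, of "i # is"] l by auto
    qed
  qed
  show e: "iter_partial is (kernel_average m r g) = kernel_average m r (iter_partial is g)" if "length is \<le> k" for "is"
    using that
  proof (induction "is")
    case (Cons i "is")
    then have e: "iter_partial is (kernel_average m r g) = kernel_average m r (iter_partial is g)" by simp
    show ?case unfolding iter_partial_simps e
      using Cons.prems has_derivative_imp_partial_deriv[OF d, of "is"] by (auto simp: fun_eq_iff)
  qed simp
  show "Ck_diff k (kernel_average m r g)"
    unfolding Ck_diff_def using e d by (auto simp: differentiable_def intro!: exI)
qed

lemma continuous_on_integral:
  fixes f :: "'p::metric_space \<Rightarrow> 'z \<Rightarrow> real"
  assumes c: "\<And>z. z \<in> space M \<Longrightarrow> continuous_on S (\<lambda>p. f p z)"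
    and b: "\<And>p z. p \<in> S \<Longrightarrow> z \<in> space M \<Longrightarrow> \<bar>f p z\<bar> \<le> G z" and G: "integrable M G"
    and m: "\<And>p. p \<in> S \<Longrightarrow> f p \<in> borel_measurable M"
  shows "continuous_on S (\<lambda>p. LINT z|M. f p z)"
  unfolding continuous_on_sequentially o_def
proof (intro allI ballI impI)
  fix X a assume a: "a \<in> S" and X: "(\<forall>n. X n \<in> S) \<and> X \<longlonglongrightarrow> a"
  show "(\<lambda>n. LINT z|M. f (X n) z) \<longlonglongrightarrow> (LINT z|M. f a z)"
  proof (rule integral_dominated_convergence[where w=G])
    show "AE z in M. (\<lambda>n. f (X n) z) \<longlonglongrightarrow> f a z"
      using c a X by (intro AE_I2) (auto simp: continuous_on_sequentially o_def)
  qed (use a X b G m in auto)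
qed

lemma continuous_on_kernel_average:
  assumes m: "1 \<le> m" and g: "continuous_on UNIV g" "\<And>x. \<bar>g x\<bar> \<le> C"
  shows "continuous_on UNIV (\<lambda>p. kernel_average m (fst p) g (snd p :: real^'n))"
  unfolding kernel_average_def
proof (rule continuous_on_integral[where G="\<lambda>z. C * \<bar>profile m z\<bar>"])
  have [measurable]: "g \<in> borel_measurable borel" by (rule borel_measurable_continuous_onI[OF g(1)])
  fix p :: "real \<times> (real^'n)" and z :: "real^'n"
  show "continuous_on UNIV (\<lambda>p. profile m z * g (snd p - fst p *\<^sub>R z))"
    by (intro continuous_intros continuous_on_compose2[OF g(1)]) auto
  show "\<bar>profile m z * g (snd p - fst p *\<^sub>R z)\<bar> \<le> C * \<bar>profile m z\<bar>"
    using mult_left_mono[OF g(2) abs_ge_zero[of "profile m z"], of "snd p - fst p *\<^sub>R z"] by (simp add: abs_mult mult.commute)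
  show "(\<lambda>z. profile m z * g (snd p - fst p *\<^sub>R z)) \<in> borel_measurable lborel" by measurable
qed (use profile_integrable[OF m] in auto)

lemma kernel_average_Holder:
  assumes m: "1 \<le> m" and g: "continuous_on UNIV g" "\<And>x. \<bar>g x\<bar> \<le> C"
    and H: "\<And>x y. \<bar>g x - g y\<bar> \<le> L * dist x y powr \<gamma>"
  shows "\<bar>kernel_average m r g x - kernel_average m r g (y :: real^'n)\<bar> \<le> L * (LINT z|lborel. \<bar>profile m (z :: real^'n)\<bar>) * dist x y powr \<gamma>"
proof -
  have i: "integrable lborel (\<lambda>z. profile m z * g (x - r *\<^sub>R z))" for x by (rule kernel_average_integrable[OF m g])
  have "kernel_average m r g x - kernel_average m r g y = (LINT z|lborel. profile m z * g (x - r *\<^sub>R z) - profile m z * g (y - r *\<^sub>R z))"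
    unfolding kernel_average_def by (rule Bochner_Integration.integral_diff[symmetric]; rule i)
  also have "\<bar>\<dots>\<bar> \<le> (LINT z|lborel. \<bar>profile m (z :: real^'n)\<bar> * (L * dist x y powr \<gamma>))"
    unfolding real_norm_def[symmetric]
  proof (rule order_trans[OF integral_norm_bound integral_mono])
    fix z :: "real^'n"
    have "\<bar>g (x - r *\<^sub>R z) - g (y - r *\<^sub>R z)\<bar> \<le> L * dist x y powr \<gamma>"
      using H[of "x - r *\<^sub>R z" "y - r *\<^sub>R z"] by (simp add: dist_norm)
    then show "norm (profile m z * g (x - r *\<^sub>R z) - profile m z * g (y - r *\<^sub>R z)) \<le> norm (profile m z) * (L * dist x y powr \<gamma>)"
      by (simp add: abs_mult mult_left_mono flip: right_diff_distrib)
  qed (use profile_integrable[OF m] i in auto)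
  finally show ?thesis by (simp add: mult_ac)
qed

lemma kernel_average_eq_poisson:
  assumes r: "0 < r" and [measurable]: "g \<in> borel_measurable borel"
  shows "complex_of_real (kernel_average m r g (x :: real^'n)) = (LINT y|lborel. poisson_kernel m (r ^ (2 * m)) (x - y) * of_real (g y))"
proof -
  let ?E = "poisson_kernel m (r ^ (2 * m)) :: real^'n \<Rightarrow> complex"
  have "(LINT y|lborel. ?E (x - y) * of_real (g y)) = (LINT y|lborel. ?E (x - (x - y)) * of_real (g (x - y)))"
    by (rule integral_reflection[symmetric]) measurable
  also have "\<dots> = (LINT y|lborel. ?E y * of_real (g (x - y)))" by simp
  also have "\<dots> = \<bar>r\<bar> ^ DIM(real^'n) *\<^sub>R (LINT z|lborel. ?E (0 + r *\<^sub>R z) * of_real (g (x - (0 + r *\<^sub>R z))))"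
    by (rule integral_scaling(1)) (use r in auto)
  also have "\<dots> = (LINT z|lborel. of_real (profile m z * g (x - r *\<^sub>R z)))"
    unfolding poisson_kernel_scale[OF r] using r
    by (simp add: scaleR_conv_of_real[where 'a=complex] mult.assoc of_real_profile)
  also have "\<dots> = complex_of_real (kernel_average m r g x)" unfolding kernel_average_def by (rule integral_complex_of_real)
  finally show ?thesis by simp
qed

text \<open>The multiplication formula, applied to the kernel centred at \<open>x\<close>. The sign of the exponent is
adjusted by the symmetry of the kernel.\<close>

lemma poisson_fourier:
  assumes m: "1 \<le> m" and a: "0 < a" and g: "integrable lborel g"
  shows "(LINT y|lborel. poisson_kernel m a (x - y) * complex_of_real (g y)) =
     1 / of_real ((2 * pi) ^ CARD('n)) * (LINT s|lborel. exp (- \<i> * of_real (x \<bullet> s)) * of_real (exp (- a * norm s ^ (2 * m))) * fourier (\<lambda>y. of_real (g y)) (s :: real^'n))"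
proof -
  let ?\<phi> = "\<lambda>s::real^'n. exp (- \<i> * of_real (x \<bullet> s)) * complex_of_real (exp (- a * norm s ^ (2 * m)))"
  have "poisson_kernel m a (x - y) = 1 / of_real ((2 * pi) ^ CARD('n)) * fourier ?\<phi> y" for y
  proof -
    have "poisson_kernel m a (x - y) = poisson_kernel m a (y - x)"
      using poisson_kernel_minus[of m a "y - x"] by simp
    also have "fourier (\<lambda>s. of_real (exp (- a * norm s ^ (2 * m)))) (y - x) = fourier ?\<phi> y"
      unfolding fourier_def
      by (intro Bochner_Integration.integral_cong) (auto simp: inner_diff_left exp_diff exp_minus algebra_simps divide_inverse)
    then have "poisson_kernel m a (y - x) = 1 / of_real ((2 * pi) ^ CARD('n)) * fourier ?\<phi> y"
      unfolding poisson_kernel_fourier by simp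
    finally show ?thesis .
  qed
  moreover have "(LINT y|lborel. fourier ?\<phi> y * of_real (g y)) = (LINT s|lborel. ?\<phi> s * fourier (\<lambda>y. of_real (g y)) s)"
  proof (rule fourier_multiplication_formula)
    have "integrable lborel (\<lambda>s::real^'n. exp (- a * norm s ^ (2 * m)))"
      using integrable_poly_exp[OF m a real_polynomial_function.intros(2)[of 1]] by simp
    then show "integrable lborel ?\<phi>"
      by (rule Bochner_Integration.integrable_bound) (auto simp: norm_mult)
  qed (use g in simp)
  ultimately show ?thesis by (simp add: mult.assoc)
qed

lemma fourier_cmult_sum:
  assumes "\<And>a. a \<in> A \<Longrightarrow> integrable lborel (g a)"
  shows "fourier (\<lambda>y. c * (\<Sum>a\<in>A. g a y)) s = c * (\<Sum>a\<in>A. fourier (g a) s)"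
proof -
  have "fourier (\<lambda>y. c * (\<Sum>a\<in>A. g a y)) s = (LINT y|lborel. c * (\<Sum>a\<in>A. exp (\<i> * of_real (s \<bullet> y)) * g a y))"
    unfolding fourier_def by (simp add: sum_distrib_left mult_ac)
  also have "\<dots> = c * (\<Sum>a\<in>A. fourier (g a) s)"
    unfolding fourier_def using fourier_integrable[OF assms] by (simp add: Bochner_Integration.integral_sum)
  finally show ?thesis .
qed

lemma Ck_Holder_compact_integrable:
  assumes "Ck_Holder_compact k \<gamma> K g" "0 < \<gamma>" "length is \<le> k"
  shows "integrable lborel (iter_partial is g)"
proof -
  obtain C where "\<And>x. \<bar>iter_partial is g x\<bar> \<le> C * weight x" using Ck_Holder_compact_le_weight[OF assms] by blast
  then show ?thesis
    by (intro integrable_le_weight[where C=C] borel_measurable_continuous_onI Ck_Holder_compact_continuous[OF assms]) auto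
qed

lemma fourier_iter_partial_doubled:
  assumes g: "Ck_Holder_compact k \<gamma> K g" "0 < \<gamma>"
  shows "2 * length is \<le> k \<Longrightarrow> fourier (\<lambda>y. of_real (iter_partial (doubled is) g y)) s
    = of_real ((-1) ^ length is * (\<Prod>i\<leftarrow>is. (s $ i)\<^sup>2)) * fourier (\<lambda>y. of_real (g y)) s"
proof (induction "is")
  case (Cons i "is")
  have step: "fourier (\<lambda>y. of_real (partial_deriv i (iter_partial js g) y)) s = - \<i> * of_real (s $ i) * fourier (\<lambda>y. of_real (iter_partial js g y)) s"
    if l: "length js < k" for js
  proof -
    obtain C where C: "\<And>x. \<bar>iter_partial js g x\<bar> \<le> C * weight x"
      using Ck_Holder_compact_le_weight[OF g, of js] l by auto
    obtain D where D: "\<And>x. \<bar>iter_partial (i # js) g x\<bar> \<le> D * weight x"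
      using Ck_Holder_compact_le_weight[OF g, of "i # js"] l by auto
    show ?thesis
    proof (rule fourier_partial)
      fix x
      have "iter_partial js g differentiable (at x)" using g l by (simp add: Ck_Holder_compact_def Ck_diff_def)
      from has_derivative_partial_deriv(2)[OF this, of i]
      show "((\<lambda>h. complex_of_real (iter_partial js g (x + h *\<^sub>R axis i 1))) has_vector_derivative of_real (partial_deriv i (iter_partial js g) x)) (at 0)"
        by (intro has_vector_derivative_of_real) (simp add: has_real_derivative_iff_has_vector_derivative)
    next
      show "(\<lambda>x. complex_of_real (iter_partial js g x)) \<in> borel_measurable borel"
        "(\<lambda>x. complex_of_real (partial_deriv i (iter_partial js g) x)) \<in> borel_measurable borel"
        using Ck_Holder_compact_continuous[OF g, of js] Ck_Holder_compact_continuous[OF g, of "i # js"] l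
        by (auto intro!: borel_measurable_continuous_onI continuous_intros)
    qed (use C D in auto)
  qed
  have "fourier (\<lambda>y. of_real (iter_partial (doubled (i # is)) g y)) s = - \<i> * of_real (s $ i) * (- \<i> * of_real (s $ i) * fourier (\<lambda>y. of_real (iter_partial (doubled is) g y)) s)"
    using step[of "i # doubled is"] step[of "doubled is"] Cons.prems by simp
  also have "\<dots> = - of_real ((s $ i)\<^sup>2) * fourier (\<lambda>y. of_real (iter_partial (doubled is) g y)) s"
    by (simp add: power2_eq_square algebra_simps)
  also have "fourier (\<lambda>y. of_real (iter_partial (doubled is) g y)) s = of_real ((-1) ^ length is * (\<Prod>i\<leftarrow>is. (s $ i)\<^sup>2)) * fourier (\<lambda>y. of_real (g y)) s"
    using Cons by simp
  finally show ?case by simp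
qed simp

lemma sum_lists_prod: "(\<Sum>is | length is = m. (\<Prod>i\<leftarrow>is. (s $ i)\<^sup>2)) = norm (s :: real^'n) ^ (2 * m)"
proof -
  have "(\<Sum>is | length is = m. (\<Prod>i\<leftarrow>is. (s $ i)\<^sup>2)) = (\<Sum>i\<in>UNIV. (s $ i)\<^sup>2) ^ m"
  proof (induction m)
    case (Suc m)
    then show ?case unfolding sum_lists_Suc by (simp add: sum_distrib_right flip: sum_distrib_left)
  qed simp
  then show ?thesis by (simp add: power_mult norm_vec_def L2_set_def real_sqrt_pow2 sum_nonneg)
qed

text \<open>Each pair of equal derivatives contributes a factor \<open>- (s $ i)\<^sup>2\<close>; summed over all lists of
length \<open>m\<close> these products form the \<open>m\<close>-th power of \<open>norm s ^ 2\<close>.\<close>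

lemma fourier_neg_laplacian_pow:
  assumes g: "Ck_Holder_compact k \<gamma> K g" "0 < \<gamma>" "2 * m \<le> k"
  shows "fourier (\<lambda>y. of_real (neg_laplacian_pow m g y)) s = of_real (norm s ^ (2 * m)) * fourier (\<lambda>y. of_real (g y)) s"
proof -
  have C: "Ck_diff (2 * m) g" using g by (auto simp: Ck_Holder_compact_def intro: Ck_diff_mono)
  have "fourier (\<lambda>y. of_real (neg_laplacian_pow m g y)) s = fourier (\<lambda>y. (-1) ^ m * (\<Sum>is | length is = m. of_real (iter_partial (doubled is) g y))) s"
    unfolding neg_laplacian_pow_expand[OF C] by simp
  also have "\<dots> = (-1) ^ m * (\<Sum>is | length is = m. fourier (\<lambda>y. of_real (iter_partial (doubled is) g y)) s)"
    by (rule fourier_cmult_sum) (use Ck_Holder_compact_integrable[OF g(1,2)] g(3) in auto)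
  also have "\<dots> = (-1) ^ m * (\<Sum>is | length is = m. of_real ((-1) ^ m * (\<Prod>i\<leftarrow>is. (s $ i)\<^sup>2)) * fourier (\<lambda>y. of_real (g y)) s)"
    by (intro arg_cong2[where f="(*)"] refl sum.cong) (use fourier_iter_partial_doubled[OF g(1,2)] g(3) in auto)
  also have "\<dots> = of_real (\<Sum>is | length is = m. (\<Prod>i\<leftarrow>is. (s $ i)\<^sup>2)) * fourier (\<lambda>y. of_real (g y)) s"
    by (simp add: sum_distrib_left sum_distrib_right mult.assoc[symmetric] flip: power_mult_distrib)
  finally show ?thesis unfolding sum_lists_prod .
qed

text \<open>In the Fourier representation the parameter occurs only in \<open>exp (- a |s|\<^sup>2\<^sup>m)\<close>. Differentiation
produces the factor \<open>- |s|\<^sup>2\<^sup>m\<close>, which is the symbol of \<open>- (-\<Delta>)\<^sup>m\<close> and can be moved to the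
Fourier integral of \<open>g\<close>.\<close>

lemma kernel_average_root_has_derivative:
  assumes m: "1 \<le> m" and g: "Ck_Holder_compact k \<gamma> K g" "0 < \<gamma>" "2 * m \<le> k" and a: "0 < a"
  shows "((\<lambda>a. kernel_average m (root (2 * m) a) g x) has_real_derivative - kernel_average m (root (2 * m) a) (neg_laplacian_pow m g) (x :: real^'n)) (at a)"
proof -
  have ig: "integrable lborel g" using Ck_Holder_compact_integrable[OF g(1,2), of "[]"] by simp
  let ?c = "1 / complex_of_real ((2 * pi) ^ CARD('n))"
  let ?g = "\<lambda>y. complex_of_real (g y)"
  let ?W = "\<lambda>a s. exp (- \<i> * of_real (x \<bullet> s)) * complex_of_real (exp (- a * norm s ^ (2 * m))) * fourier ?g s"
  have L: "Ck_Holder_compact (k - 2 * m) \<gamma> K (\<lambda>x. 1 * neg_laplacian_pow m g x)"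
    by (rule Ck_Holder_compact_neg_laplacian_pow) (use g in simp)
  have iL: "integrable lborel (neg_laplacian_pow m g)"
    using Ck_Holder_compact_integrable[OF L g(2), of "[]"] by simp
  have rep: "complex_of_real (kernel_average m (root (2 * m) b) f x) = ?c * (LINT s|lborel. exp (- \<i> * of_real (x \<bullet> s)) * of_real (exp (- b * norm s ^ (2 * m))) * fourier (\<lambda>y. of_real (f y)) s)"
    if b: "0 < b" and f: "integrable lborel f" for b and f :: "real^'n \<Rightarrow> real"
  proof -
    have r: "0 < root (2 * m) b" "root (2 * m) b ^ (2 * m) = b" using b m by auto
    show ?thesis
      using kernel_average_eq_poisson[OF r(1), of f m x] poisson_fourier[OF m b f, of x] borel_measurable_integrable[OF f] r(2) by simp
  qed
  \<comment> \<open>for parameters above \<open>a/2\<close> the factor \<open>exp (- (a/2) |s|\<^sup>2\<^sup>m)\<close> dominates uniformly\<close>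
  have "((\<lambda>b. LINT s|lborel. ?W b s) has_derivative (\<lambda>h. LINT s|lborel. h *\<^sub>R (- of_real (norm s ^ (2 * m)) * ?W a s))) (at a within {a/2<..})"
  proof (rule has_derivative_integral[where G="\<lambda>s. (LINT y|lborel. norm (?g y)) * (norm s ^ (2 * m) * exp (- (a/2) * norm s ^ (2 * m)))"])
    show "a \<in> {a/2<..}" using a by simp
    have ig': "integrable lborel ?g" using ig by simp
    have Fb: "norm (fourier ?g s) \<le> (LINT y|lborel. norm (?g y))" for s by (rule fourier_bound[OF ig'])
    have [measurable]: "?g \<in> borel_measurable borel" using borel_measurable_integrable[OF ig'] by simp
    show "integrable lborel (\<lambda>s::real^'n. (LINT y|lborel. norm (?g y)) * (norm s ^ (2 * m) * exp (- (a/2) * norm s ^ (2 * m))))"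
      by (intro integrable_mult_right integrable_poly_exp[OF m _ real_polynomial_function_norm_even_power[of m], of "a/2"]) (use a in simp)
    show "(\<lambda>s. h *\<^sub>R (- complex_of_real (norm s ^ (2 * m)) * ?W a s)) \<in> borel_measurable lborel" for h
      by measurable
    fix b assume "b \<in> {a/2<..}"
    then have b: "0 < b" "a / 2 < b" using a by auto
    show "integrable lborel (?W b)"
    proof (rule Bochner_Integration.integrable_bound)
      show "integrable lborel (\<lambda>s::real^'n. (1 * exp (- b * norm s ^ (2 * m))) * (LINT y|lborel. norm (?g y)))"
        by (rule integrable_mult_left) (rule integrable_poly_exp[OF m b(1) real_polynomial_function.intros(2)])
      show "AE s in lborel. norm (?W b s) \<le> norm ((1 * exp (- b * norm s ^ (2 * m))) * (LINT y|lborel. norm (?g y)))"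
        using Fb by (intro AE_I2) (simp add: norm_mult mult_left_mono order_trans[OF _ abs_ge_self])
    qed measurable
    fix s h
    have "((\<lambda>b. ?W b s) has_vector_derivative - of_real (norm s ^ (2 * m)) * ?W b s) (at b)"
    proof -
      have "((\<lambda>b. exp (- b * norm s ^ (2 * m))) has_real_derivative - (norm s ^ (2 * m)) * exp (- b * norm s ^ (2 * m))) (at b)"
        by (auto intro!: derivative_eq_intros)
      then have "((\<lambda>b. complex_of_real (exp (- b * norm s ^ (2 * m)))) has_vector_derivative of_real (- (norm s ^ (2 * m)) * exp (- b * norm s ^ (2 * m)))) (at b)"
        by (intro has_vector_derivative_of_real) (simp add: has_real_derivative_iff_has_vector_derivative)
      from has_vector_derivative_mult_left[OF has_vector_derivative_mult_right[OF this, of "exp (- \<i> * of_real (x \<bullet> s))"], of "fourier ?g s"]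
      show ?thesis by (simp add: mult_ac)
    qed
    then show "((\<lambda>b. ?W b s) has_derivative (\<lambda>h. h *\<^sub>R (- of_real (norm s ^ (2 * m)) * ?W b s))) (at b within {a/2<..})"
      unfolding has_vector_derivative_def by (rule has_derivative_at_withinI)
    have "norm s ^ (2 * m) * (exp (- b * norm s ^ (2 * m)) * norm (fourier ?g s)) \<le> norm s ^ (2 * m) * (exp (- (a/2) * norm s ^ (2 * m)) * (LINT y|lborel. norm (?g y)))"
    proof (intro mult_left_mono mult_mono Fb)
      have "- b * norm s ^ (2 * m) \<le> - (a/2) * norm s ^ (2 * m)" using b by (intro mult_right_mono) auto
      then show "exp (- b * norm s ^ (2 * m)) \<le> exp (- (a/2) * norm s ^ (2 * m))" by simp
    qed auto
    from mult_left_mono[OF this, of "\<bar>h\<bar>"]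
    show "norm (h *\<^sub>R (- complex_of_real (norm s ^ (2 * m)) * ?W b s)) \<le> (LINT y|lborel. norm (?g y)) * (norm s ^ (2 * m) * exp (- (a/2) * norm s ^ (2 * m))) * norm h"
      by (simp add: norm_mult norm_power mult_ac)
  qed simp
  then have "((\<lambda>b. LINT s|lborel. ?W b s) has_vector_derivative - (LINT s|lborel. of_real (norm s ^ (2 * m)) * ?W a s)) (at a)"
    using a by (subst (asm) at_within_open) (auto simp: has_vector_derivative_def)
  then have "((\<lambda>b. ?c * (LINT s|lborel. ?W b s)) has_vector_derivative ?c * - (LINT s|lborel. of_real (norm s ^ (2 * m)) * ?W a s)) (at a)"
    by (rule has_vector_derivative_mult_right)
  also have "(LINT s|lborel. of_real (norm s ^ (2 * m)) * ?W a s) = (LINT s|lborel. exp (- \<i> * of_real (x \<bullet> s)) * of_real (exp (- a * norm s ^ (2 * m))) * fourier (\<lambda>y. of_real (neg_laplacian_pow m g y)) s)"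
    unfolding fourier_neg_laplacian_pow[OF g] by (simp add: mult_ac)
  finally have "((\<lambda>b. ?c * (LINT s|lborel. ?W b s)) has_vector_derivative - of_real (kernel_average m (root (2 * m) a) (neg_laplacian_pow m g) x)) (at a)"
    unfolding rep[OF a iL] by simp
  then have "((\<lambda>b. complex_of_real (kernel_average m (root (2 * m) b) g x)) has_vector_derivative - of_real (kernel_average m (root (2 * m) a) (neg_laplacian_pow m g) x)) (at a)"
    by (rule has_vector_derivative_transform_within_open[where S="{0<..}"]) (use a rep[OF _ ig] in auto)
  from bounded_linear.has_vector_derivative[OF bounded_linear_Re this]
  show ?thesis by (simp add: has_real_derivative_iff_has_vector_derivative)
qed

lemma neg_laplacian_pow_kernel_average:
  assumes m: "1 \<le> m" and g: "Ck_Holder_compact k \<gamma> K g" "0 < \<gamma>" "2 * m \<le> k"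
  shows "neg_laplacian_pow m (kernel_average m r g) (x :: real^'n) = kernel_average m r (neg_laplacian_pow m g) x"
proof -
  have C: "Ck_diff (2 * m) g" "Ck_diff (2 * m) (kernel_average m r g)"
    using g iter_partial_kernel_average(2)[OF m g(1,2)] by (auto simp: Ck_Holder_compact_def intro: Ck_diff_mono)
  have "neg_laplacian_pow m (kernel_average m r g) x = (-1) ^ m * (\<Sum>is | length is = m. kernel_average m r (iter_partial (doubled is) g) x)"
    unfolding neg_laplacian_pow_expand[OF C(2)]
    by (intro arg_cong2[where f="(*)"] refl sum.cong) (use iter_partial_kernel_average(1)[OF m g(1,2)] g(3) in auto)
  also have "\<dots> = kernel_average m r (neg_laplacian_pow m g) x"
    unfolding neg_laplacian_pow_expand[OF C(1)]
  proof (rule kernel_average_cmult_sum[OF m, symmetric])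
    fix "is" :: "'n list" assume "is \<in> {is. length is = m}"
    then have l: "length (doubled is) \<le> k" using g(3) by simp
    show "continuous_on UNIV (iter_partial (doubled is) g)" by (rule Ck_Holder_compact_continuous[OF g(1,2) l])
    show "\<exists>C. \<forall>x. \<bar>iter_partial (doubled is) g x\<bar> \<le> C" using Ck_Holder_compact_bounded[OF g(1,2) l] by metis
  qed
  finally show ?thesis .
qed

text \<open>Since \<open>\<alpha>\<close> is bounded below by \<open>\<delta>\<close>, its primitive is positive for positive times; it serves as
the new time variable in which the equation has coefficient one.\<close>

locale parabolic_coefficient =
  fixes \<alpha> :: "real \<Rightarrow> real" and T \<delta> :: real
  assumes T: "0 < T" and cont: "continuous_on {0..T} \<alpha>" and \<delta>: "0 < \<delta>" "\<And>t. t \<in> {0..T} \<Longrightarrow> \<delta> \<le> \<alpha> t"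
begin

definition primitive :: "real \<Rightarrow> real" where "primitive t = integral {0..t} \<alpha>"

lemma primitive_deriv: "t \<in> {0..T} \<Longrightarrow> (primitive has_real_derivative \<alpha> t) (at t within {0..T})"
  unfolding primitive_def[abs_def] by (rule integral_has_real_derivative[OF cont])

lemma primitive_cont: "continuous_on {0..T} primitive"
  unfolding continuous_on_eq_continuous_within using DERIV_continuous primitive_deriv by blast

lemma primitive_0 [simp]: "primitive 0 = 0" by (simp add: primitive_def)

lemma primitive_pos: "t \<in> {0<..T} \<Longrightarrow> 0 < primitive t"
proof -
  assume t: "t \<in> {0<..T}"
  have i: "\<alpha> integrable_on {0..t}"
    by (rule integrable_continuous_real[OF continuous_on_subset[OF cont]]) (use t in auto)
  have "integral {0..t} (\<lambda>_. \<delta>) \<le> integral {0..t} \<alpha>"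
    by (rule integral_le[OF _ i]) (use t \<delta> in auto)
  moreover have "0 < integral {0..t} (\<lambda>_. \<delta>)" using t \<delta> by simp
  ultimately show "0 < primitive t" unfolding primitive_def by linarith
qed

lemma cauchy_solution_kernel_average:
  fixes g :: "real^'n \<Rightarrow> real"
  assumes m: "1 \<le> m" and g: "Ck_Holder_compact (2 * m) \<gamma> K g" "0 < \<gamma>"
  shows "cauchy_solution m \<gamma> T \<Omega> \<alpha> g (\<lambda>t. kernel_average m (root (2 * m) (primitive t)) g)"
proof -
  let ?r = "\<lambda>t. root (2 * m) (primitive t)"
  have e: "iter_partial is (kernel_average m r g) = kernel_average m r (iter_partial is g)" if "length is \<le> 2 * m" for "is" r
    by (rule iter_partial_kernel_average(1)[OF m g that])
  have "continuous_on ({0..T} \<times> S) (\<lambda>(t, x). iter_partial is (kernel_average m (?r t) g) x)" if l: "length is \<le> 2 * m" for "is" S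
  proof -
    obtain C where C: "\<And>x. \<bar>iter_partial is g x\<bar> \<le> C" using Ck_Holder_compact_bounded[OF g l] by blast
    have "continuous_on ({0..T} \<times> S) (\<lambda>p. ?r (fst p))"
      by (rule continuous_on_compose2[OF continuous_on_real_root[OF primitive_cont]]) (auto intro!: continuous_intros)
    then have c: "continuous_on ({0..T} \<times> S) (\<lambda>p. (?r (fst p), snd p))"
      by (intro continuous_on_Pair continuous_on_snd continuous_on_id)
    have "continuous_on ({0..T} \<times> S) (\<lambda>p. (\<lambda>p. kernel_average m (fst p) (iter_partial is g) (snd p)) (?r (fst p), snd p))"
      by (rule continuous_on_compose2[OF continuous_on_kernel_average[OF m Ck_Holder_compact_continuous[OF g l] C] c]) auto
    then show ?thesis by (simp add: e[OF l] split_def)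
  qed
  then have sp: "Ck_space_on (2 * m) T S (\<lambda>t. kernel_average m (?r t) g)" for S
    using iter_partial_kernel_average(2)[OF m g] unfolding Ck_space_on_def Ck_diff_def by blast
  moreover have "\<exists>C. \<forall>t\<in>{0..T}. \<forall>x\<in>\<Omega>. \<forall>y\<in>\<Omega>. \<bar>iter_partial is (kernel_average m (?r t) g) x - iter_partial is (kernel_average m (?r t) g) y\<bar> \<le> C * dist x y powr \<gamma>"
    if l: "length is = 2 * m" for "is"
  proof -
    obtain L where L: "\<And>x y. \<bar>iter_partial is g x - iter_partial is g y\<bar> \<le> L * dist x y powr \<gamma>"
      using g(1) l unfolding Ck_Holder_compact_def Holder_on_def by blast
    have l': "length is \<le> 2 * m" using l by simp
    obtain C where C: "\<And>x. \<bar>iter_partial is g x\<bar> \<le> C" using Ck_Holder_compact_bounded[OF g l'] by blast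
    show ?thesis unfolding e[OF l']
      using kernel_average_Holder[OF m Ck_Holder_compact_continuous[OF g l'] C L] by blast
  qed
  moreover have "\<exists>B. \<forall>t\<in>{0..T}. \<forall>x. \<bar>kernel_average m (?r t) g x\<bar> \<le> B"
  proof -
    obtain C where C: "\<And>x. \<bar>g x\<bar> \<le> C" using Ck_Holder_compact_bounded[OF g, of "[]"] by auto
    have "continuous_on UNIV g" using Ck_Holder_compact_continuous[OF g, of "[]"] by simp
    from kernel_average_bound[OF m this C] show ?thesis by blast
  qed
  moreover have "((\<lambda>s. kernel_average m (?r s) g x) has_real_derivative - \<alpha> t * neg_laplacian_pow m (kernel_average m (?r t) g) x) (at t within {0..T})"
    if t: "t \<in> {0<..T}" for t x
  proof -
    have "((\<lambda>s. kernel_average m (root (2 * m) (primitive s)) g x) has_real_derivative - kernel_average m (root (2 * m) (primitive t)) (neg_laplacian_pow m g) x * \<alpha> t) (at t within {0..T})"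
      by (rule DERIV_chain2[OF kernel_average_root_has_derivative[OF m g order_refl primitive_pos[OF t]] primitive_deriv]) (use t in auto)
    then show ?thesis by (simp add: neg_laplacian_pow_kernel_average[OF m g] mult.commute)
  qed
  ultimately show ?thesis
    using m by (simp add: cauchy_solution_def Ck_Holder_space_on_def kernel_average_zero)
qed

lemma poisson_integral_kernel_average:
  fixes g :: "real^'n \<Rightarrow> real"
  assumes m: "1 \<le> m" and g: "g \<in> borel_measurable borel" "\<And>x. x \<notin> \<Omega> \<Longrightarrow> g x = 0" and t: "t \<in> {0<..T}"
  shows "complex_of_real (kernel_average m (root (2 * m) (primitive t)) g x) = poisson_integral m \<Omega> \<alpha> g t x"
proof -
  have r: "0 < root (2 * m) (primitive t)" "root (2 * m) (primitive t) ^ (2 * m) = primitive t" using primitive_pos[OF t] m by auto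
  have "(\<lambda>y. indicat_real \<Omega> y *\<^sub>R (poisson_kernel m (primitive t) (x - y) * complex_of_real (g y))) = (\<lambda>y. poisson_kernel m (primitive t) (x - y) * of_real (g y))"
    using g(2) by (auto simp: indicator_def)
  then show ?thesis
    unfolding poisson_integral_def set_lebesgue_integral_def primitive_def[symmetric] kernel_average_eq_poisson[OF r(1) g(1)] r(2) by simp
qed

end

section \<open>Band-limited functions and cutoffs\<close>

text \<open>\<open>band_limited k\<close> is the \<open>k\<close>-th derivative of \<open>x \<mapsto> (1 - cos x) / x\<^sup>2\<close>, written as the cosine
transform of \<open>1 - \<xi>\<close> on \<open>[0,1]\<close>. Because the frequencies are bounded, the derivatives grow at most
geometrically in \<open>k\<close>; a nonzero function with compact support cannot have this property.\<close>

definition band_limited :: "nat \<Rightarrow> real \<Rightarrow> real" where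
  "band_limited k x = integral {0..1} (\<lambda>\<xi>. (1 - \<xi>) * \<xi> ^ k * cos (x * \<xi> + k * pi / 2))"

lemma band_limited_deriv: "(band_limited k has_real_derivative band_limited (Suc k) x) (at x)"
proof -
  let ?f' = "\<lambda>x \<xi>. (1 - \<xi>) * \<xi> ^ Suc k * cos (x * \<xi> + Suc k * pi / 2)"
  have "((\<lambda>x. integral (cbox 0 1) (\<lambda>\<xi>. (1 - \<xi>) * \<xi> ^ k * cos (x * \<xi> + k * pi / 2))) has_field_derivative
      integral (cbox 0 1) (?f' x)) (at x within UNIV)"
  proof (rule leibniz_rule_field_derivative)
    fix x \<xi> :: real
    have "cos (x * \<xi> + Suc k * pi / 2) = - sin (x * \<xi> + k * pi / 2)"
      using cos_add[of "x * \<xi> + k * pi / 2" "pi/2"] by (simp add: algebra_simps add_divide_distrib)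
    then show "((\<lambda>x. (1 - \<xi>) * \<xi> ^ k * cos (x * \<xi> + k * pi / 2)) has_field_derivative ?f' x \<xi>) (at x within UNIV)"
      by (auto intro!: derivative_eq_intros)
    show "(\<lambda>\<xi>. (1 - \<xi>) * \<xi> ^ k * cos (x * \<xi> + k * pi / 2)) integrable_on cbox 0 1"
      by (intro integrable_continuous continuous_intros)
    show "continuous_on (UNIV \<times> cbox 0 1) (\<lambda>(x, \<xi>). ?f' x \<xi>)"
      unfolding split_def by (intro continuous_intros)
  qed auto
  then show ?thesis by (simp add: band_limited_def[abs_def])
qed

text \<open>Two partial integrations in \<open>\<xi>\<close>. The first produces no boundary term: \<open>1 - \<xi>\<close> vanishes at
\<open>\<xi> = 1\<close>, and at \<open>\<xi> = 0\<close> either \<open>\<xi> ^ k\<close> or, for \<open>k = 0\<close>, the sine vanishes.\<close>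

lemma band_limited_square:
  defines "f2 k \<equiv> (\<lambda>\<xi>::real. real k * (real (k - 1) * \<xi> ^ (k - 1 - 1)) - real (Suc k) * (real k * \<xi> ^ (k - 1)))"
  shows "x\<^sup>2 * band_limited k x = (- cos (x + k * pi / 2) - (real k * 0 ^ (k - 1) - real (Suc k) * 0 ^ k) * cos (k * pi / 2))
     - integral {0..1} (\<lambda>\<xi>. f2 k \<xi> * cos (x * \<xi> + k * pi / 2))"
proof -
  let ?c = "k * pi / 2"
  let ?f = "\<lambda>\<xi>::real. \<xi> ^ k - \<xi> ^ Suc k"
  let ?f1 = "\<lambda>\<xi>::real. real k * \<xi> ^ (k - 1) - real (Suc k) * \<xi> ^ k"
  let ?h = "\<lambda>\<xi>. ?f \<xi> * x * sin (x * \<xi> + ?c) + ?f1 \<xi> * cos (x * \<xi> + ?c)"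
  let ?A = "\<lambda>\<xi>. (1 - \<xi>) * \<xi> ^ k * cos (x * \<xi> + ?c)" and ?B = "\<lambda>\<xi>. f2 k \<xi> * cos (x * \<xi> + ?c)"
  have iA: "?A integrable_on {0..1}" and iB: "?B integrable_on {0..1}"
    unfolding f2_def by (intro integrable_continuous_real continuous_intros)+
  have "((\<lambda>\<xi>. x\<^sup>2 * ?A \<xi> + ?B \<xi>) has_integral (?h 1 - ?h 0)) {0..1}"
  proof (rule fundamental_theorem_of_calculus)
    fix \<xi> :: real
    have d1: "(?f has_real_derivative ?f1 \<xi>) (at \<xi> within {0..1})"
      by (rule derivative_eq_intros refl)+ (cases k; simp add: algebra_simps)
    have d2: "(?f1 has_real_derivative f2 k \<xi>) (at \<xi> within {0..1})"
      unfolding f2_def by (rule derivative_eq_intros refl)+ simp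
    have "(?h has_real_derivative (x\<^sup>2 * ?A \<xi> + ?B \<xi>)) (at \<xi> within {0..1})"
      by (rule derivative_eq_intros d1 d2 refl)+ (simp add: algebra_simps power2_eq_square)
    then show "(?h has_vector_derivative (x\<^sup>2 * ?A \<xi> + ?B \<xi>)) (at \<xi> within {0..1})"
      by (simp add: has_real_derivative_iff_has_vector_derivative)
  qed simp
  then have "integral {0..1} (\<lambda>\<xi>. x\<^sup>2 * ?A \<xi> + ?B \<xi>) = ?h 1 - ?h 0" by (rule integral_unique)
  moreover have "integral {0..1} (\<lambda>\<xi>. x\<^sup>2 * ?A \<xi> + ?B \<xi>) = x\<^sup>2 * band_limited k x + integral {0..1} ?B"
    unfolding band_limited_def using iA iB by (subst integral_add) (auto intro: integrable_on_mult_right)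
  ultimately show ?thesis by (cases k) simp_all
qed

lemma abs_triangle3: "\<bar>b\<bar> \<le> B \<Longrightarrow> \<bar>a\<bar> \<le> A \<Longrightarrow> \<bar>c\<bar> \<le> C \<Longrightarrow> \<bar>- a - b - c\<bar> \<le> A + B + (C :: real)"
  by linarith

lemma band_limited_bound:
  fixes k :: nat
  shows "\<bar>band_limited k x\<bar> \<le> 5 * 4 ^ k / (1 + x\<^sup>2)"
proof -
  have 1: "\<bar>band_limited k x\<bar> \<le> 1"
  proof -
    have "norm (integral (cbox 0 (1::real)) (\<lambda>\<xi>::real. (1 - \<xi>) * \<xi> ^ k * cos (x * \<xi> + real k * pi / 2))) \<le> 1 * measure lborel (cbox 0 (1::real))"
    proof (rule has_integral_bound[OF _ integrable_integral])
      show "norm ((1 - \<xi>) * \<xi> ^ k * cos (x * \<xi> + real k * pi / 2)) \<le> 1" if "\<xi> \<in> cbox 0 1" for \<xi> :: real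
        using that by (auto simp: abs_mult power_abs intro!: mult_le_one power_le_one)
    qed (auto intro!: integrable_continuous_real continuous_intros)
    then show ?thesis by (simp add: band_limited_def)
  qed
  let ?f2 = "\<lambda>\<xi>::real. real k * (real (k - 1) * \<xi> ^ (k - 1 - 1)) - real (Suc k) * (real k * \<xi> ^ (k - 1))"
  have I: "\<bar>integral {0..1} (\<lambda>\<xi>::real. ?f2 \<xi> * cos (x * \<xi> + real k * pi / 2))\<bar> \<le> 2 * real (Suc k) ^ 2"
  proof -
    have "norm (integral (cbox 0 (1::real)) (\<lambda>\<xi>::real. ?f2 \<xi> * cos (x * \<xi> + real k * pi / 2))) \<le> (2 * real (Suc k) ^ 2) * measure lborel (cbox 0 (1::real))"
    proof (rule has_integral_bound[OF _ integrable_integral])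
      fix \<xi> :: real assume "\<xi> \<in> cbox 0 1"
      then have x: "0 \<le> \<xi>" "\<xi> \<le> 1" by auto
      have "real k * (real (k - 1) * \<xi> ^ (k - 1 - 1)) \<le> real (Suc k) * (real (Suc k) * 1)"
        using x by (intro mult_mono power_le_one) auto
      moreover have "real (Suc k) * (real k * \<xi> ^ (k - 1)) \<le> real (Suc k) * (real (Suc k) * 1)"
        using x by (intro mult_mono power_le_one) auto
      moreover have "0 \<le> real k * (real (k - 1) * \<xi> ^ (k - 1 - 1))" "0 \<le> real (Suc k) * (real k * \<xi> ^ (k - 1))"
        using x by auto
      ultimately have f: "\<bar>?f2 \<xi>\<bar> \<le> 2 * real (Suc k) ^ 2"
        unfolding power2_eq_square mult_1_right by linarith
      have "\<bar>?f2 \<xi>\<bar> * \<bar>cos (x * \<xi> + real k * pi / 2)\<bar> \<le> (2 * real (Suc k) ^ 2) * 1"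
        by (intro mult_mono f) auto
      then show "norm (?f2 \<xi> * cos (x * \<xi> + real k * pi / 2)) \<le> 2 * real (Suc k) ^ 2" by (simp only: real_norm_def abs_mult mult_1_right)
    qed (auto intro!: integrable_continuous_real continuous_intros)
    then show ?thesis by simp
  qed
  have "\<bar>(real k * 0 ^ (k - 1) - real (Suc k) * 0 ^ k) * cos (real k * pi / 2)\<bar> \<le> real (Suc k) * 1"
    unfolding abs_mult by (intro mult_mono) (auto simp: power_0_left)
  moreover have "\<bar>cos (x + real k * pi / 2)\<bar> \<le> 1" by simp
  ultimately have "\<bar>x\<^sup>2 * band_limited k x\<bar> \<le> 1 + real (Suc k) + 2 * real (Suc k) ^ 2"
    using I unfolding band_limited_square by (intro abs_triangle3) simp_all
  then have "(1 + x\<^sup>2) * \<bar>band_limited k x\<bar> \<le> 2 + real (Suc k) + 2 * real (Suc k) ^ 2"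
    using 1 by (simp add: abs_mult algebra_simps)
  also have "\<dots> \<le> 5 * real (Suc k) ^ 2"
    by (simp add: power2_eq_square algebra_simps)
  also have "\<dots> \<le> 5 * (2 ^ k) ^ 2"
  proof -
    have "Suc k \<le> 2 ^ k" by (rule Suc_leI[OF less_exp])
    then have "real (Suc k) \<le> 2 ^ k" by (metis of_nat_le_iff of_nat_numeral of_nat_power)
    then show ?thesis by (intro mult_left_mono power_mono) auto
  qed
  also have "(2 ^ k) ^ 2 = (4::real) ^ k" by (simp add: power2_eq_square flip: power_mult_distrib)
  finally show ?thesis by (simp add: pos_le_divide_eq add_pos_nonneg mult.commute)
qed

lemma band_limited_continuous: "continuous_on S (band_limited k)"
  using band_limited_deriv by (meson DERIV_isCont continuous_at_imp_continuous_on)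

lemma band_limited_integrable: "integrable lborel (band_limited k)"
  by (rule Bochner_Integration.integrable_bound[OF integrable_mult_right[OF integrable_inv_1_plus_square, of "5 * 4 ^ k"]])
    (use band_limited_bound band_limited_continuous in \<open>auto intro!: borel_measurable_continuous_onI simp: abs_div\<close>)

lemma band_limited_0_nonneg: "0 \<le> band_limited 0 x"
proof (cases "x = 0")
  case True
  then show ?thesis unfolding band_limited_def by (intro integral_nonneg integrable_continuous_real continuous_intros) auto
next
  case False
  have "x\<^sup>2 * band_limited 0 x = 1 - cos x" using band_limited_square[of x 0] by simp
  then show ?thesis using False by (metis cos_le_one diff_ge_0_iff_ge zero_le_mult_iff zero_less_power2 not_less)
qed

lemma band_limited_0_0: "band_limited 0 0 > 0"
proof -
  have "((\<lambda>\<xi>::real. 1 - \<xi>) has_integral (1 - 1\<^sup>2/2) - (0 - 0\<^sup>2/2)) {0..1}"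
    by (rule fundamental_theorem_of_calculus)
      (auto intro!: derivative_eq_intros simp: has_real_derivative_iff_has_vector_derivative[symmetric])
  then show ?thesis unfolding band_limited_def by (simp add: integral_unique)
qed

text \<open>Positivity makes the rescaled products of these functions usable as approximate identities.\<close>

lemma band_limited_0_integral_pos: "0 < (LINT x|lborel. band_limited 0 x)"
proof -
  have "isCont (band_limited 0) 0" using band_limited_deriv by (rule DERIV_isCont)
  then obtain d where d': "0 < d" "\<And>x. \<bar>x\<bar> < d \<Longrightarrow> \<bar>band_limited 0 x - band_limited 0 0\<bar> < band_limited 0 0 / 2"
    using band_limited_0_0 unfolding continuous_at_eps_delta dist_real_def by (metis diff_zero half_gt_zero)
  have d: "0 < d" "\<And>x. \<bar>x\<bar> < d \<Longrightarrow> band_limited 0 0 / 2 \<le> band_limited 0 x"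
    using d'(1) apply simp
    subgoal for x using d'(2)[of x] by linarith
    done
  have "0 < band_limited 0 0 / 2 * d" using band_limited_0_0 d by simp
  also have "\<dots> = (LINT x|lborel. band_limited 0 0 / 2 * indicator {0<..<d} x)" using d by simp
  also have "\<dots> \<le> (LINT x|lborel. band_limited 0 x)"
  proof (rule integral_mono)
    show "band_limited 0 0 / 2 * indicator {0<..<d} x \<le> band_limited 0 x" for x
      using d(2)[of x] band_limited_0_nonneg[of x] by (simp add: indicator_def)
    show "integrable lborel (\<lambda>x. band_limited 0 0 / 2 * indicator {0<..<d} x)"
      using d(1) by (intro integrable_mult_right) (simp add: integrable_indicator_iff)
  qed (rule band_limited_integrable)
  finally show ?thesis .
qed

text \<open>If \<open>p\<close> and \<open>q\<close> list the successive derivatives of two functions, then \<open>leibniz p q k a b\<close> is the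
\<open>k\<close>-th derivative of \<open>p a * q b\<close>. The recursion is the product rule itself, so that all properties
follow by induction on \<open>k\<close> without binomial coefficients.\<close>

fun leibniz :: "(nat \<Rightarrow> real \<Rightarrow> real) \<Rightarrow> (nat \<Rightarrow> real \<Rightarrow> real) \<Rightarrow> nat \<Rightarrow> nat \<Rightarrow> nat \<Rightarrow> real \<Rightarrow> real" where
  "leibniz p q 0 a b x = p a x * q b x"
| "leibniz p q (Suc k) a b x = leibniz p q k (Suc a) b x + leibniz p q k a (Suc b) x"

lemma leibniz_deriv:
  assumes p: "\<And>a x. a < M \<Longrightarrow> (p a has_real_derivative p (Suc a) x) (at x)"
    and q: "\<And>b x. b < N \<Longrightarrow> (q b has_real_derivative q (Suc b) x) (at x)"
  shows "a + k < M \<Longrightarrow> b + k < N \<Longrightarrow> (leibniz p q k a b has_real_derivative leibniz p q (Suc k) a b x) (at x)"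
proof (induction k arbitrary: a b)
  case 0
  then show ?case unfolding leibniz.simps[abs_def]
    by (auto intro!: derivative_eq_intros p q)
next
  case (Suc k)
  have "((\<lambda>x. leibniz p q k (Suc a) b x + leibniz p q k a (Suc b) x) has_real_derivative
     leibniz p q (Suc k) (Suc a) b x + leibniz p q (Suc k) a (Suc b) x) (at x)"
    by (intro DERIV_add Suc.IH) (use Suc.prems in auto)
  then show ?case by (simp only: leibniz.simps(2)[abs_def])
qed

lemma leibniz_bound:
  assumes p: "\<And>a'. a' \<le> a + k \<Longrightarrow> \<bar>p a' x\<bar> \<le> P" and q: "\<And>b'. b' \<le> b + k \<Longrightarrow> \<bar>q b' x\<bar> \<le> Q"
  shows "\<bar>leibniz p q k a b x\<bar> \<le> 2 ^ k * (P * Q)"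
  using assms
proof (induction k arbitrary: a b)
  case 0
  have "\<bar>p a x\<bar> \<le> P" "\<bar>q b x\<bar> \<le> Q" using 0 by auto
  then have "\<bar>p a x\<bar> * \<bar>q b x\<bar> \<le> P * Q" by (intro mult_mono) auto
  then show ?case by (simp add: abs_mult)
next
  case (Suc k)
  have "\<bar>leibniz p q k (Suc a) b x\<bar> \<le> 2 ^ k * (P * Q)" "\<bar>leibniz p q k a (Suc b) x\<bar> \<le> 2 ^ k * (P * Q)"
    by (intro Suc.IH; use Suc.prems in auto)+
  then show ?case by simp
qed

text \<open>Cutoffs that converge to the constant one while their derivatives tend to zero leave, in the
limit, only the term in which all derivatives hit \<open>p\<close>.\<close>

lemma leibniz_limit:
  assumes "\<And>b'. b' \<le> b + k \<Longrightarrow> (\<lambda>n. q n b' x) \<longlonglongrightarrow> (if b' = 0 then 1 else 0)"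
  shows "(\<lambda>n. leibniz p (q n) k a b x) \<longlonglongrightarrow> (if b = 0 then p (a + k) x else 0)"
  using assms
proof (induction k arbitrary: a b)
  case 0
  have "(\<lambda>n. p a x * q n b x) \<longlonglongrightarrow> p a x * (if b = 0 then 1 else 0)"
    by (intro tendsto_mult tendsto_const 0) simp
  then show ?case by (simp split: if_splits)
next
  case (Suc k)
  have "(\<lambda>n. leibniz p (q n) k (Suc a) b x + leibniz p (q n) k a (Suc b) x) \<longlonglongrightarrow> (if b = 0 then p (Suc a + k) x else 0) + (if Suc b = 0 then p (a + k) x else 0)"
    by (intro tendsto_add Suc.IH Suc.prems) auto
  then show ?case by (simp split: if_splits)
qed

lemma leibniz_continuous:
  assumes "\<And>a'. a' \<le> a + k \<Longrightarrow> continuous_on S (p a')" and "\<And>b'. b' \<le> b + k \<Longrightarrow> continuous_on S (q b')"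
  shows "continuous_on S (leibniz p q k a b)"
  using assms
proof (induction k arbitrary: a b)
  case 0
  then show ?case unfolding leibniz.simps[abs_def] by (intro continuous_intros) auto
next
  case (Suc k)
  then show ?case unfolding leibniz.simps(2)[abs_def] by (intro continuous_on_add Suc.IH) auto
qed

lemma max_power_deriv:
  assumes "2 \<le> n"
  shows "((\<lambda>x::real. max 0 x ^ n) has_real_derivative real n * max 0 x ^ (n - 1)) (at x)"
proof -
  consider "x < 0" | "x = 0" | "0 < x" by linarith
  then show ?thesis
  proof cases
    case 1
    have "((\<lambda>x::real. max 0 x ^ n) has_real_derivative 0) (at x)"
      by (rule has_field_derivative_transform_within_open[where f="\<lambda>_. 0" and S="{..<0}"]) (use 1 assms in auto)
    moreover have "max 0 x = 0" using 1 by simp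
    ultimately show ?thesis using assms by (simp add: power_0_left)
  next
    case 2
    have "((\<lambda>h. max 0 h ^ n / h) \<longlongrightarrow> 0) (at (0::real))"
    proof (rule Lim_null_comparison[where g="\<lambda>h. \<bar>h\<bar> ^ (n - 1)"])
      have "max 0 h ^ n \<le> \<bar>h\<bar> ^ n" for h :: real by (intro power_mono) auto
      moreover have n: "n = Suc (n - 1)" using assms by simp
      ultimately have "max 0 h ^ n \<le> \<bar>h\<bar> ^ (n - 1) * \<bar>h\<bar>" for h :: real
        by (metis power_Suc2)
      then have "norm (max 0 h ^ n / h) \<le> \<bar>h\<bar> ^ (n - 1)" for h :: real
        by (cases "h = 0") (simp_all add: abs_div power_abs pos_divide_le_eq)
      then show "\<forall>\<^sub>F h in at 0. norm (max 0 h ^ n / h) \<le> \<bar>h\<bar> ^ (n - 1)" by simp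
      have "((\<lambda>h::real. \<bar>h\<bar> ^ (n - 1)) \<longlongrightarrow> \<bar>0\<bar> ^ (n - 1)) (at 0)" by (intro tendsto_intros)
      then show "((\<lambda>h::real. \<bar>h\<bar> ^ (n - 1)) \<longlongrightarrow> 0) (at 0)" using assms by (simp add: power_0_left)
    qed
    then show ?thesis using 2 assms by (simp add: DERIV_def power_0_left)
  next
    case 3
    have "((\<lambda>x::real. max 0 x ^ n) has_real_derivative real n * x ^ (n - 1)) (at x)"
      by (rule has_field_derivative_transform_within_open[where f="\<lambda>x. x ^ n" and S="{0<..}"])
        (use 3 in \<open>auto intro!: derivative_eq_intros\<close>)
    moreover have "max 0 x = x" using 3 by simp
    ultimately show ?thesis by simp
  qed
qed

text \<open>\<open>truncated_power N k\<close> is the \<open>k\<close>-th derivative of \<open>x \<mapsto> (max 0 x)\<^sup>N\<close> as long as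
\<open>k < N\<close>.\<close>

definition truncated_power :: "nat \<Rightarrow> nat \<Rightarrow> real \<Rightarrow> real" where
  "truncated_power N k x = fact N / fact (N - k) * max 0 x ^ (N - k)"

lemma truncated_power_deriv: "k + 2 \<le> N \<Longrightarrow> (truncated_power N k has_real_derivative truncated_power N (Suc k) x) (at x)"
proof -
  assume k: "k + 2 \<le> N"
  have e: "N - k = Suc (N - Suc k)" using k by simp
  have "((\<lambda>x. fact N / fact (N - k) * max 0 x ^ (N - k)) has_real_derivative fact N / fact (N - k) * (real (N - k) * max 0 x ^ (N - k - 1))) (at x)"
    by (intro DERIV_cmult max_power_deriv) (use k in auto)
  then show ?thesis unfolding truncated_power_def[abs_def] using k by (simp add: e)
qed

text \<open>For \<open>k < N\<close> the \<open>k\<close>-th derivative of \<open>x \<mapsto> (max 0 (1 + x))\<^sup>N (max 0 (1 - x))\<^sup>N\<close>, a cutoff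
of finite smoothness with support \<open>[-1,1]\<close>.\<close>

definition bump :: "nat \<Rightarrow> nat \<Rightarrow> real \<Rightarrow> real" where
  "bump N k = leibniz (\<lambda>a x. truncated_power N a (1 + x)) (\<lambda>b x. (-1) ^ b * truncated_power N b (1 - x)) k 0 0"

lemma bump_deriv:
  assumes "k + 2 \<le> N"
  shows "(bump N k has_real_derivative bump N (Suc k) x) (at x)"
  unfolding bump_def
proof (rule leibniz_deriv[where M="N - 1" and N="N - 1"])
  fix a and x :: real assume a: "a < N - 1"
  then have "a + 2 \<le> N" by linarith
  note d = truncated_power_deriv[OF this]
  have "((\<lambda>x. truncated_power N a (1 + x)) has_real_derivative truncated_power N (Suc a) (1 + x) * 1) (at x)"
    by (rule DERIV_chain2[OF d]) (auto intro!: derivative_eq_intros)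
  then show "((\<lambda>x. truncated_power N a (1 + x)) has_real_derivative truncated_power N (Suc a) (1 + x)) (at x)" by simp
  have "((\<lambda>x. truncated_power N a (1 - x)) has_real_derivative truncated_power N (Suc a) (1 - x) * (-1)) (at x)"
    by (rule DERIV_chain2[OF d]) (auto intro!: derivative_eq_intros)
  from DERIV_cmult[OF this, of "(-1) ^ a"]
  show "((\<lambda>x. (-1) ^ a * truncated_power N a (1 - x)) has_real_derivative (-1) ^ Suc a * truncated_power N (Suc a) (1 - x)) (at x)"
    by simp
qed (use assms in auto)

lemma truncated_power_continuous: "continuous_on S (truncated_power N k)"
  unfolding truncated_power_def[abs_def] by (intro continuous_intros)

lemma bump_continuous: "continuous_on UNIV (bump N k)"
  unfolding bump_def
  by (intro leibniz_continuous continuous_intros continuous_on_compose2[OF truncated_power_continuous]) auto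

lemma leibniz_split_zero:
  assumes "\<And>a. a \<le> A \<Longrightarrow> p a x = 0"
  shows "a + k \<le> A \<Longrightarrow> leibniz p q k a b x = 0"
  using assms by (induction k arbitrary: a b) auto

lemma leibniz_split_zero':
  assumes "\<And>b. b \<le> B \<Longrightarrow> q b x = 0"
  shows "b + k \<le> B \<Longrightarrow> leibniz p q k a b x = 0"
  using assms by (induction k arbitrary: a b) auto

lemma bump_zero:
  assumes "k < N" "1 < \<bar>x\<bar>"
  shows "bump N k x = 0"
proof (cases "x < 0")
  case True
  then show ?thesis unfolding bump_def
    by (intro leibniz_split_zero[of k]) (use assms in \<open>auto simp: truncated_power_def power_0_left\<close>)
next
  case False
  then show ?thesis unfolding bump_def
    by (intro leibniz_split_zero'[of k]) (use assms in \<open>auto simp: truncated_power_def power_0_left\<close>)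
qed

lemma bump_bounded:
  assumes "k < N"
  shows "\<exists>C. \<forall>x. \<bar>bump N k x\<bar> \<le> C"
proof -
  have "compact (bump N k ` {-1..1})"
    by (intro compact_continuous_image continuous_on_subset[OF bump_continuous]) auto
  then obtain C where C: "\<And>x. x \<in> {-1..1} \<Longrightarrow> \<bar>bump N k x\<bar> \<le> C"
    using compact_imp_bounded by (fastforce simp: bounded_iff)
  have "\<bar>bump N k x\<bar> \<le> C" for x
    using C[of x] C[of 0] bump_zero[OF assms, of x] by (cases "\<bar>x\<bar> \<le> 1") (auto simp: abs_le_iff)
  then show ?thesis by blast
qed

lemma bump_0_0: "bump N 0 0 = 1" by (simp add: bump_def truncated_power_def)

section \<open>Weak form of the equation\<close>

text \<open>Products of functions of one variable, where \<open>p i\<close> lists the derivatives of the factor in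
coordinate \<open>i\<close>. A mixed derivative of order \<open>ks\<close> is then just \<open>tensor p ks\<close>, independently of the order
of differentiation.\<close>

definition tensor :: "('n::finite \<Rightarrow> nat \<Rightarrow> real \<Rightarrow> real) \<Rightarrow> ('n \<Rightarrow> nat) \<Rightarrow> real^'n \<Rightarrow> real" where
  "tensor p ks y = (\<Prod>i\<in>UNIV. p i (ks i) (y $ i))"

lemma tensor_deriv:
  assumes "(p i (ks i) has_real_derivative p i (Suc (ks i)) (y $ i)) (at (y $ i))"
  shows "((\<lambda>h. tensor p ks (y + h *\<^sub>R axis i 1)) has_real_derivative tensor p (ks(i := Suc (ks i))) y) (at 0)"
proof -
  let ?c = "\<Prod>j\<in>UNIV-{i}. p j (ks j) (y $ j)"
  have e: "tensor p ks (y + h *\<^sub>R axis i 1) = p i (ks i) (y $ i + h) * ?c" for h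
  proof -
    have "(\<Prod>j\<in>UNIV-{i}. p j (ks j) ((y + h *\<^sub>R axis i 1) $ j)) = ?c"
      by (intro prod.cong) (auto simp: axis_def)
    then show ?thesis unfolding tensor_def by (subst prod.remove[of _ i]) auto
  qed
  have e': "tensor p (ks(i := Suc (ks i))) y = p i (Suc (ks i)) (y $ i) * ?c"
  proof -
    have "(\<Prod>j\<in>UNIV-{i}. p j ((ks(i := Suc (ks i))) j) (y $ j)) = ?c"
      by (intro prod.cong) auto
    then show ?thesis unfolding tensor_def by (subst prod.remove[of _ i]) auto
  qed
  have "((\<lambda>h. p i (ks i) (y $ i + h)) has_real_derivative p i (Suc (ks i)) (y $ i) * 1) (at 0)"
    by (rule DERIV_chain2[where g="\<lambda>h. y $ i + h"]) (use assms in \<open>auto intro!: derivative_eq_intros\<close>)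
  then show ?thesis unfolding e e' by (auto intro!: derivative_eq_intros)
qed

lemma tensor_continuous:
  assumes "\<And>i. continuous_on UNIV (p i (ks i))"
  shows "continuous_on UNIV (tensor p ks)"
  unfolding tensor_def by (intro continuous_intros continuous_on_compose2[OF assms]) auto

lemma tensor_zero: "\<bar>y $ i\<bar> > R \<Longrightarrow> (\<And>x. R < \<bar>x\<bar> \<Longrightarrow> p i (ks i) x = 0) \<Longrightarrow> tensor p ks y = 0"
  unfolding tensor_def by (rule prod_zero) auto

text \<open>Only \<open>\<phi>\<close> has to vanish outside a compact set: \<open>f\<close> and its derivative may grow arbitrarily.\<close>

lemma integration_by_parts_compact:
  fixes f \<phi> \<phi>' :: "real^'n \<Rightarrow> real"
  assumes f: "\<And>x. f differentiable (at x)" "continuous_on UNIV (partial_deriv i f)"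
    and \<phi>: "\<And>x. ((\<lambda>h. \<phi> (x + h *\<^sub>R axis i 1)) has_real_derivative \<phi>' x) (at 0)"
    and c: "continuous_on UNIV \<phi>" "continuous_on UNIV \<phi>'"
    and K: "compact K" "\<And>x. x \<notin> K \<Longrightarrow> \<phi> x = 0" "\<And>x. x \<notin> K \<Longrightarrow> \<phi>' x = 0"
  shows "(LINT x|lborel. partial_deriv i f x * \<phi> x) = - (LINT x|lborel. f x * \<phi>' x)"
proof -
  have cf: "continuous_on UNIV f"
    using f(1) by (intro continuous_at_imp_continuous_on ballI differentiable_imp_continuous_within)
  have c1: "continuous_on UNIV (\<lambda>x. f x * \<phi> x)" and c2: "continuous_on UNIV (\<lambda>x. partial_deriv i f x * \<phi> x)"
    and c3: "continuous_on UNIV (\<lambda>x. f x * \<phi>' x)"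
    by (intro continuous_on_mult cf f(2) c)+
  obtain C1 where C1: "0 \<le> C1" "\<And>x. norm (f x * \<phi> x) \<le> C1 * weight x"
    using compact_support_le_weight[OF c1 K(1)] K by auto
  obtain C2 where C2: "0 \<le> C2" "\<And>x. norm (partial_deriv i f x * \<phi> x) \<le> C2 * weight x"
    using compact_support_le_weight[OF c2 K(1)] K by auto
  obtain C3 where C3: "0 \<le> C3" "\<And>x. norm (f x * \<phi>' x) \<le> C3 * weight x"
    using compact_support_le_weight[OF c3 K(1)] K by auto
  have i2: "integrable lborel (\<lambda>x. partial_deriv i f x * \<phi> x)"
    by (rule integrable_le_weight[OF borel_measurable_continuous_onI[OF c2] C2(2)])
  have i3: "integrable lborel (\<lambda>x. f x * \<phi>' x)"
    by (rule integrable_le_weight[OF borel_measurable_continuous_onI[OF c3] C3(2)])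
  have "(LINT x|lborel. partial_deriv i f x * \<phi> x + f x * \<phi>' x) = 0"
  proof (rule integral_partial_zero)
    show "((\<lambda>h. f (x + h *\<^sub>R axis i 1) * \<phi> (x + h *\<^sub>R axis i 1)) has_vector_derivative (partial_deriv i f x * \<phi> x + f x * \<phi>' x)) (at 0)" for x
      unfolding has_real_derivative_iff_has_vector_derivative[symmetric]
      using DERIV_mult[OF has_derivative_partial_deriv(2)[OF f(1)] \<phi>, of x i x] by (simp add: add.commute mult.commute)
    show "norm (f x * \<phi> x) \<le> (C1 + C2 + C3) * weight x" for x
      using C1(2)[of x] C2(1) C3(1) weight_pos[of x] by (smt (verit) mult_nonneg_nonneg distrib_right)
    show "norm (partial_deriv i f x * \<phi> x + f x * \<phi>' x) \<le> (C1 + C2 + C3) * weight x" for x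
    proof -
      have "norm (partial_deriv i f x * \<phi> x + f x * \<phi>' x) \<le> C2 * weight x + C3 * weight x"
        by (rule order_trans[OF norm_triangle_ineq add_mono[OF C2(2) C3(2)]])
      also have "\<dots> \<le> (C1 + C2 + C3) * weight x" using C1(1) weight_pos[of x] by (simp add: distrib_right)
      finally show ?thesis .
    qed
  qed (auto intro!: borel_measurable_continuous_onI continuous_on_add c1 c2 c3)
  then show ?thesis by (simp add: Bochner_Integration.integral_add[OF i2 i3])
qed

text \<open>Compactly supported test functions of product form. Derivatives are available up to order \<open>L\<close>
only, as the cutoffs have finite smoothness.\<close>

locale product_test =
  fixes p :: "'n::finite \<Rightarrow> nat \<Rightarrow> real \<Rightarrow> real" and L :: nat and R :: real
  assumes p_deriv: "\<And>i k x. k < L \<Longrightarrow> (p i k has_real_derivative p i (Suc k) x) (at x)"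
    and p_cont: "\<And>i k. k \<le> L \<Longrightarrow> continuous_on UNIV (p i k)"
    and p_zero: "\<And>i k x. k \<le> L \<Longrightarrow> R < \<bar>x\<bar> \<Longrightarrow> p i k x = 0"
begin

lemma tensor_cont: "(\<And>i. ks i \<le> L) \<Longrightarrow> continuous_on UNIV (tensor p ks)"
  by (intro tensor_continuous p_cont)

definition test_box :: "(real^'n) set" where "test_box = cbox (\<chi> i. - R) (\<chi> i. R)"

lemma tensor_outside:
  assumes "\<And>i. ks i \<le> L" "y \<notin> test_box"
  shows "tensor p ks y = 0"
proof -
  obtain i where "R < \<bar>y $ i\<bar>" using assms(2) by (auto simp: test_box_def mem_box_cart) (smt (verit))+
  then show ?thesis by (rule tensor_zero) (rule p_zero[OF assms(1)])
qed

lemma tensor_le_weight: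
  assumes "\<And>i. ks i \<le> L"
  obtains C where "0 \<le> C" "\<And>y. \<bar>tensor p ks y\<bar> \<le> C * weight y"
proof -
  have "compact test_box" by (simp add: test_box_def)
  moreover have "continuous_on UNIV (tensor p ks)" by (rule tensor_cont[OF assms])
  moreover have "tensor p ks y = 0" if "y \<notin> test_box" for y by (rule tensor_outside[OF assms that])
  ultimately obtain C where "0 \<le> C" "\<And>y. norm (tensor p ks y) \<le> C * weight y"
    using compact_support_le_weight by blast
  then show ?thesis using that by simp
qed

lemma integral_iter_partial:
  fixes w :: "real^'n \<Rightarrow> real"
  assumes w: "Ck_diff k w" "\<And>is. length is \<le> k \<Longrightarrow> continuous_on UNIV (iter_partial is w)"
  shows "length is \<le> k \<Longrightarrow> (\<And>i. ks i + length is \<le> L) \<Longrightarrow>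
    (LINT y|lborel. iter_partial is w y * tensor p ks y) = (-1) ^ length is * (LINT y|lborel. w y * tensor p (\<lambda>i. ks i + count_list is i) y)"
proof (induction "is" arbitrary: ks)
  case (Cons i "is")
  let ?k = "ks(i := Suc (ks i))"
  have l: "ks j < L" "ks j \<le> L" "?k j \<le> L" for j using Cons.prems(2)[of j] by auto
  have "(LINT y|lborel. iter_partial (i # is) w y * tensor p ks y) = - (LINT y|lborel. iter_partial is w y * tensor p ?k y)"
    unfolding iter_partial_simps
  proof (rule integration_by_parts_compact)
    show "iter_partial is w differentiable (at x)" for x using w(1) Cons.prems by (simp add: Ck_diff_def)
    show "continuous_on UNIV (partial_deriv i (iter_partial is w))" using w(2)[of "i # is"] Cons.prems by simp
    show "((\<lambda>h. tensor p ks (x + h *\<^sub>R axis i 1)) has_real_derivative tensor p ?k x) (at 0)" for x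
      by (rule tensor_deriv) (rule p_deriv[OF l(1)])
    show "compact test_box" by (simp add: test_box_def)
  qed (use l in \<open>auto intro!: tensor_cont tensor_outside\<close>)
  also have "(LINT y|lborel. iter_partial is w y * tensor p ?k y) = (-1) ^ length is * (LINT y|lborel. w y * tensor p (\<lambda>j. ?k j + count_list is j) y)"
  proof (rule Cons.IH)
    show "?k j + length is \<le> L" for j using Cons.prems(2)[of j] Cons.prems(2)[of i] by auto
  qed (use Cons.prems in auto)
  also have "(\<lambda>j. ?k j + count_list is j) = (\<lambda>j. ks j + count_list (i # is) j)" by auto
  finally show ?case by simp
qed simp

end

text \<open>The information about a solution that uniqueness uses. The space derivatives of \<open>w\<close> are
continuous, but may grow at infinity.\<close>

locale bounded_solution =
  fixes m :: nat and T B :: real and \<alpha> :: "real \<Rightarrow> real" and w :: "real \<Rightarrow> real^'n \<Rightarrow> real"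
  assumes T: "0 < T" and \<alpha>: "continuous_on {0..T} \<alpha>" and w: "Ck_space_on (2 * m) T UNIV w"
    and eq: "\<And>t x. t \<in> {0<..T} \<Longrightarrow> ((\<lambda>s. w s x) has_real_derivative - \<alpha> t * neg_laplacian_pow m (w t) x) (at t within {0..T})"
    and wB: "\<And>t x. t \<in> {0..T} \<Longrightarrow> \<bar>w t x\<bar> \<le> B"
begin

lemma w_Ck: "t \<in> {0..T} \<Longrightarrow> Ck_diff (2 * m) (w t)"
  using w by (auto simp: Ck_space_on_def Ck_diff_def)

lemma w_cont2: "length is \<le> 2 * m \<Longrightarrow> continuous_on ({0..T} \<times> UNIV) (\<lambda>p. iter_partial is (w (fst p)) (snd p))"
  using w by (auto simp: Ck_space_on_def split_def)

lemma w_cont: "length is \<le> 2 * m \<Longrightarrow> t \<in> {0..T} \<Longrightarrow> continuous_on UNIV (iter_partial is (w t))"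
proof -
  assume l: "length is \<le> 2 * m" and t: "t \<in> {0..T}"
  have c: "continuous_on UNIV (\<lambda>x. (t, x))" by (intro continuous_on_Pair continuous_on_const continuous_on_id)
  show "continuous_on UNIV (iter_partial is (w t))"
    using continuous_on_compose2[OF w_cont2[OF l] c] t by (simp add: image_subset_iff)
qed

lemma w_cont0: "t \<in> {0..T} \<Longrightarrow> continuous_on UNIV (w t)"
  using w_cont[of "[]"] by simp

lemma w_cont_time: "continuous_on {0..T} (\<lambda>t. w t x)"
proof -
  have c: "continuous_on {0..T} (\<lambda>t. (t, x))" by (intro continuous_on_Pair continuous_on_const continuous_on_id)
  show ?thesis using continuous_on_compose2[OF w_cont2[of "[]"] c] by (simp add: image_subset_iff)
qed

lemma w_integral_integrable:
  assumes "continuous_on UNIV \<phi>" "\<And>y. \<bar>\<phi> y\<bar> \<le> C * weight y" "t \<in> {0..T}"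
  shows "integrable lborel (\<lambda>y. w t y * \<phi> y)"
proof (rule Bochner_Integration.integrable_bound)
  show "integrable lborel (\<lambda>y. B * \<phi> y)"
    by (intro integrable_mult_right integrable_le_weight[where C=C] borel_measurable_continuous_onI) (use assms in auto)
  show "(\<lambda>y. w t y * \<phi> y) \<in> borel_measurable lborel"
    using w_cont0[OF assms(3)] assms(1) by (simp add: borel_measurable_continuous_onI borel_measurable_times)
  show "AE y in lborel. norm (w t y * \<phi> y) \<le> norm (B * \<phi> y)"
    using wB[OF assms(3)] by (intro AE_I2) (simp add: abs_mult mult_right_mono order_trans[OF _ abs_ge_self])
qed

lemma w_integral_continuous:
  assumes \<phi>: "continuous_on UNIV \<phi>" "\<And>y. \<bar>\<phi> y\<bar> \<le> C * weight y"
  shows "continuous_on {0..T} (\<lambda>t. LINT y|lborel. w t y * \<phi> y)"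
proof (rule continuous_on_integral)
  show "continuous_on {0..T} (\<lambda>t. w t y * \<phi> y)" for y by (intro continuous_intros w_cont_time)
  show "\<bar>w t y * \<phi> y\<bar> \<le> B * \<bar>\<phi> y\<bar>" if "t \<in> {0..T}" for t y
    using wB[OF that] by (simp add: abs_mult mult_right_mono)
  show "integrable lborel (\<lambda>y. B * \<bar>\<phi> y\<bar>)"
    by (intro integrable_mult_right integrable_abs integrable_le_weight[where C=C] borel_measurable_continuous_onI) (use \<phi> in auto)
  show "(\<lambda>y. w t y * \<phi> y) \<in> borel_measurable lborel" if "t \<in> {0..T}" for t
    using w_cont0[OF that] \<phi>(1) by (simp add: borel_measurable_continuous_onI borel_measurable_times)
qed

lemma neg_laplacian_pow_cont2: "continuous_on ({0..T} \<times> UNIV) (\<lambda>p. neg_laplacian_pow m (w (fst p)) (snd p))"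
proof -
  have "continuous_on ({0..T} \<times> UNIV) (\<lambda>p. (-1) ^ m * (\<Sum>is | length is = m. iter_partial (doubled is) (w (fst p)) (snd p)))"
    by (intro continuous_intros w_cont2) auto
  then show ?thesis
    by (rule continuous_on_eq) (auto simp: neg_laplacian_pow_expand[OF w_Ck])
qed

text \<open>On the compact support of the test function the time derivative is bounded, so one may
differentiate under the integral; the space derivatives are then moved to the test function.\<close>

lemma weak_formulation:
  assumes "product_test p L R" and L: "2 * m \<le> L" and t: "t \<in> {0<..T}"
  shows "((\<lambda>s. LINT y|lborel. w s y * tensor p (\<lambda>_. 0) y) has_real_derivative
     - \<alpha> t * (-1) ^ m * (\<Sum>is | length is = m. LINT y|lborel. w t y * tensor p (count_list (doubled is)) y)) (at t within {0..T})"
proof -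
  interpret product_test p L R by fact
  let ?\<phi> = "tensor p (\<lambda>_. 0)"
  have c\<phi>: "continuous_on UNIV ?\<phi>" by (rule tensor_cont) simp
  have z\<phi>: "?\<phi> y = 0" if "y \<notin> test_box" for y by (rule tensor_outside) (use that in auto)
  have cb: "compact test_box" by (simp add: test_box_def)
  obtain C where C: "0 \<le> C" "\<And>y. \<bar>?\<phi> y\<bar> \<le> C * weight y" by (rule tensor_le_weight[of "\<lambda>_. 0"]) auto
  have t': "t \<in> {0..T}" using t by auto
  have "continuous_on ({0..T} \<times> test_box) (\<lambda>p. - \<alpha> (fst p) * neg_laplacian_pow m (w (fst p)) (snd p))"
    by (intro continuous_intros continuous_on_compose2[OF \<alpha>] continuous_on_subset[OF neg_laplacian_pow_cont2]) auto
  from compact_imp_bounded[OF compact_continuous_image[OF this compact_Times[OF compact_Icc cb]]]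
  obtain M where M: "\<And>s y. s \<in> {0..T} \<Longrightarrow> y \<in> test_box \<Longrightarrow> \<bar>- \<alpha> s * neg_laplacian_pow m (w s) y\<bar> \<le> M"
    by (fastforce simp: bounded_iff)
  have "((\<lambda>s. LINT y|lborel. w s y * ?\<phi> y) has_derivative (\<lambda>h. LINT y|lborel. - \<alpha> t * neg_laplacian_pow m (w t) y * h * ?\<phi> y)) (at t within {0<..T})"
  proof (rule has_derivative_integral[where G="\<lambda>y. M * \<bar>?\<phi> y\<bar>"])
    show "integrable lborel (\<lambda>y. M * \<bar>?\<phi> y\<bar>)"
      by (intro integrable_mult_right integrable_abs integrable_le_weight[where C=C] borel_measurable_continuous_onI) (use C c\<phi> in auto)
    show "(\<lambda>y. - \<alpha> t * neg_laplacian_pow m (w t) y * h * ?\<phi> y) \<in> borel_measurable lborel" for h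
      by (simp, rule borel_measurable_continuous_onI,
          intro continuous_intros c\<phi> continuous_on_compose2[OF neg_laplacian_pow_cont2, of UNIV "\<lambda>y. (t, y)", simplified])
        (use t' in auto)
    fix s :: real assume s: "s \<in> {0<..T}"
    then have s': "s \<in> {0..T}" by auto
    show "integrable lborel (\<lambda>y. w s y * ?\<phi> y)" by (rule w_integral_integrable[OF c\<phi> C(2) s'])
    fix y
    have "((\<lambda>s. w s y) has_derivative (\<lambda>h. - \<alpha> s * neg_laplacian_pow m (w s) y * h)) (at s within {0<..T})"
      using eq[OF s, of y] unfolding has_field_derivative_def
      by (rule has_derivative_subset) auto
    from has_derivative_mult_left[OF this]
    show "((\<lambda>s. w s y * ?\<phi> y) has_derivative (\<lambda>h. - \<alpha> s * neg_laplacian_pow m (w s) y * h * ?\<phi> y)) (at s within {0<..T})" .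
    show "norm (- \<alpha> s * neg_laplacian_pow m (w s) y * h * ?\<phi> y) \<le> M * \<bar>?\<phi> y\<bar> * norm h" for h
    proof (cases "y \<in> test_box")
      case True
      have "\<bar>- \<alpha> s * neg_laplacian_pow m (w s) y\<bar> * (\<bar>h\<bar> * \<bar>?\<phi> y\<bar>) \<le> M * (\<bar>h\<bar> * \<bar>?\<phi> y\<bar>)"
        by (intro mult_right_mono M s' True) auto
      then show ?thesis by (simp add: abs_mult mult_ac)
    qed (simp add: z\<phi>)
  qed (use t in auto)
  then have "((\<lambda>s. LINT y|lborel. w s y * ?\<phi> y) has_derivative (\<lambda>h. LINT y|lborel. h * (- \<alpha> t * (neg_laplacian_pow m (w t) y * ?\<phi> y)))) (at t within {0<..T})"
    by (simp add: mult_ac)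
  also have "(\<lambda>h. LINT y|lborel. h * (- \<alpha> t * (neg_laplacian_pow m (w t) y * ?\<phi> y))) = (*) (- \<alpha> t * (LINT y|lborel. neg_laplacian_pow m (w t) y * ?\<phi> y))"
    unfolding integral_mult_right_zero by (auto simp: fun_eq_iff)
  finally have d: "((\<lambda>s. LINT y|lborel. w s y * ?\<phi> y) has_real_derivative - \<alpha> t * (LINT y|lborel. neg_laplacian_pow m (w t) y * ?\<phi> y)) (at t within {0..T})"
    unfolding has_field_derivative_def
    by (subst (asm) at_within_nhd[of t "{0<..}" "{0<..T}" "{0..T}"]) (use t in auto)
  have "integrable lborel (\<lambda>y. iter_partial (doubled is) (w t) y * ?\<phi> y)" if "length is = m" for "is"
  proof -
    have c: "continuous_on UNIV (\<lambda>y. iter_partial (doubled is) (w t) y * ?\<phi> y)"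
      by (intro continuous_intros c\<phi> w_cont t') (use that in auto)
    obtain D where D: "0 \<le> D" "\<And>y. norm (iter_partial (doubled is) (w t) y * ?\<phi> y) \<le> D * weight y"
      by (rule compact_support_le_weight[OF c cb]) (use z\<phi> in auto)
    from integrable_le_weight[OF borel_measurable_continuous_onI[OF c] D(2)] show ?thesis .
  qed
  then have "(LINT y|lborel. neg_laplacian_pow m (w t) y * ?\<phi> y) = (-1) ^ m * (\<Sum>is | length is = m. LINT y|lborel. iter_partial (doubled is) (w t) y * ?\<phi> y)"
    unfolding neg_laplacian_pow_expand[OF w_Ck[OF t']]
    by (simp add: mult.assoc sum_distrib_right Bochner_Integration.integral_sum)
  also have "\<dots> = (-1) ^ m * (\<Sum>is | length is = m. LINT y|lborel. w t y * tensor p (count_list (doubled is)) y)"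
  proof (intro arg_cong2[where f="(*)"] refl sum.cong)
    fix "is" :: "'n list" assume "is \<in> {is. length is = m}"
    then have l: "length (doubled is) = 2 * m" by simp
    have "(LINT y|lborel. iter_partial (doubled is) (w t) y * ?\<phi> y) = (-1) ^ length (doubled is) * (LINT y|lborel. w t y * tensor p (\<lambda>i. 0 + count_list (doubled is) i) y)"
      by (rule integral_iter_partial[OF w_Ck[OF t'] w_cont[OF _ t']]) (use l L in auto)
    then show "(LINT y|lborel. iter_partial (doubled is) (w t) y * ?\<phi> y) = (LINT y|lborel. w t y * tensor p (count_list (doubled is)) y)"
      unfolding l by simp
  qed
  finally show ?thesis using d by (simp add: mult.assoc)
qed

end

section \<open>Uniqueness of bounded solutions\<close>

text \<open>Derivatives of a factor concentrated near \<open>c\<close> at scale \<open>1 / lam\<close>.\<close>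

definition band_limited_at :: "real \<Rightarrow> real \<Rightarrow> nat \<Rightarrow> real \<Rightarrow> real" where
  "band_limited_at lam c k y = lam ^ k * band_limited k (lam * (y - c))"

lemma band_limited_at_deriv: "(band_limited_at lam c k has_real_derivative band_limited_at lam c (Suc k) y) (at y)"
proof -
  have "((\<lambda>y. band_limited k (lam * (y - c))) has_real_derivative band_limited (Suc k) (lam * (y - c)) * lam) (at y)"
    by (rule DERIV_chain2[OF band_limited_deriv]) (auto intro!: derivative_eq_intros)
  from DERIV_cmult[OF this, of "lam ^ k"] show ?thesis by (simp add: band_limited_at_def[abs_def] mult_ac)
qed

lemma band_limited_at_continuous: "continuous_on UNIV (band_limited_at lam c k)"
  unfolding band_limited_at_def[abs_def] by (intro continuous_intros continuous_on_compose2[OF band_limited_continuous]) auto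

lemma band_limited_at_bound:
  assumes "1 \<le> lam"
  shows "\<exists>D\<ge>0. \<forall>k y. \<bar>band_limited_at lam c k y\<bar> \<le> D * (4 * lam) ^ k * (1 / (1 + y\<^sup>2))"
proof -
  define C where "C = 3 + 2 * c\<^sup>2"
  have C: "0 \<le> C" by (simp add: C_def)
  have "\<bar>band_limited_at lam c k y\<bar> \<le> (5 * C) * (4 * lam) ^ k * (1 / (1 + y\<^sup>2))" for k y
  proof -
    have "0 \<le> (y - 2 * c)\<^sup>2" by simp
    moreover have "1 * (y - c)\<^sup>2 \<le> lam\<^sup>2 * (y - c)\<^sup>2" using assms by (intro mult_right_mono) (auto simp: one_le_power)
    moreover have "0 \<le> c\<^sup>2 * (lam\<^sup>2 * (y - c)\<^sup>2)" "0 \<le> lam\<^sup>2 * (y - c)\<^sup>2" by auto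
    ultimately have "1 + y\<^sup>2 \<le> C * (1 + lam\<^sup>2 * (y - c)\<^sup>2)"
      unfolding C_def by (simp add: algebra_simps power2_eq_square)
    then have "1 / (1 + (lam * (y - c))\<^sup>2) \<le> C * (1 / (1 + y\<^sup>2))"
      by (simp add: divide_le_eq pos_divide_le_eq pos_le_divide_eq add_pos_nonneg power_mult_distrib mult.commute)
    from mult_left_mono[OF this, of "5 * 4 ^ k"]
    have "\<bar>band_limited k (lam * (y - c))\<bar> \<le> 5 * 4 ^ k * (C * (1 / (1 + y\<^sup>2)))"
      using band_limited_bound[of k "lam * (y - c)"] by simp
    from mult_left_mono[OF this, of "lam ^ k"] show ?thesis
      using assms by (simp add: band_limited_at_def abs_mult power_mult_distrib mult_ac)
  qed
  with C show ?thesis by (intro exI[of _ "5 * C"]) auto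
qed

lemma tensor_bound:
  fixes ks :: "'n::finite \<Rightarrow> nat"
  assumes "\<And>i y. \<bar>p i (ks i) y\<bar> \<le> D i * (1 / (1 + y\<^sup>2))"
  shows "\<bar>tensor p ks (y :: real^'n)\<bar> \<le> (\<Prod>i\<in>UNIV. D i) * weight y"
proof -
  have "\<bar>tensor p ks y\<bar> = (\<Prod>i\<in>UNIV. \<bar>p i (ks i) (y $ i)\<bar>)" unfolding tensor_def by (rule abs_prod)
  also have "\<dots> \<le> (\<Prod>i\<in>UNIV. D i * (1 / (1 + (y $ i)\<^sup>2)))"
    by (intro prod_mono) (use assms in auto)
  finally show ?thesis unfolding weight_def prod.distrib .
qed

lemma tensor_band_limited_at_bound:
  assumes "1 \<le> lam"
  shows "\<exists>E\<ge>0. \<forall>ks (y :: real^'n). \<bar>tensor (\<lambda>i. band_limited_at lam (c i)) ks y\<bar> \<le> E * (4 * lam) ^ (sum ks UNIV) * weight y"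
proof -
  obtain D where D: "\<And>i. D i \<ge> 0" "\<And>i k y. \<bar>band_limited_at lam (c i) k y\<bar> \<le> D i * (4 * lam) ^ k * (1 / (1 + y\<^sup>2))"
    using band_limited_at_bound[OF assms, of "c _"] by metis
  have "\<bar>tensor (\<lambda>i. band_limited_at lam (c i)) ks y\<bar> \<le> (\<Prod>i\<in>UNIV. D i) * (4 * lam) ^ (sum ks UNIV) * weight y" for ks and y :: "real^'n"
    using tensor_bound[of "\<lambda>i. band_limited_at lam (c i)" ks "\<lambda>i. D i * (4 * lam) ^ ks i" y] D(2)
    by (simp add: prod.distrib power_sum)
  then show ?thesis using D(1) by (intro exI[of _ "\<Prod>i\<in>UNIV. D i"]) (auto intro!: prod_nonneg)
qed

text \<open>The \<open>k\<close>-th derivative of the product of \<open>band_limited_at lam (c i) (a i)\<close> with a cutoff at radius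
\<open>R\<close>. The exponent \<open>L + 2\<close> makes the cutoff \<open>L\<close> times differentiable with continuous derivatives.\<close>

definition cut_off :: "real \<Rightarrow> ('n \<Rightarrow> real) \<Rightarrow> ('n \<Rightarrow> nat) \<Rightarrow> nat \<Rightarrow> real \<Rightarrow> 'n \<Rightarrow> nat \<Rightarrow> real \<Rightarrow> real" where
  "cut_off lam c a L R i k = leibniz (band_limited_at lam (c i)) (\<lambda>b y. (1 / R) ^ b * bump (L + 2) b (y / R)) k (a i) 0"

lemma cut_off_product_test:
  assumes R: "0 < R"
  shows "product_test (cut_off lam c a L R) L R"
proof
  fix i k and x :: real
  show "(cut_off lam c a L R i k has_real_derivative cut_off lam c a L R i (Suc k) x) (at x)" if "k < L"
    unfolding cut_off_def
  proof (rule leibniz_deriv[where M="a i + k + 1" and N="L + 1"])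
    fix b and x :: real assume "b < L + 1"
    then have "((\<lambda>y. bump (L + 2) b (y / R)) has_real_derivative bump (L + 2) (Suc b) (x / R) * (1 / R)) (at x)"
      using R by (intro DERIV_chain2[OF bump_deriv]) (auto intro!: derivative_eq_intros)
    from DERIV_cmult[OF this, of "(1 / R) ^ b"]
    show "((\<lambda>y. (1 / R) ^ b * bump (L + 2) b (y / R)) has_real_derivative (1 / R) ^ Suc b * bump (L + 2) (Suc b) (x / R)) (at x)"
      by (simp add: mult_ac)
  qed (use that band_limited_at_deriv in auto)
  show "continuous_on UNIV (cut_off lam c a L R i k)"
    unfolding cut_off_def using R
    by (intro leibniz_continuous band_limited_at_continuous continuous_intros continuous_on_compose2[OF bump_continuous]) auto
  show "cut_off lam c a L R i k x = 0" if "k \<le> L" "R < \<bar>x\<bar>"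
    unfolding cut_off_def
  proof (rule leibniz_split_zero'[of L])
    fix b assume "b \<le> L"
    moreover have "1 < \<bar>x / R\<bar>" using that R by simp
    ultimately show "(1 / R) ^ b * bump (L + 2) b (x / R) = 0" by (simp add: bump_zero)
  qed (use that in auto)
qed

lemma cut_off_bound:
  assumes lam: "1 \<le> lam"
  shows "\<exists>C. \<forall>R k y. 1 \<le> R \<longrightarrow> k \<le> L \<longrightarrow> \<bar>cut_off lam c a L R i k y\<bar> \<le> C * (1 / (1 + y\<^sup>2))"
proof -
  obtain D where D: "D \<ge> 0" "\<And>k y. \<bar>band_limited_at lam (c i) k y\<bar> \<le> D * (4 * lam) ^ k * (1 / (1 + y\<^sup>2))"
    using band_limited_at_bound[OF assms, of "c i"] by metis
  have "\<forall>b\<in>{..L}. \<exists>C. \<forall>x. \<bar>bump (L + 2) b x\<bar> \<le> C" by (auto intro!: bump_bounded)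
  then obtain X where X: "\<And>b x. b \<le> L \<Longrightarrow> \<bar>bump (L + 2) b x\<bar> \<le> X b" by (metis atMost_iff)
  have X0: "b \<le> L \<Longrightarrow> 0 \<le> X b" for b using X[of b 0] by linarith
  let ?Q = "\<Sum>b\<le>L. X b"
  have "\<bar>cut_off lam c a L R i k y\<bar> \<le> (2 ^ L * (D * (4 * lam) ^ (a i + L) * ?Q)) * (1 / (1 + y\<^sup>2))"
    if R: "1 \<le> R" and k: "k \<le> L" for R k y
  proof -
    have "\<bar>cut_off lam c a L R i k y\<bar> \<le> 2 ^ k * ((D * (4 * lam) ^ (a i + L) * (1 / (1 + y\<^sup>2))) * ?Q)"
      unfolding cut_off_def
    proof (rule leibniz_bound)
      fix a' assume "a' \<le> a i + k"
      then have "(4 * lam) ^ a' \<le> (4 * lam) ^ (a i + L)" using lam k by (intro power_increasing) auto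
      then have "D * (4 * lam) ^ a' * (1 / (1 + y\<^sup>2)) \<le> D * (4 * lam) ^ (a i + L) * (1 / (1 + y\<^sup>2))"
        using D(1) by (intro mult_right_mono mult_left_mono) auto
      then show "\<bar>band_limited_at lam (c i) a' y\<bar> \<le> D * (4 * lam) ^ (a i + L) * (1 / (1 + y\<^sup>2))"
        using D(2)[of a' y] by linarith
    next
      fix b assume "b \<le> 0 + k"
      then have b: "b \<le> L" using k by simp
      have "(1 / R) ^ b \<le> 1" using R by (intro power_le_one) auto
      then have "\<bar>(1 / R) ^ b * bump (L + 2) b (y / R)\<bar> \<le> 1 * X b"
        unfolding abs_mult using R X0[OF b] by (intro mult_mono X b) auto
      also have "X b \<le> ?Q" by (rule member_le_sum) (use b X0 in auto)
      then have "1 * X b \<le> ?Q" by simp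
      finally show "\<bar>(1 / R) ^ b * bump (L + 2) b (y / R)\<bar> \<le> ?Q" .
    qed
    also have "\<dots> \<le> 2 ^ L * ((D * (4 * lam) ^ (a i + L) * (1 / (1 + y\<^sup>2))) * ?Q)"
      using D(1) lam k X0 by (intro mult_right_mono power_increasing mult_nonneg_nonneg sum_nonneg) auto
    finally show ?thesis by (simp add: mult_ac)
  qed
  then show ?thesis by blast
qed

lemma cut_off_limit:
  assumes "k \<le> L"
  shows "(\<lambda>n. cut_off lam c a L (real (Suc n)) i k y) \<longlonglongrightarrow> band_limited_at lam (c i) (a i + k) y"
proof -
  have r0: "(\<lambda>n. 1 / real (Suc n)) \<longlonglongrightarrow> 0" by (rule LIMSEQ_inverse_real_of_nat[unfolded inverse_eq_divide])
  have "(\<lambda>n. leibniz (band_limited_at lam (c i)) (\<lambda>b y. (1 / real (Suc n)) ^ b * bump (L + 2) b (y / real (Suc n))) k (a i) 0 y)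
    \<longlonglongrightarrow> (if (0::nat) = 0 then band_limited_at lam (c i) (a i + k) y else 0)"
  proof (rule leibniz_limit)
    fix b assume "b \<le> 0 + k"
    have "(\<lambda>n. y * (1 / real (Suc n))) \<longlonglongrightarrow> y * 0" by (intro tendsto_intros r0)
    then have "(\<lambda>n. y / real (Suc n)) \<longlonglongrightarrow> 0" by simp
    then have "(\<lambda>n. bump (L + 2) b (y / real (Suc n))) \<longlonglongrightarrow> bump (L + 2) b 0"
      by (rule continuous_on_tendsto_compose[OF bump_continuous]) auto
    then have "(\<lambda>n. (1 / real (Suc n)) ^ b * bump (L + 2) b (y / real (Suc n))) \<longlonglongrightarrow> 0 ^ b * bump (L + 2) b 0"
      by (intro tendsto_intros r0)
    then show "(\<lambda>n. (1 / real (Suc n)) ^ b * bump (L + 2) b (y / real (Suc n))) \<longlonglongrightarrow> (if b = 0 then 1 else 0)"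
      by (cases "b = 0") (auto simp: bump_0_0 power_0_left)
  qed
  then show ?thesis by (simp add: cut_off_def)
qed

text \<open>The cutoffs converge in \<open>L\<^sup>1\<close> together with all derivatives under consideration: pointwise
by the limit of the Leibniz rule, with a dominating function that does not depend on the radius.\<close>

lemma tensor_cut_off_L1:
  fixes c :: "'n::finite \<Rightarrow> real"
  assumes lam: "1 \<le> lam" and ks: "\<And>i. ks i \<le> L"
  shows "(\<lambda>n. LINT y|lborel. \<bar>tensor (cut_off lam c a L (real (Suc n))) ks (y :: real^'n) - tensor (\<lambda>i. band_limited_at lam (c i)) (\<lambda>i. a i + ks i) y\<bar>) \<longlonglongrightarrow> 0"
proof -
  let ?p = "\<lambda>n. tensor (cut_off lam c a L (real (Suc n))) ks :: real^'n \<Rightarrow> real"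
  let ?g = "tensor (\<lambda>i. band_limited_at lam (c i)) (\<lambda>i. a i + ks i) :: real^'n \<Rightarrow> real"
  obtain C where C: "\<And>i R k y. 1 \<le> R \<Longrightarrow> k \<le> L \<Longrightarrow> \<bar>cut_off lam c a L R i k y\<bar> \<le> C i * (1 / (1 + y\<^sup>2))"
    using cut_off_bound[OF lam, of L c a] by metis
  have b1: "\<bar>?p n y\<bar> \<le> (\<Prod>i\<in>UNIV. C i) * weight y" for n y
    by (rule tensor_bound) (rule C, use ks in auto)
  obtain E where E: "E \<ge> 0" "\<And>ks (y :: real^'n). \<bar>tensor (\<lambda>i. band_limited_at lam (c i)) ks y\<bar> \<le> E * (4 * lam) ^ (sum ks UNIV) * weight y"
    using tensor_band_limited_at_bound[OF lam, of c] by blast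
  have c1: "continuous_on UNIV (?p n)" for n
  proof -
    interpret product_test "cut_off lam c a L (real (Suc n))" L "real (Suc n)" by (rule cut_off_product_test) simp
    show ?thesis by (rule tensor_cont[OF ks])
  qed
  have c2: "continuous_on UNIV ?g" by (intro tensor_continuous band_limited_at_continuous)
  have "(\<lambda>n. LINT y|lborel. \<bar>?p n y - ?g y\<bar>) \<longlonglongrightarrow> (LINT y|(lborel :: (real^'n) measure). (0 :: real))"
  proof (rule integral_dominated_convergence[where w="\<lambda>y. ((\<Prod>i\<in>UNIV. C i) + E * (4 * lam) ^ (\<Sum>i\<in>UNIV. a i + ks i)) * weight y"])
    show "integrable lborel (\<lambda>y::real^'n. ((\<Prod>i\<in>UNIV. C i) + E * (4 * lam) ^ (\<Sum>i\<in>UNIV. a i + ks i)) * weight y)"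
      by (intro integrable_mult_right integrable_weight)
    show "(\<lambda>y. \<bar>?p n y - ?g y\<bar>) \<in> borel_measurable lborel" for n
      using borel_measurable_continuous_onI[OF c1[of n]] borel_measurable_continuous_onI[OF c2] by simp
    show "AE y in lborel. norm \<bar>?p n y - ?g y\<bar> \<le> ((\<Prod>i\<in>UNIV. C i) + E * (4 * lam) ^ (\<Sum>i\<in>UNIV. a i + ks i)) * weight y" for n
    proof (rule AE_I2)
      fix y
      show "norm \<bar>?p n y - ?g y\<bar> \<le> ((\<Prod>i\<in>UNIV. C i) + E * (4 * lam) ^ (\<Sum>i\<in>UNIV. a i + ks i)) * weight y"
        using abs_triangle_ineq4[of "?p n y" "?g y"] b1[of n y] E(2)[of "\<lambda>i. a i + ks i" y]
        unfolding distrib_right real_norm_def abs_idempotent by linarith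
    qed
    have "(\<lambda>n. ?p n y) \<longlonglongrightarrow> ?g y" for y
      unfolding tensor_def by (intro tendsto_prod cut_off_limit ks)
    then have "(\<lambda>n. \<bar>?p n y - ?g y\<bar>) \<longlonglongrightarrow> \<bar>?g y - ?g y\<bar>" for y
      by (intro tendsto_intros)
    then show "AE y in lborel. (\<lambda>n. \<bar>?p n y - ?g y\<bar>) \<longlonglongrightarrow> 0" by simp
  qed simp
  then show "(\<lambda>n. LINT y|lborel. \<bar>?p n y - ?g y\<bar>) \<longlonglongrightarrow> 0" by simp
qed

text \<open>Both \<open>G - f\<close> and \<open>G + f\<close> are nondecreasing. The derivatives are given on the half-open
interval because the equation holds for positive times; continuity covers the left endpoint.\<close>

lemma abs_le_by_derivative:
  fixes f G :: "real \<Rightarrow> real"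
  assumes t: "t \<in> {0..T}" and f: "continuous_on {0..T} f" "f 0 = 0"
    and f': "\<And>s. s \<in> {0<..T} \<Longrightarrow> (f has_real_derivative f' s) (at s within {0..T})"
    and b: "\<And>s. s \<in> {0<..T} \<Longrightarrow> \<bar>f' s\<bar> \<le> G' s"
    and G: "\<And>s. (G has_real_derivative G' s) (at s)" "G 0 = 0"
  shows "\<bar>f t\<bar> \<le> G t"
proof -
  have "G 0 - e * f 0 \<le> G t - e * f t" if e: "\<bar>e\<bar> = 1" for e
  proof (rule DERIV_nonneg_imp_increasing_open[where f="\<lambda>s. G s - e * f s"])
    show "0 \<le> t" using t by simp
    show "continuous_on {0..t} (\<lambda>s. G s - e * f s)"
    proof (intro continuous_on_diff continuous_on_mult continuous_on_const)
      show "continuous_on {0..t} G"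
        using G(1) by (meson DERIV_isCont continuous_at_imp_continuous_on)
      show "continuous_on {0..t} f" by (rule continuous_on_subset[OF f(1)]) (use t in auto)
    qed
    fix s assume s: "0 < s" "s < t"
    then have s': "s \<in> {0<..T}" using t by auto
    have "(f has_real_derivative f' s) (at s)"
      using f'[OF s'] s t by (subst (asm) at_within_Icc_at) auto
    then have "((\<lambda>s. G s - e * f s) has_real_derivative G' s - e * f' s) (at s)"
      by (intro DERIV_diff G(1) DERIV_cmult)
    moreover have "\<bar>e * f' s\<bar> \<le> G' s" using b[OF s'] e by (simp add: abs_mult)
    then have "0 \<le> G' s - e * f' s" by linarith
    ultimately show "\<exists>y. ((\<lambda>s. G s - e * f s) has_real_derivative y) (at s) \<and> 0 \<le> y" by blast
  qed
  from this[of 1] this[of "-1"] show ?thesis using f(2) G(2) by simp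
qed

text \<open>The bound on \<open>F ks\<close> improves by a factor \<open>Q s / (j + 1)\<close> with every use of the equation, because the
derivative of \<open>F ks\<close> is a sum of such functions for indices of order larger by \<open>2 * m\<close>, and raising the
order costs a constant factor \<open>M ^ (2 * m)\<close> only. Since the equation may be tested with compactly
supported functions only, each step is carried out for cut-off test functions, at the price of an error
that vanishes as the radius grows.\<close>

lemma bounded_solution_tested_zero:
  fixes u v :: "real \<Rightarrow> real^'n \<Rightarrow> real"
  assumes u: "bounded_solution m T B \<alpha> u" and v: "bounded_solution m T B \<alpha> v"
    and init: "\<And>x. u 0 x = v 0 x" and lam: "1 \<le> lam" and t: "t \<in> {0..T}"
  shows "(LINT y|lborel. (u t y - v t y) * tensor (\<lambda>i. band_limited_at lam (c i)) (\<lambda>_. 0) y) = 0"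
proof -
  interpret U: bounded_solution m T B \<alpha> u by fact
  interpret V: bounded_solution m T B \<alpha> v by fact
  let ?g = "tensor (\<lambda>i. band_limited_at lam (c i)) :: _ \<Rightarrow> real^'n \<Rightarrow> real"
  define d where "d s y = u s y - v s y" for s y
  define F where "F ks s = (LINT y|lborel. d s y * ?g ks y)" for ks s
  define M where "M = 4 * lam"
  have M: "1 \<le> M" using lam by (simp add: M_def)
  obtain E where E: "E \<ge> 0" "\<And>ks y. \<bar>?g ks y\<bar> \<le> E * M ^ (sum ks UNIV) * weight y"
    using tensor_band_limited_at_bound[OF lam, of c] unfolding M_def by blast
  have cg: "continuous_on UNIV (?g ks)" for ks by (intro tensor_continuous band_limited_at_continuous)
  have dB: "\<bar>d s y\<bar> \<le> 2 * B" if "s \<in> {0..T}" for s y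
    using U.wB[OF that, of y] V.wB[OF that, of y] unfolding d_def by linarith
  have B0: "0 \<le> B" using U.wB[of 0 0] U.T by auto
  have cd: "continuous_on UNIV (d s)" if "s \<in> {0..T}" for s
    unfolding d_def by (intro continuous_intros U.w_cont0 V.w_cont0 that)
  have split: "(LINT y|lborel. d s y * \<phi> y) = (LINT y|lborel. u s y * \<phi> y) - (LINT y|lborel. v s y * \<phi> y)"
    and intd: "integrable lborel (\<lambda>y. d s y * \<phi> y)"
    if "continuous_on UNIV \<phi>" "\<And>y. \<bar>\<phi> y\<bar> \<le> C * weight y" "s \<in> {0..T}" for \<phi> C s
    using U.w_integral_integrable[OF that] V.w_integral_integrable[OF that]
    by (auto simp: d_def left_diff_distrib)
  have dbound: "\<bar>LINT y|lborel. d s y * \<phi> y\<bar> \<le> 2 * B * (LINT y|lborel. \<bar>\<phi> y\<bar>)"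
    if "continuous_on UNIV \<phi>" "\<And>y. \<bar>\<phi> y\<bar> \<le> C * weight y" "s \<in> {0..T}" for \<phi> C s
  proof -
    have i: "integrable lborel \<phi>"
      by (rule integrable_le_weight[where C=C]) (use that in \<open>auto intro!: borel_measurable_continuous_onI\<close>)
    have "\<bar>LINT y|lborel. d s y * \<phi> y\<bar> \<le> (LINT y|lborel. 2 * B * \<bar>\<phi> y\<bar>)"
      unfolding real_norm_def[symmetric]
    proof (rule order_trans[OF integral_norm_bound integral_mono])
      show "integrable lborel (\<lambda>y. norm (d s y * \<phi> y))" by (rule integrable_norm[OF intd[OF that]])
    qed (use i dB[OF that(3)] in \<open>auto simp: abs_mult intro!: mult_right_mono\<close>)
    then show ?thesis by simp
  qed
  obtain A where A: "\<And>s. s \<in> {0..T} \<Longrightarrow> \<bar>\<alpha> s\<bar> \<le> A"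
    using compact_imp_bounded[OF compact_continuous_image[OF U.\<alpha> compact_Icc]] by (fastforce simp: bounded_iff)
  have A0: "0 \<le> A" using A[of 0] U.T by auto
  \<comment> \<open>\<open>N\<close> counts the terms of the expanded operator, so \<open>Q\<close> bounds the growth caused by one use of the equation\<close>
  define N where "N = real (card {is :: 'n list. length is = m})"
  define Q where "Q = A * N * M ^ (2 * m)"
  define N0 where "N0 = 2 * B * (E * (LINT y|lborel. weight (y :: real^'n)))"
  have claim: "\<bar>F ks s\<bar> \<le> (Q * s) ^ j / fact j * (N0 * M ^ (sum ks UNIV))" if "s \<in> {0..T}" for j ks s
    using that
  proof (induction j arbitrary: ks s)
    case 0
    have "\<bar>F ks s\<bar> \<le> 2 * B * (LINT y|lborel. \<bar>?g ks y\<bar>)"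
      unfolding F_def by (rule dbound[OF cg E(2) 0])
    moreover have "(LINT y|lborel. \<bar>?g ks y\<bar>) \<le> (LINT y|lborel. E * M ^ (sum ks UNIV) * weight (y :: real^'n))"
    proof (rule integral_mono)
      show "integrable lborel (\<lambda>y. \<bar>?g ks y\<bar>)"
        by (intro integrable_abs integrable_le_weight[where C="E * M ^ (sum ks UNIV)"] borel_measurable_continuous_onI cg) (use E in auto)
    qed (use E integrable_weight in auto)
    then have "2 * B * (LINT y|lborel. \<bar>?g ks y\<bar>) \<le> 2 * B * (LINT y|lborel. E * M ^ (sum ks UNIV) * weight (y :: real^'n))"
      using B0 by (intro mult_left_mono) auto
    ultimately show ?case by (simp add: N0_def mult_ac)
  next
    case (Suc j)
    let ?p = "\<lambda>n. cut_off lam c ks (2 * m) (real (Suc n))"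
    let ?\<phi> = "\<lambda>n ls. tensor (?p n) ls :: real^'n \<Rightarrow> real"
    let ?eps = "\<lambda>n ls. LINT y|lborel. \<bar>?\<phi> n ls y - ?g (\<lambda>i. ks i + ls i) y\<bar>"
    let ?cnt = "\<lambda>is. count_list (doubled is) :: 'n \<Rightarrow> nat"
    have pt: "product_test (?p n) (2 * m) (real (Suc n))" for n by (rule cut_off_product_test) simp
    have lim: "(\<lambda>n. ?eps n ls) \<longlonglongrightarrow> 0" if "\<And>i. ls i \<le> 2 * m" for ls
      by (rule tensor_cut_off_L1[OF lam that])
    have near: "\<bar>(LINT y|lborel. d s y * ?\<phi> n ls y) - F (\<lambda>i. ks i + ls i) s\<bar> \<le> 2 * B * ?eps n ls"
      and c\<phi>: "continuous_on UNIV (?\<phi> n ls)" and b\<phi>: "\<exists>C. \<forall>y. \<bar>?\<phi> n ls y\<bar> \<le> C * weight y"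
      if ls: "\<And>i. ls i \<le> 2 * m" and s: "s \<in> {0..T}" for n ls s
    proof -
      interpret product_test "?p n" "2 * m" "real (Suc n)" by (rule pt)
      show c: "continuous_on UNIV (?\<phi> n ls)" by (rule tensor_cont[OF ls])
      obtain C where "0 \<le> C" and C: "\<And>y. \<bar>?\<phi> n ls y\<bar> \<le> C * weight y" by (rule tensor_le_weight[of ls]) (auto intro: ls)
      then show "\<exists>C. \<forall>y. \<bar>?\<phi> n ls y\<bar> \<le> C * weight y" by blast
      let ?ks = "\<lambda>i. ks i + ls i"
      have e: "(LINT y|lborel. d s y * ?\<phi> n ls y) - F ?ks s = (LINT y|lborel. d s y * (?\<phi> n ls y - ?g ?ks y))"
        unfolding F_def using intd[OF c C s] intd[OF cg E(2) s]
        by (simp add: right_diff_distrib)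
      show "\<bar>(LINT y|lborel. d s y * ?\<phi> n ls y) - F ?ks s\<bar> \<le> 2 * B * ?eps n ls"
        unfolding e
      proof (rule dbound[OF _ _ s])
        show "continuous_on UNIV (\<lambda>y. ?\<phi> n ls y - ?g ?ks y)" by (intro continuous_intros c cg)
        show "\<bar>?\<phi> n ls y - ?g ?ks y\<bar> \<le> (C + E * M ^ (sum ?ks UNIV)) * weight y" for y
          unfolding distrib_right
          by (rule order_trans[OF abs_triangle_ineq4 add_mono[OF C[of y] E(2)[of ?ks y]]])
      qed
    qed
    have cnt: "?cnt is i \<le> 2 * m" "(\<Sum>i\<in>UNIV. ?cnt is i) = 2 * m" if "length is = m" for "is" i
    proof -
      show "?cnt is i \<le> 2 * m" using count_le_length[of "doubled is" i] that by simp
      show "(\<Sum>i\<in>UNIV. ?cnt is i) = 2 * m" using sum_count_set[of "doubled is" UNIV] that by simp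
    qed
    \<comment> \<open>the cutoff error in the derivative, which tends to zero with \<open>n\<close>\<close>
    define \<eta> where "\<eta> n = A * (\<Sum>is | length is = m. 2 * B * ?eps n (?cnt is))" for n
    let ?f = "\<lambda>n s. LINT y|lborel. d s y * ?\<phi> n (\<lambda>_. 0) y"
    let ?K = "N0 * M ^ (sum ks UNIV)"
    \<comment> \<open>chosen so that its derivative is the induction hypothesis, summed over the terms of the operator, plus the error\<close>
    let ?G = "\<lambda>n s. (Q * s) ^ Suc j / fact (Suc j) * ?K + \<eta> n * s"
    have step: "\<bar>?f n s\<bar> \<le> ?G n s" for n
    proof (rule abs_le_by_derivative[OF \<open>s \<in> {0..T}\<close>])
      obtain C where C: "\<And>y. \<bar>?\<phi> n (\<lambda>_. 0) y\<bar> \<le> C * weight y" using b\<phi>[of "\<lambda>_. 0" 0 n] U.T by auto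
      have c0: "continuous_on UNIV (?\<phi> n (\<lambda>_. 0))" using c\<phi>[of "\<lambda>_. 0" 0 n] U.T by auto
      have "continuous_on {0..T} (\<lambda>s. (LINT y|lborel. u s y * ?\<phi> n (\<lambda>_. 0) y) - (LINT y|lborel. v s y * ?\<phi> n (\<lambda>_. 0) y))"
        by (intro continuous_intros U.w_integral_continuous[OF c0 C] V.w_integral_continuous[OF c0 C])
      then show "continuous_on {0..T} (?f n)"
        by (rule continuous_on_eq) (rule split[OF c0 C, symmetric])
      show "?f n 0 = 0" using init by (simp add: d_def)
      show "(?G n has_real_derivative (Q * ((Q * r) ^ j / fact j * ?K) + \<eta> n)) (at r)" for r
      proof -
        have "((\<lambda>s. (Q * s) ^ Suc j / fact (Suc j) * ?K + \<eta> n * s) has_real_derivative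
            (real (Suc j) * (Q * (Q * r) ^ j)) / fact (Suc j) * ?K + \<eta> n) (at r)"
        proof (intro DERIV_add DERIV_cmult_right DERIV_cdivide DERIV_cmult_Id)
          have "((\<lambda>s. Q * s) has_real_derivative Q) (at r)" by (rule DERIV_cmult_Id)
          from DERIV_power[OF this, of "Suc j"]
          show "((\<lambda>s. (Q * s) ^ Suc j) has_real_derivative real (Suc j) * (Q * (Q * r) ^ j)) (at r)" by simp
        qed
        moreover have "real (Suc j) * (Q * (Q * r) ^ j) / fact (Suc j) = Q * (Q * r) ^ j / fact j"
          by (simp add: fact_Suc del: of_nat_Suc)
        ultimately show ?thesis by (simp add: mult_ac)
      qed
      show "?G n 0 = 0" by simp
      fix r assume r: "r \<in> {0<..T}"
      then have r': "r \<in> {0..T}" by auto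
      let ?D = "\<lambda>ls. LINT y|lborel. d r y * ?\<phi> n ls y"
      have D: "?D (?cnt is) = (LINT y|lborel. u r y * ?\<phi> n (?cnt is) y) - (LINT y|lborel. v r y * ?\<phi> n (?cnt is) y)" if len: "length is = m" for "is"
      proof -
        obtain C where "\<And>y. \<bar>?\<phi> n (?cnt is) y\<bar> \<le> C * weight y" using b\<phi>[where ls="?cnt is" and n=n, OF cnt(1)[OF len] r'] by blast
        from split[OF c\<phi>[where ls="?cnt is" and n=n, OF cnt(1)[OF len] r'] this r'] show ?thesis .
      qed
      have "((\<lambda>s. (LINT y|lborel. u s y * ?\<phi> n (\<lambda>_. 0) y) - (LINT y|lborel. v s y * ?\<phi> n (\<lambda>_. 0) y)) has_real_derivative
         - \<alpha> r * (-1) ^ m * (\<Sum>is | length is = m. LINT y|lborel. u r y * ?\<phi> n (?cnt is) y)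
         - (- \<alpha> r * (-1) ^ m * (\<Sum>is | length is = m. LINT y|lborel. v r y * ?\<phi> n (?cnt is) y))) (at r within {0..T})"
        by (intro DERIV_diff U.weak_formulation[OF pt order_refl r] V.weak_formulation[OF pt order_refl r])
      moreover have "- \<alpha> r * (-1) ^ m * (\<Sum>is | length is = m. LINT y|lborel. u r y * ?\<phi> n (?cnt is) y)
         - (- \<alpha> r * (-1) ^ m * (\<Sum>is | length is = m. LINT y|lborel. v r y * ?\<phi> n (?cnt is) y))
        = - \<alpha> r * (-1) ^ m * (\<Sum>is | length is = m. ?D (?cnt is))"
      proof -
        have S: "(\<Sum>is | length is = m. ?D (?cnt is)) = (\<Sum>is | length is = m. LINT y|lborel. u r y * ?\<phi> n (?cnt is) y) - (\<Sum>is | length is = m. LINT y|lborel. v r y * ?\<phi> n (?cnt is) y)"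
          unfolding sum_subtractf[symmetric] by (rule sum.cong[OF refl]) (rule D, simp)
        show ?thesis unfolding S by (rule right_diff_distrib[symmetric])
      qed
      ultimately have "((\<lambda>s. (LINT y|lborel. u s y * ?\<phi> n (\<lambda>_. 0) y) - (LINT y|lborel. v s y * ?\<phi> n (\<lambda>_. 0) y)) has_real_derivative
         - \<alpha> r * (-1) ^ m * (\<Sum>is | length is = m. ?D (?cnt is))) (at r within {0..T})" by simp
      then show "(?f n has_real_derivative - \<alpha> r * (-1) ^ m * (\<Sum>is | length is = m. ?D (?cnt is))) (at r within {0..T})"
        by (rule has_field_derivative_transform_within[where d=1]) (use r' in \<open>auto simp: split[OF c0 C] simp del: of_nat_Suc\<close>)
      have tb: "\<bar>?D (?cnt is)\<bar> \<le> (Q * r) ^ j / fact j * (?K * M ^ (2 * m)) + 2 * B * ?eps n (?cnt is)" if "length is = m" for "is"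
      proof -
        have "\<bar>F (\<lambda>i. ks i + ?cnt is i) r\<bar> \<le> (Q * r) ^ j / fact j * (N0 * M ^ (\<Sum>i\<in>UNIV. ks i + ?cnt is i))"
          by (rule Suc.IH[OF r'])
        also have "M ^ (\<Sum>i\<in>UNIV. ks i + ?cnt is i) = M ^ (sum ks UNIV) * M ^ (2 * m)"
          unfolding sum.distrib cnt(2)[OF that] by (rule power_add)
        finally have "\<bar>F (\<lambda>i. ks i + ?cnt is i) r\<bar> \<le> (Q * r) ^ j / fact j * (?K * M ^ (2 * m))" by (simp add: mult.assoc)
        then show ?thesis using near[where ls="?cnt is" and n=n, OF cnt(1)[OF that] r'] by linarith
      qed
      have "\<bar>- \<alpha> r * (-1) ^ m * (\<Sum>is | length is = m. ?D (?cnt is))\<bar> = \<bar>\<alpha> r\<bar> * \<bar>\<Sum>is | length is = m. ?D (?cnt is)\<bar>"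
        by (simp add: abs_mult)
      also have "\<dots> \<le> A * (\<Sum>is | length is = m. (Q * r) ^ j / fact j * (?K * M ^ (2 * m)) + 2 * B * ?eps n (?cnt is))"
        by (intro mult_mono A[OF r'] A0 order_trans[OF sum_abs sum_mono] tb) auto
      also have "\<dots> = Q * ((Q * r) ^ j / fact j * ?K) + \<eta> n"
        unfolding sum.distrib \<eta>_def sum_constant by (simp add: Q_def N_def algebra_simps)
      finally show "\<bar>- \<alpha> r * (-1) ^ m * (\<Sum>is | length is = m. ?D (?cnt is))\<bar> \<le> Q * ((Q * r) ^ j / fact j * ?K) + \<eta> n" .
    qed
    have "(\<lambda>n. ?f n s) \<longlonglongrightarrow> F ks s"
    proof (rule LIM_zero_cancel, rule Lim_null_comparison)
      show "\<forall>\<^sub>F n in sequentially. norm (?f n s - F ks s) \<le> 2 * B * ?eps n (\<lambda>_. 0)"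
        using near[of "\<lambda>_. 0" s] Suc.prems by simp
      have "(\<lambda>n. 2 * B * ?eps n (\<lambda>_. 0)) \<longlonglongrightarrow> 2 * B * 0" by (intro tendsto_mult tendsto_const lim) simp
      then show "(\<lambda>n. 2 * B * ?eps n (\<lambda>_. 0)) \<longlonglongrightarrow> 0" by simp
    qed
    then have L1: "(\<lambda>n. \<bar>?f n s\<bar>) \<longlonglongrightarrow> \<bar>F ks s\<bar>" by (rule tendsto_rabs)
    have "(\<lambda>n. \<Sum>is | length is = m. 2 * B * ?eps n (?cnt is)) \<longlonglongrightarrow> (\<Sum>is | length (is :: 'n list) = m. 2 * B * 0)"
    proof (rule tendsto_sum)
      fix "is" :: "'n list" assume "is \<in> {is. length is = m}"
      then have len: "length is = m" by simp
      show "(\<lambda>n. 2 * B * ?eps n (?cnt is)) \<longlonglongrightarrow> 2 * B * 0"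
        by (rule tendsto_mult[OF tendsto_const lim[where ls="?cnt is"]]) (rule cnt(1)[OF len])
    qed
    then have "\<eta> \<longlonglongrightarrow> A * (\<Sum>is | length (is :: 'n list) = m. 2 * B * 0)"
      unfolding \<eta>_def by (rule tendsto_mult[OF tendsto_const])
    then have "\<eta> \<longlonglongrightarrow> 0" by simp
    then have "(\<lambda>n. ?G n s) \<longlonglongrightarrow> (Q * s) ^ Suc j / fact (Suc j) * ?K + 0 * s"
      by (rule tendsto_add[OF tendsto_const tendsto_mult[OF _ tendsto_const]])
    then have "\<bar>F ks s\<bar> \<le> (Q * s) ^ Suc j / fact (Suc j) * ?K + 0 * s"
      using step by (intro LIMSEQ_le[OF L1]) auto
    then show ?case by simp
  qed
  have "(\<lambda>j. inverse (fact j) * (Q * t) ^ j) \<longlonglongrightarrow> 0"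
    by (rule summable_LIMSEQ_zero[OF summable_exp])
  then have "(\<lambda>j. inverse (fact j) * (Q * t) ^ j * N0) \<longlonglongrightarrow> 0 * N0"
    by (intro tendsto_mult tendsto_const)
  moreover have "\<bar>F (\<lambda>_. 0) t\<bar> \<le> inverse (fact j) * (Q * t) ^ j * N0" for j
    using claim[OF t, of "\<lambda>_. 0" j] by (simp add: divide_inverse mult_ac)
  ultimately have "\<bar>F (\<lambda>_. 0) t\<bar> \<le> 0 * N0"
    by (intro LIMSEQ_le_const) auto
  then show ?thesis by (simp add: F_def d_def)
qed

text \<open>The rescaled test functions form an approximate identity at \<open>x\<close>, so the vanishing integrals
converge to a nonzero multiple of \<open>u t x - v t x\<close>.\<close>

lemma bounded_solution_unique:
  fixes u v :: "real \<Rightarrow> real^'n \<Rightarrow> real"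
  assumes u: "bounded_solution m T B \<alpha> u" and v: "bounded_solution m T B \<alpha> v"
    and init: "\<And>x. u 0 x = v 0 x" and t: "t \<in> {0..T}"
  shows "u t x = v t x"
proof -
  interpret U: bounded_solution m T B \<alpha> u by fact
  interpret V: bounded_solution m T B \<alpha> v by fact
  define d where "d y = u t y - v t y" for y
  have cd: "continuous_on UNIV d" unfolding d_def by (intro continuous_intros U.w_cont0 V.w_cont0 t)
  have [measurable]: "d \<in> borel_measurable borel" by (rule borel_measurable_continuous_onI[OF cd])
  have dB: "\<bar>d y\<bar> \<le> 2 * B" for y
    using U.wB[OF t, of y] V.wB[OF t, of y] unfolding d_def by linarith
  let ?\<psi> = "\<lambda>z :: real^'n. \<Prod>i\<in>UNIV. band_limited 0 (z $ i)"
  have i\<psi>: "integrable lborel ?\<psi>" by (rule integrable_prod_coords[OF band_limited_integrable])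
  then have [measurable]: "?\<psi> \<in> borel_measurable borel" using borel_measurable_integrable by fastforce
  have zero: "(LINT z|lborel. d (x + (1 / real (Suc n)) *\<^sub>R z) * ?\<psi> z) = 0" for n
  proof -
    let ?l = "real (Suc n)"
    let ?h = "\<lambda>y. d y * tensor (\<lambda>i. band_limited_at ?l (x $ i)) (\<lambda>_. 0) y"
    have "continuous_on UNIV ?h" by (intro continuous_intros cd tensor_continuous band_limited_at_continuous)
    then have m: "?h \<in> borel_measurable borel" by (rule borel_measurable_continuous_onI)
    have "0 = (LINT y|lborel. ?h y)"
      unfolding d_def by (rule bounded_solution_tested_zero[OF u v init _ t, symmetric]) auto
    also have "\<dots> = \<bar>1 / ?l\<bar> ^ DIM(real^'n) *\<^sub>R (LINT z|lborel. ?h (x + (1 / ?l) *\<^sub>R z))"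
      by (rule integral_scaling(1)[OF _ m]) simp
    also have "(LINT z|lborel. ?h (x + (1 / ?l) *\<^sub>R z)) = (LINT z|lborel. d (x + (1 / ?l) *\<^sub>R z) * ?\<psi> z)"
      by (simp add: tensor_def band_limited_at_def del: of_nat_Suc)
    finally show ?thesis by simp
  qed
  have "(\<lambda>n. LINT z|lborel. d (x + (1 / real (Suc n)) *\<^sub>R z) * ?\<psi> z) \<longlonglongrightarrow> (LINT z|lborel. d x * ?\<psi> z)"
  proof (rule integral_dominated_convergence[where w="\<lambda>z. 2 * B * \<bar>?\<psi> z\<bar>"])
    show "integrable lborel (\<lambda>z. 2 * B * \<bar>?\<psi> z\<bar>)" using i\<psi> by (intro integrable_mult_right integrable_abs)
    show "AE z in lborel. norm (d (x + (1 / real (Suc n)) *\<^sub>R z) * ?\<psi> z) \<le> 2 * B * \<bar>?\<psi> z\<bar>" for n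
      using dB by (intro AE_I2) (simp add: abs_mult mult_right_mono)
    have "(\<lambda>n. d (x + (1 / real (Suc n)) *\<^sub>R z) * ?\<psi> z) \<longlonglongrightarrow> d x * ?\<psi> z" for z
    proof (intro tendsto_mult tendsto_const continuous_on_tendsto_compose[OF cd])
      have "(\<lambda>n. x + (1 / real (Suc n)) *\<^sub>R z) \<longlonglongrightarrow> x + 0 *\<^sub>R z"
        by (intro tendsto_intros LIMSEQ_inverse_real_of_nat[unfolded inverse_eq_divide])
      then show "(\<lambda>n. x + (1 / real (Suc n)) *\<^sub>R z) \<longlonglongrightarrow> x" by simp
    qed auto
    then show "AE z in lborel. (\<lambda>n. d (x + (1 / real (Suc n)) *\<^sub>R z) * ?\<psi> z) \<longlonglongrightarrow> d x * ?\<psi> z" by simp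
  qed measurable
  then have "(LINT z|lborel. d x * ?\<psi> z) = 0" unfolding zero by (simp add: LIMSEQ_const_iff)
  then have "d x * (\<Prod>i\<in>(UNIV::'n set). LINT z|lborel. band_limited 0 z) = 0"
    by (simp add: integral_prod_coords[OF band_limited_integrable])
  moreover have "(\<Prod>i\<in>(UNIV::'n set). LINT z|lborel. band_limited 0 z) \<noteq> 0" using band_limited_0_integral_pos by simp
  ultimately show ?thesis by (simp add: d_def)
qed

lemma cauchy_solution_imp_bounded_solution:
  fixes u :: "real \<Rightarrow> real^'n \<Rightarrow> real"
  assumes "0 < T" "continuous_on {0..T} \<alpha>" and u: "cauchy_solution m \<gamma> T \<Omega> \<alpha> g u"
  obtains B where "\<And>C. B \<le> C \<Longrightarrow> bounded_solution m T C \<alpha> u"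
proof -
  obtain B where B: "\<And>t x. t \<in> {0..T} \<Longrightarrow> \<bar>u t x\<bar> \<le> B"
    using u unfolding cauchy_solution_def by blast
  have "bounded_solution m T C \<alpha> u" if "B \<le> C" for C
  proof
    show "\<bar>u t x\<bar> \<le> C" if "t \<in> {0..T}" for t x
      using B[OF that, of x] \<open>B \<le> C\<close> by linarith
  qed (use u assms(1,2) in \<open>auto simp: cauchy_solution_def\<close>)
  then show ?thesis using that by blast
qed

lemma cauchy_solution_unique:
  fixes u v :: "real \<Rightarrow> real^'n \<Rightarrow> real"
  assumes T: "0 < T" and \<alpha>: "continuous_on {0..T} \<alpha>"
    and u: "cauchy_solution m \<gamma> T \<Omega> \<alpha> g u" and v: "cauchy_solution m \<gamma> T \<Omega> \<alpha> g v" and t: "t \<in> {0..T}"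
  shows "u t x = v t x"
proof -
  obtain B1 where "\<And>C. B1 \<le> C \<Longrightarrow> bounded_solution m T C \<alpha> u"
    using cauchy_solution_imp_bounded_solution[OF T \<alpha> u] by blast
  moreover obtain B2 where "\<And>C. B2 \<le> C \<Longrightarrow> bounded_solution m T C \<alpha> v"
    using cauchy_solution_imp_bounded_solution[OF T \<alpha> v] by blast
  ultimately have "bounded_solution m T (max B1 B2) \<alpha> u" "bounded_solution m T (max B1 B2) \<alpha> v"
    by auto
  moreover have "u 0 x = v 0 x" for x using u v by (simp add: cauchy_solution_def)
  ultimately show ?thesis using t by (rule bounded_solution_unique)
qed

section \<open>The inverse problem\<close>

lemma petrovskii_parabolic_lower_bound:
  assumes "petrovskii_parabolic TYPE('n::finite) m T \<alpha>"
  obtains \<delta> where "0 < \<delta>" "\<And>t. t \<in> {0..T} \<Longrightarrow> \<delta> \<le> \<alpha> t"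
proof -
  obtain \<delta> where \<delta>: "0 < \<delta>" "\<And>t \<xi> :: real^'n. t \<in> {0..T} \<Longrightarrow> \<delta> * norm \<xi> ^ (2 * m) \<le> \<alpha> t * norm \<xi> ^ (2 * m)"
    using assms unfolding petrovskii_parabolic_def by blast
  have "\<delta> \<le> \<alpha> t" if "t \<in> {0..T}" for t
    using \<delta>(2)[OF that, of "axis undefined 1"] by simp
  with \<delta>(1) that show ?thesis by blast
qed

text \<open>By uniqueness both solutions are Poisson integrals, and the operator \<open>(-\<Delta>)\<^sup>m\<close> passes from
\<open>u\<close> to its initial datum; hence \<open>(-\<Delta>)\<^sup>m u = - v\<close>, and the equation for \<open>u\<close> becomes a
relation between the two traces.\<close>

lemma (in parabolic_coefficient) cauchy_solution_trace_derivative: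
  fixes u0 :: "real^'n \<Rightarrow> real"
  assumes m: "1 \<le> m" and u0: "Ck_Holder_compact (2 * m + 2 * m) \<gamma> K u0" and \<gamma>: "0 < \<gamma>" "\<gamma> < 1"
    and u: "cauchy_solution m \<gamma> T \<Omega> \<alpha> u0 u"
    and v: "cauchy_solution m \<gamma> T \<Omega> \<alpha> (\<lambda>x. - neg_laplacian_pow m u0 x) v"
    and t: "t \<in> {0<..T}"
  shows "((\<lambda>s. u s q) has_real_derivative \<alpha> t * v t q) (at t within {0..T})"
proof -
  let ?r = "root (2 * m) (primitive t)"
  have t': "t \<in> {0..T}" using t by auto
  have g: "Ck_Holder_compact (2 * m) \<gamma> K u0"
    by (rule Ck_Holder_compact_lower[OF u0 \<gamma>]) (use m in simp)
  have g': "Ck_Holder_compact (2 * m) \<gamma> K (\<lambda>x. - neg_laplacian_pow m u0 x)"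
    using Ck_Holder_compact_neg_laplacian_pow[OF u0, of "-1"] by simp
  have "u t = kernel_average m ?r u0"
    using cauchy_solution_unique[OF T cont u cauchy_solution_kernel_average[OF m g \<gamma>(1)] t'] by auto
  then have "neg_laplacian_pow m (u t) q = kernel_average m ?r (neg_laplacian_pow m u0) q"
    using neg_laplacian_pow_kernel_average[OF m g \<gamma>(1)] by simp
  also have "\<dots> = - kernel_average m ?r (\<lambda>x. - neg_laplacian_pow m u0 x) q" by (simp add: kernel_average_def)
  also have "kernel_average m ?r (\<lambda>x. - neg_laplacian_pow m u0 x) q = v t q"
    using cauchy_solution_unique[OF T cont v cauchy_solution_kernel_average[OF m g' \<gamma>(1)] t'] by simp
  finally have "neg_laplacian_pow m (u t) q = - v t q" .
  moreover have "((\<lambda>s. u s q) has_real_derivative - \<alpha> t * neg_laplacian_pow m (u t) q) (at t within {0..T})"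
    using u t unfolding cauchy_solution_def by blast
  ultimately show ?thesis by simp
qed

lemma has_real_derivative_unique_Icc:
  fixes f :: "real \<Rightarrow> real"
  assumes "(f has_real_derivative a) (at t within {0..T})" "(f has_real_derivative b) (at t within {0..T})"
    and "0 < T" "t \<in> {0..T}"
  shows "a = b"
proof -
  have "at t within {0..T} \<noteq> bot"
    using assms(3,4) by (simp add: trivial_limit_within islimpt_Icc)
  then show ?thesis using assms(1,2) unfolding has_field_derivative_iff by (rule tendsto_unique)
qed

theorem theorem3p2:
  fixes m :: nat and T \<gamma> :: real
    and \<Omega> :: "(real ^ 'n) set" and q :: "real ^ 'n"
    and u0 :: "real ^ 'n \<Rightarrow> real" and h1 h1' h2 :: "real \<Rightarrow> real"
  assumes "1 \<le> m" and "0 < T" and "0 < \<gamma>" and "\<gamma> < 1"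
    and "open \<Omega>" and "bounded \<Omega>" and "piecewise_smooth_boundary \<Omega>" and "q \<in> \<Omega>"
    and u0_regular: "Ck_Holder_on (4 * m) \<gamma> \<Omega> u0"
    and u0_support: "closure {x. u0 x \<noteq> 0} \<subseteq> \<Omega>"
    and h1_deriv: "\<And>t. t \<in> {0..T} \<Longrightarrow> (h1 has_real_derivative h1' t) (at t within {0..T})"
    and h1'_cont: "continuous_on {0..T} h1'"
    and h2_cont: "continuous_on {0..T} h2"
    and h2_nonzero: "\<And>t. t \<in> {0..T} \<Longrightarrow> h2 t \<noteq> 0"
    and parabolic: "petrovskii_parabolic TYPE('n) m T (\<lambda>t. h1' t / h2 t)"
    and h1_compatible: "h1 0 = u0 q"
    and h2_is_trace: "\<And>v t. cauchy_solution m \<gamma> T \<Omega> (\<lambda>t. h1' t / h2 t)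
                               (\<lambda>x. - neg_laplacian_pow m u0 x) v \<Longrightarrow> t \<in> {0..T} \<Longrightarrow> v t q = h2 t"
  shows "\<exists>\<alpha> u v.
           inverse_solution m \<gamma> T \<Omega> q u0 h1 h2 \<alpha> u v \<and>
           (\<forall>t\<in>{0..T}. \<alpha> t = h1' t / h2 t) \<and>
           (\<forall>t\<in>{0<..T}. \<forall>x.
              complex_of_real (u t x) = poisson_integral m \<Omega> \<alpha> u0 t x \<and>
              complex_of_real (v t x) =
                poisson_integral m \<Omega> \<alpha> (\<lambda>x. - neg_laplacian_pow m u0 x) t x) \<and>
           (\<forall>\<beta> w z. inverse_solution m \<gamma> T \<Omega> q u0 h1 h2 \<beta> w z \<longrightarrow>
              (\<forall>t\<in>{0..T}. \<beta> t = \<alpha> t \<and> (\<forall>x. w t x = u t x \<and> z t x = v t x)))"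
proof -
  define \<alpha> where "\<alpha> = (\<lambda>t. h1' t / h2 t)"
  define v0 where "v0 = (\<lambda>x. - neg_laplacian_pow m u0 x)"
  define K where "K = closure {x. u0 x \<noteq> 0}"
  have m: "1 \<le> m" and T: "0 < T" and \<gamma>: "0 < \<gamma>" "\<gamma> < 1" by fact+
  have U0: "Ck_Holder_compact (2 * m + 2 * m) \<gamma> K u0"
    using Ck_Holder_on_imp_Ck_Holder_compact[OF u0_regular \<open>open \<Omega>\<close> \<open>bounded \<Omega>\<close> \<gamma>(1) u0_support]
    by (simp add: K_def)
  have u0: "Ck_Holder_compact (2 * m) \<gamma> K u0"
    by (rule Ck_Holder_compact_lower[OF U0 \<gamma>]) (use m in simp)
  have v0: "Ck_Holder_compact (2 * m) \<gamma> K v0"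
    using Ck_Holder_compact_neg_laplacian_pow[OF U0, of "-1"] by (simp add: v0_def)
  have \<alpha>_cont: "continuous_on {0..T} \<alpha>"
    unfolding \<alpha>_def by (intro continuous_intros h1'_cont h2_cont) (use h2_nonzero in auto)
  obtain \<delta> where \<delta>: "0 < \<delta>" "\<And>t. t \<in> {0..T} \<Longrightarrow> \<delta> \<le> \<alpha> t"
    using petrovskii_parabolic_lower_bound[OF parabolic] unfolding \<alpha>_def by blast
  interpret P: parabolic_coefficient \<alpha> T \<delta>
    by unfold_locales (use T \<alpha>_cont \<delta> in auto)
  define u where "u = (\<lambda>t. kernel_average m (root (2 * m) (P.primitive t)) u0)"
  define v where "v = (\<lambda>t. kernel_average m (root (2 * m) (P.primitive t)) v0)"
  have cu: "cauchy_solution m \<gamma> T \<Omega> \<alpha> u0 u"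
    unfolding u_def by (rule P.cauchy_solution_kernel_average[OF m u0 \<gamma>(1)])
  have cv: "cauchy_solution m \<gamma> T \<Omega> \<alpha> v0 v"
    unfolding v_def by (rule P.cauchy_solution_kernel_average[OF m v0 \<gamma>(1)])
  have vq: "v t q = h2 t" if "t \<in> {0..T}" for t
    using h2_is_trace[OF cv[unfolded \<alpha>_def v0_def] that] .
  \<comment> \<open>the derivative of the difference of the traces is \<open>\<alpha> h2 - h1' = 0\<close>, and the difference vanishes initially\<close>
  have uq: "u t q = h1 t" if t: "t \<in> {0..T}" for t
  proof -
    obtain B where "\<And>C. B \<le> C \<Longrightarrow> bounded_solution m T C \<alpha> u"
      using cauchy_solution_imp_bounded_solution[OF T \<alpha>_cont cu] by blast
    then interpret bounded_solution m T B \<alpha> u by blast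
    have "\<bar>u t q - h1 t\<bar> \<le> 0 * t"
    proof (rule abs_le_by_derivative[OF t, where f="\<lambda>t. u t q - h1 t" and f'="\<lambda>_. 0" and G'="\<lambda>_. 0"])
      have "continuous_on {0..T} h1" using h1_deriv by (rule DERIV_continuous_on)
      then show "continuous_on {0..T} (\<lambda>t. u t q - h1 t)"
        by (intro continuous_on_diff w_cont_time)
      show "u 0 q - h1 0 = 0" using cu h1_compatible by (simp add: cauchy_solution_def)
      fix s assume s: "s \<in> {0<..T}"
      then have s': "s \<in> {0..T}" by auto
      have "((\<lambda>s. u s q) has_real_derivative \<alpha> s * v s q) (at s within {0..T})"
        by (rule P.cauchy_solution_trace_derivative[OF m U0 \<gamma> cu cv[unfolded v0_def] s])
      from DERIV_diff[OF this h1_deriv[OF s']]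
      show "((\<lambda>t. u t q - h1 t) has_real_derivative 0) (at s within {0..T})"
        using h2_nonzero[OF s'] by (simp add: vq[OF s'] \<alpha>_def)
    qed auto
    then show ?thesis by simp
  qed
  have sol: "inverse_solution m \<gamma> T \<Omega> q u0 h1 h2 \<alpha> u v"
    unfolding inverse_solution_def
    using \<alpha>_cont parabolic cu cv uq vq by (simp add: \<alpha>_def v0_def)
  have zero: "u0 x = 0" "v0 x = 0" if "x \<notin> \<Omega>" for x
  proof -
    have "x \<notin> K" using that u0_support by (auto simp: K_def)
    then have "iter_partial [] u0 x = 0" "iter_partial [] v0 x = 0"
      using u0 v0 unfolding Ck_Holder_compact_def by blast+
    then show "u0 x = 0" "v0 x = 0" by simp_all
  qed
  have meas: "u0 \<in> borel_measurable borel" "v0 \<in> borel_measurable borel"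
    using Ck_Holder_compact_continuous[OF u0 \<gamma>(1), of "[]"] Ck_Holder_compact_continuous[OF v0 \<gamma>(1), of "[]"]
    by (auto intro: borel_measurable_continuous_onI)
  have poisson: "complex_of_real (u t x) = poisson_integral m \<Omega> \<alpha> u0 t x"
    "complex_of_real (v t x) = poisson_integral m \<Omega> \<alpha> v0 t x" if "t \<in> {0<..T}" for t x
    unfolding u_def v_def
    using P.poisson_integral_kernel_average[OF m meas(1) zero(1) that] P.poisson_integral_kernel_average[OF m meas(2) zero(2) that] by auto
  have unique: "\<beta> t = \<alpha> t \<and> (\<forall>x. w t x = u t x \<and> z t x = v t x)"
    if inv: "inverse_solution m \<gamma> T \<Omega> q u0 h1 h2 \<beta> w z" and t: "t \<in> {0..T}" for \<beta> w z t
  proof -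
    have \<beta>: "continuous_on {0..T} \<beta>" "petrovskii_parabolic TYPE('n) m T \<beta>"
      and cw: "cauchy_solution m \<gamma> T \<Omega> \<beta> u0 w" and wq: "\<And>t. t \<in> {0..T} \<Longrightarrow> w t q = h1 t"
      and cz: "cauchy_solution m \<gamma> T \<Omega> \<beta> v0 z" and zq: "\<And>t. t \<in> {0..T} \<Longrightarrow> z t q = h2 t"
      using inv unfolding inverse_solution_def v0_def by blast+
    obtain \<epsilon> where \<epsilon>: "0 < \<epsilon>" "\<And>t. t \<in> {0..T} \<Longrightarrow> \<epsilon> \<le> \<beta> t"
      using petrovskii_parabolic_lower_bound[OF \<beta>(2)] by blast
    interpret Q: parabolic_coefficient \<beta> T \<epsilon>
      by unfold_locales (use T \<beta> \<epsilon> in auto)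
    \<comment> \<open>the equation holds for positive times only; the value at time zero follows by continuity\<close>
    have pos: "\<beta> s = \<alpha> s" if s: "s \<in> {0<..T}" for s
    proof -
      have s': "s \<in> {0..T}" using s by auto
      have "((\<lambda>s. w s q) has_real_derivative \<beta> s * z s q) (at s within {0..T})"
        by (rule Q.cauchy_solution_trace_derivative[OF m U0 \<gamma> cw cz[unfolded v0_def] s])
      then have "(h1 has_real_derivative \<beta> s * h2 s) (at s within {0..T})"
        unfolding zq[OF s'] by (rule has_field_derivative_transform_within[where d=1]) (use s' wq in auto)
      then have "\<beta> s * h2 s = h1' s"
        using h1_deriv[OF s'] T s' by (rule has_real_derivative_unique_Icc)
      then show ?thesis using h2_nonzero[OF s'] by (simp add: \<alpha>_def field_simps)
    qed
    have eq: "\<beta> s = \<alpha> s" if s: "s \<in> {0..T}" for s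
    proof (cases "s = 0")
      case False
      then show ?thesis using pos s by auto
    next
      case True
      have "continuous_on {0..T} (\<lambda>s. \<beta> s - \<alpha> s)" by (intro continuous_on_diff \<beta>(1) \<alpha>_cont)
      moreover have "(\<lambda>n. T * (1 / real (Suc n))) \<longlonglongrightarrow> T * 0"
        by (intro tendsto_intros LIMSEQ_inverse_real_of_nat[unfolded inverse_eq_divide])
      moreover have range: "T * (1 / real (Suc n)) \<in> {0<..T}" for n
        using T by (simp add: pos_divide_le_eq algebra_simps)
      ultimately have "(\<lambda>n. \<beta> (T * (1 / real (Suc n))) - \<alpha> (T * (1 / real (Suc n)))) \<longlonglongrightarrow> \<beta> (T * 0) - \<alpha> (T * 0)"
        using T by (intro continuous_on_tendsto_compose[where f="\<lambda>s. \<beta> s - \<alpha> s"]) (auto simp: less_imp_le simp del: of_nat_Suc)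
      then show ?thesis using pos[OF range] True by (simp add: LIMSEQ_const_iff)
    qed
    have cw': "cauchy_solution m \<gamma> T \<Omega> \<alpha> u0 w" and cz': "cauchy_solution m \<gamma> T \<Omega> \<alpha> v0 z"
      using cw cz eq by (auto simp: cauchy_solution_def)
    show ?thesis
      using eq[OF t] cauchy_solution_unique[OF T \<alpha>_cont cw' cu t] cauchy_solution_unique[OF T \<alpha>_cont cz' cv t] by simp
  qed
  show ?thesis
    using sol poisson unique unfolding \<alpha>_def v0_def by blast
qed

end
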